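(* For each $n$, consider the model $y_i=x_i'\beta_0+\sigma\epsilon_i$ $(i=1,\dots,n)$ with fixed regressors $x_i\in\mathbb{R}^p$ normalized so that $n^{-1}\sum_{i=1}^nx_{ij}^2=1$ $(j=1,\dots,p)$, $\sigma>0$, $T=\mathrm{supp}(\beta_0)$ having $s<n$ elements, and errors $\epsilon_i$ i.i.d. with law $F_0$ such that $E_{F_0}(\epsilon_i)=0$ and $E_{F_0}(\epsilon_i^2)=1$. Let $c>1$ be a constant and $\bar c=(c+1)/(c-1)$. Suppose that: (RE) there exist finite constants $n_0>0$ and $\kappa>0$ such that $\kappa_{\bar c}\ge\kappa$ and $\tilde\kappa_{\bar c}\ge\kappa$ for all $n>n_0$; (M) there exists a finite constant $q>2$ such that the law $F_0$ is an element of the family $\mathcal F$ with $\sup_{n\ge1}\sup_{F\in\mathcal F}E_F(|\epsilon|^q)<\infty$, and the design $X$ obeys $\sup_{n\ge1,\,1\le j\le p}n^{-1}\sum_{i=1}^n|x_{ij}|^q<\infty$; (R) as $n\to\infty$, $p\le\alpha n^{\eta(q-2)/2}/2$ for some constant $0<\eta<1$, and $\alpha^{-1}=o\big[n^{\{(q/2-1)\wedge(q/4)\}\vee(q/2-2)}/(\log n)^{q/2}\big]$, with $q$ as in (M); and $(s/n)\log(p/\alpha)\to0$ as $n\to\infty$. Let $\lambda$ be specified according to any one of: the asymptotic option $\lambda=c\,n^{1/2}\Phi^{-1}(1-\alpha/2p)$; the exact option $\lambda=c\,\Lambda_{F}(1-\alpha\mid X)$ with $F=F_0$; or the semi-exact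 option $\lambda=c\max_{F\in\mathcal F}\Lambda_F(1-\alpha\mid X)$. Let $\hat\beta$ be the square-root lasso estimator with penalty level $\lambda$. Then there is an $o(1)$ term such that with probability at least $1-\alpha-o(\alpha)$, $$\kappa\|\hat\beta-\beta_0\|_2\le\|\hat\beta-\beta_0\|_{2,n}\le C_n\,\sigma\Big\{\frac{2s\log(2p/\alpha)}{n}\Big\}^{1/2},\qquad C_n=\frac{2(1+c)}{\kappa\{1-o(1)\}}.$$
   Context: Asymptotics: $n\to\infty$ and $p=p_n\to\infty$; $s=s_n$ may tend to infinity, and all true parameters ($\beta_0,\sigma,F_0$), the design and $\alpha$ may depend on $n$. The level $0<\alpha<1$ is bounded away from $1$ but may approach $0$. $o(\cdot)$ is with respect to $n\to\infty$. $a\wedge b=\min(a,b)$, $a\vee b=\max(a,b)$. Notation: $E_n(f)=n^{-1}\sum_{i=1}^nf(z_i)$; $E_F$ is expectation when $\epsilon$ has law $F$; $\Phi$ is the standard normal distribution function; $X$ is the fixed design with rows $x_i'$. $\delta_T$ keeps the coordinates of $\delta$ in $T$ and sets the others to $0$. The prediction norm is $\|\delta\|_{2,n}=[n^{-1}\sum_i(x_i'\delta)^2]^{1/2}$. Square-root lasso: $\hat\beta\in\arg\min_{\beta\in\mathbb{R}^p}\{n^{-1}\sum_i(y_i-x_i'\beta)^2\}^{1/2}+\frac\lambda n\|\beta\|_1$. $\mathcal F$ is a family of laws on $\mathbb{R}$. For a law $F$, $\Lambda_F(1-\alpha\mid X)$ is the $(1-\alpha)$-quantile, given the fixed design $X$,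 of $\Lambda_F=n\|E_n(x\xi)\|_\infty/\{E_n(\xi^2)\}^{1/2}$, where $\xi_1,\dots,\xi_n$ are i.i.d. with law $F$ and $E_n(x\xi)=n^{-1}\sum_ix_i\xi_i$. $\mathcal F$ is assumed finite or, more generally, such that the maximum $\max_{F\in\mathcal F}\Lambda_F(1-\alpha\mid X)$ is well defined. Restricted eigenvalues: $\Delta_{\bar c}=\{\delta\in\mathbb{R}^p:\|\delta_{T^c}\|_1\le\bar c\|\delta_T\|_1,\ \delta\ne0\}$, $\kappa_{\bar c}=\min_{\delta\in\Delta_{\bar c}}s^{1/2}\|\delta\|_{2,n}/\|\delta_T\|_1$, $\tilde\kappa_{\bar c}=\min_{\delta\in\Delta_{\bar c}}\|\delta\|_{2,n}/\|\delta\|_2$.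
   Formalization: For the semi-exact option, every law F in the family is additionally assumed to satisfy E_F(ε)=0 and E_F(ε²)=1; without this the claim fails, e.g. if the family contains the point mass at 1 and x_{i1}=1 for all i (then the estimator is 0). *)

theory Defs
  imports "HOL-Probability.Probability" "HOL-Library.Landau_Symbols"
begin

(* Since p depends on n, R^p is the set of functions on nat vanishing outside {1..p}.
   Observations are indexed by {1..n}; x i j is the j-th regressor of observation i. *)

definition Rvec :: "nat \<Rightarrow> (nat \<Rightarrow> real) set" where
  "Rvec p = {v. \<forall>j. j \<notin> {1..p} \<longrightarrow> v j = 0}"

definition supp :: "(nat \<Rightarrow> real) \<Rightarrow> nat set" where
  "supp v = {j. v j \<noteq> 0}"

definition restr :: "nat set \<Rightarrow> (nat \<Rightarrow> real) \<Rightarrow> nat \<Rightarrow> real" where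
  "restr T v = (\<lambda>j. if j \<in> T then v j else 0)"

definition l1_norm :: "nat \<Rightarrow> (nat \<Rightarrow> real) \<Rightarrow> real" where
  "l1_norm p v = (\<Sum>j=1..p. \<bar>v j\<bar>)"

definition l2_norm :: "nat \<Rightarrow> (nat \<Rightarrow> real) \<Rightarrow> real" where
  "l2_norm p v = L2_set v {1..p}"

definition emp_mean :: "nat \<Rightarrow> (nat \<Rightarrow> real) \<Rightarrow> real" where
  "emp_mean n f = (\<Sum>i=1..n. f i) / real n"

definition lin_pred :: "nat \<Rightarrow> (nat \<Rightarrow> nat \<Rightarrow> real) \<Rightarrow> (nat \<Rightarrow> real) \<Rightarrow> nat \<Rightarrow> real" where
  "lin_pred p x v i = (\<Sum>j=1..p. x i j * v j)"

definition pred_norm :: "nat \<Rightarrow> nat \<Rightarrow> (nat \<Rightarrow> nat \<Rightarrow> real) \<Rightarrow> (nat \<Rightarrow> real) \<Rightarrow> real" where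
  "pred_norm n p x v = sqrt (emp_mean n (\<lambda>i. (lin_pred p x v i)\<^sup>2))"

definition sqrt_lasso_obj ::
  "nat \<Rightarrow> nat \<Rightarrow> (nat \<Rightarrow> nat \<Rightarrow> real) \<Rightarrow> (nat \<Rightarrow> real) \<Rightarrow> real \<Rightarrow> (nat \<Rightarrow> real) \<Rightarrow> real" where
  "sqrt_lasso_obj n p x y lam \<beta> =
     sqrt (emp_mean n (\<lambda>i. (y i - lin_pred p x \<beta> i)\<^sup>2)) + lam / real n * l1_norm p \<beta>"

definition is_sqrt_lasso ::
  "nat \<Rightarrow> nat \<Rightarrow> (nat \<Rightarrow> nat \<Rightarrow> real) \<Rightarrow> (nat \<Rightarrow> real) \<Rightarrow> real \<Rightarrow> (nat \<Rightarrow> real) \<Rightarrow> bool" where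
  "is_sqrt_lasso n p x y lam b \<longleftrightarrow> is_arg_min (sqrt_lasso_obj n p x y lam) (\<lambda>\<beta>. \<beta> \<in> Rvec p) b"

definition restricted_cone :: "nat \<Rightarrow> nat set \<Rightarrow> real \<Rightarrow> (nat \<Rightarrow> real) set" where
  "restricted_cone p T cbar =
     {\<delta> \<in> Rvec p. l1_norm p (restr (- T) \<delta>) \<le> cbar * l1_norm p (restr T \<delta>) \<and> \<delta> \<noteq> (\<lambda>_. 0)}"

(* The infima are taken in ereal so that they are infinite, and not an unspecified real,
   when the cone is empty (T = {}). For nonempty T the minima are attained by homogeneity
   and compactness, and the denominators are nonzero on the cone. *)

definition re_kappa :: "nat \<Rightarrow> nat \<Rightarrow> (nat \<Rightarrow> nat \<Rightarrow> real) \<Rightarrow> nat set \<Rightarrow> real \<Rightarrow> ereal" where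
  "re_kappa n p x T cbar =
     (INF \<delta>\<in>restricted_cone p T cbar.
        ereal (sqrt (real (card T)) * pred_norm n p x \<delta> / l1_norm p (restr T \<delta>)))"

definition re_kappa_tilde :: "nat \<Rightarrow> nat \<Rightarrow> (nat \<Rightarrow> nat \<Rightarrow> real) \<Rightarrow> nat set \<Rightarrow> real \<Rightarrow> ereal" where
  "re_kappa_tilde n p x T cbar =
     (INF \<delta>\<in>restricted_cone p T cbar. ereal (pred_norm n p x \<delta> / l2_norm p \<delta>))"

definition standardized_law :: "real measure \<Rightarrow> bool" where
  "standardized_law F \<longleftrightarrow>
     has_bochner_integral F (\<lambda>e. e) 0 \<and> has_bochner_integral F (\<lambda>e. e\<^sup>2) 1"

definition std_normal_quantile :: "real \<Rightarrow> real" where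
  "std_normal_quantile u = (THE z. cdf std_normal_distribution z = u)"

definition quantile :: "'a measure \<Rightarrow> ('a \<Rightarrow> real) \<Rightarrow> real \<Rightarrow> real" where
  "quantile M Z u = Inf {t. u \<le> measure M {\<omega> \<in> space M. Z \<omega> \<le> t}}"

definition Lambda_stat :: "nat \<Rightarrow> nat \<Rightarrow> (nat \<Rightarrow> nat \<Rightarrow> real) \<Rightarrow> (nat \<Rightarrow> real) \<Rightarrow> real" where
  "Lambda_stat n p x \<xi> =
     real n * Max ((\<lambda>j. \<bar>emp_mean n (\<lambda>i. x i j * \<xi> i)\<bar>) ` {1..p})
       / sqrt (emp_mean n (\<lambda>i. (\<xi> i)\<^sup>2))"

definition Lambda_quantile ::
  "nat \<Rightarrow> nat \<Rightarrow> (nat \<Rightarrow> nat \<Rightarrow> real) \<Rightarrow> real measure \<Rightarrow> real \<Rightarrow> real" where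
  "Lambda_quantile n p x F u = quantile (PiM {1..n} (\<lambda>_. F)) (Lambda_stat n p x) u"

definition Lambda_max_exists ::
  "nat \<Rightarrow> nat \<Rightarrow> (nat \<Rightarrow> nat \<Rightarrow> real) \<Rightarrow> real measure set \<Rightarrow> real \<Rightarrow> bool" where
  "Lambda_max_exists n p x \<F> u \<longleftrightarrow>
     (\<exists>F\<in>\<F>. \<forall>G\<in>\<F>. Lambda_quantile n p x G u \<le> Lambda_quantile n p x F u)"

datatype penalty_choice = Asymptotic | Exact | Semi_Exact

(* In the third equation the supremum is the maximum whenever Lambda_max_exists holds. *)
fun penalty_level ::
  "penalty_choice \<Rightarrow> real \<Rightarrow> nat \<Rightarrow> nat \<Rightarrow> (nat \<Rightarrow> nat \<Rightarrow> real) \<Rightarrow> real measure \<Rightarrow>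
   real measure set \<Rightarrow> real \<Rightarrow> real" where
  "penalty_level Asymptotic c n p x F0 \<F> \<alpha> =
     c * sqrt (real n) * std_normal_quantile (1 - \<alpha> / (2 * real p))"
| "penalty_level Exact c n p x F0 \<F> \<alpha> = c * Lambda_quantile n p x F0 (1 - \<alpha>)"
| "penalty_level Semi_Exact c n p x F0 \<F> \<alpha> =
     c * (SUP F\<in>\<F>. Lambda_quantile n p x F (1 - \<alpha>))"

end

theory Submission
  imports Defs "HOL-Real_Asymp.Real_Asymp"
begin

text \<open>
  On the event that \<open>c \<Lambda> \<le> \<lambda>\<close>, optimality of the estimator together with convexity of the root loss
  puts the error \<open>\<delta>\<close> into the restricted cone, and the restricted eigenvalues turn the difference
  of the two losses into a quadratic inequality for the prediction norm of \<open>\<delta>\<close>.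

  The probabilistic part is a moderate deviation bound for the self-normalized sums, sharp up to a factor
  \<open>1 + o(1)\<close>. The lower tail of \<open>E\<^sub>n(\<epsilon>\<^sup>2)\<close> is exponentially small, since squares are bounded below, so the
  denominator costs nothing. For the numerator, the indicator of \<open>[t, \<infinity>)\<close> is majorized by a smooth step that
  rises on a window of width of order \<open>1/t\<^sup>2\<close>, and the truncated summands are exchanged one at a time for normal
  ones. As the derivatives of the step at \<open>u\<close> are bounded by a multiple of \<open>exp (t (u - t))\<close>, the
  error of each exchange is controlled by the moment generating function at \<open>t\<close>, and so is
  polynomially small in \<open>n\<close> relative to \<open>exp (- t\<^sup>2/2)\<close>; since \<open>t\<close> is of order \<open>sqrt (ln n)\<close>, this is negligible
  against the normal tail. The rate condition with \<open>\<eta> < 1\<close> is what makes the truncation error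
  small relative to \<open>\<alpha>/p\<close>, and the bound on \<open>1/\<alpha>\<close> is what makes the upper tail of \<open>E\<^sub>n(\<epsilon>\<^sup>2)\<close> of order \<open>o(\<alpha>)\<close>.
\<close>

subsection \<open>The normal distribution\<close>

text \<open>All three penalty levels are compared with one quantity,
  \<open>c * (sqrt n * level n)\<close>, where \<open>level n\<close> is sqrt(2 ln(2p/\<alpha>)).
  The normal tail there is smaller than \<alpha>/(2p) by a further factor of order
  \<open>level n\<close>, so a crude constant suffices to bound the exact quantiles. For the score,
  precision 1 + o(1) is forced by the asymptotic option alone, where the union bound over 2p signed
  sums uses up all of \<alpha>. The window of the step must be o(1/t), because a shift by d changes
  the normal tail at t by a factor 1 + O(t d exp(t d)); the choice 1/t^2 costs only t^6 in the third
  derivative, which the polynomially small truncation level absorbs. Positivity of the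
  quantile-based penalties is a separate issue: it rests on anticoncentration of one score at 0 and
  on \<alpha> being bounded away from 1. In the final bound, 1 - r collects two vanishing losses:
  the quadratic term of the oracle inequality and the fluctuation of the empirical noise
  level.\<close>

abbreviation gauss :: "real measure" where
  "gauss \<equiv> std_normal_distribution"

definition normal_tail :: "real \<Rightarrow> real" where
  "normal_tail t = measure gauss {t<..}"

lemma real_distribution_gauss: "real_distribution gauss"
  by (rule real_dist_normal_dist)

interpretation gauss: real_distribution gauss
  by (rule real_distribution_gauss)

interpretation gauss_pair: pair_prob_space gauss gauss ..

lemma distr_gauss_pair_snd: "distr (gauss \<Otimes>\<^sub>M gauss) gauss snd = gauss"
proof (rule measure_eqI)
  fix A assume "A \<in> sets (distr (gauss \<Otimes>\<^sub>M gauss) gauss snd)"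
  then have A: "A \<in> sets gauss" by simp
  then have "emeasure (distr (gauss \<Otimes>\<^sub>M gauss) gauss snd) A = emeasure (gauss \<Otimes>\<^sub>M gauss) (space gauss \<times> A)"
    by (subst emeasure_distr) (auto simp: space_pair_measure intro!: arg_cong2[where f = emeasure])
  also have "\<dots> = emeasure gauss A"
    using A by (subst gauss.emeasure_pair_measure_Times) (auto simp: gauss.emeasure_space_1[simplified])
  finally show "emeasure (distr (gauss \<Otimes>\<^sub>M gauss) gauss snd) A = emeasure gauss A" .
qed simp

text \<open>Stability of the normal law under independent linear combinations: the characteristic
  functions multiply to that of N(0, a^2 + b^2), and Levy uniqueness identifies the laws. In the
  Lindeberg induction this merges the normal variable of one exchange with the others, so that a
  single normal integral remains.\<close>

lemma integral_gauss_conv: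
  fixes f :: "real \<Rightarrow> real"
  assumes f [measurable]: "f \<in> borel_measurable borel" and bdd: "\<And>u. \<bar>f u\<bar> \<le> K"
  shows "(\<integral>u. (\<integral>z. f (a * u + b * z) \<partial>gauss) \<partial>gauss) = (\<integral>z. f (sqrt (a\<^sup>2 + b\<^sup>2) * z) \<partial>gauss)"
proof -
  let ?P = "gauss \<Otimes>\<^sub>M gauss"
  have char_scaled: "char (distr gauss borel (\<lambda>z. r * z)) t = exp (- (r * t)\<^sup>2 / 2)" for r t
  proof -
    have "char (distr gauss borel (\<lambda>z. r * z)) t = char gauss (r * t)"
      unfolding char_def by (subst integral_distr) (auto simp: ac_simps)
    then show ?thesis by (simp add: char_std_normal_distribution)
  qed
  have fst: "distr ?P borel (\<lambda>w. a * fst w) = distr gauss borel (\<lambda>u. a * u)"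
  proof -
    have "distr gauss borel (\<lambda>u. a * u) = distr (distr ?P gauss fst) borel (\<lambda>u. a * u)"
      by (subst gauss.distr_pair_fst) simp
    then show ?thesis by (subst (asm) distr_distr) (auto simp: comp_def)
  qed
  have snd: "distr ?P borel (\<lambda>w. b * snd w) = distr gauss borel (\<lambda>u. b * u)"
  proof -
    have "distr gauss borel (\<lambda>u. b * u) = distr (distr ?P gauss snd) borel (\<lambda>u. b * u)"
      by (subst distr_gauss_pair_snd) simp
    then show ?thesis by (subst (asm) distr_distr) (auto simp: comp_def)
  qed
  have "distr ?P gauss fst = gauss"
    by (rule gauss.distr_pair_fst)
  then have "gauss_pair.indep_var gauss fst gauss snd"
    unfolding gauss_pair.indep_var_distribution_eq by (simp add: distr_gauss_pair_snd distr_id2)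
  then have "gauss_pair.indep_var borel ((\<lambda>u. a * u) \<circ> fst) borel ((\<lambda>u. b * u) \<circ> snd)"
    by (rule gauss_pair.indep_var_compose) auto
  then have indep: "gauss_pair.indep_var borel (\<lambda>w. a * fst w) borel (\<lambda>w. b * snd w)"
    by (simp add: comp_def)
  have "distr ?P borel (\<lambda>w. a * fst w + b * snd w) = distr gauss borel (\<lambda>z. sqrt (a\<^sup>2 + b\<^sup>2) * z)"
  proof (rule Levy_uniqueness)
    show "real_distribution (distr ?P borel (\<lambda>w. a * fst w + b * snd w))"
      by (rule gauss_pair.real_distribution_distr) measurable
    show "real_distribution (distr gauss borel (\<lambda>z. sqrt (a\<^sup>2 + b\<^sup>2) * z))"
      by (rule gauss.real_distribution_distr) measurable
    show "char (distr ?P borel (\<lambda>w. a * fst w + b * snd w))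
        = char (distr gauss borel (\<lambda>z. sqrt (a\<^sup>2 + b\<^sup>2) * z))"
    proof
      fix t
      have "char (distr ?P borel (\<lambda>w. a * fst w + b * snd w)) t
          = complex_of_real (exp (- (a * t)\<^sup>2 / 2)) * exp (- (b * t)\<^sup>2 / 2)"
        by (subst gauss_pair.char_distr_add[OF indep]) (simp add: fst snd char_scaled)
      also have "\<dots> = complex_of_real (exp (- (a * t)\<^sup>2 / 2 + - (b * t)\<^sup>2 / 2))"
        by (simp only: exp_add of_real_mult)
      also have "- (a * t)\<^sup>2 / 2 + - (b * t)\<^sup>2 / 2 = - (sqrt (a\<^sup>2 + b\<^sup>2) * t)\<^sup>2 / 2"
        by (simp add: power_mult_distrib field_simps)
      finally show "char (distr ?P borel (\<lambda>w. a * fst w + b * snd w)) t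
          = char (distr gauss borel (\<lambda>z. sqrt (a\<^sup>2 + b\<^sup>2) * z)) t"
        by (simp add: char_scaled)
    qed
  qed
  then have "(\<integral>v. f v \<partial>distr ?P borel (\<lambda>w. a * fst w + b * snd w))
      = (\<integral>v. f v \<partial>distr gauss borel (\<lambda>z. sqrt (a\<^sup>2 + b\<^sup>2) * z))"
    by simp
  then have "(\<integral>w. f (a * fst w + b * snd w) \<partial>?P) = (\<integral>z. f (sqrt (a\<^sup>2 + b\<^sup>2) * z) \<partial>gauss)"
    by (simp add: integral_distr)
  moreover have "integrable ?P (\<lambda>w. f (a * fst w + b * snd w))"
    by (rule gauss_pair.integrable_const_bound[where B = K]) (use bdd in auto)
  then have "(\<integral>u. (\<integral>z. f (a * u + b * z) \<partial>gauss) \<partial>gauss) = (\<integral>w. f (a * fst w + b * snd w) \<partial>?P)"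
    by (subst gauss_pair.integral_fst'[symmetric]) auto
  ultimately show ?thesis by simp
qed

text \<open>Completing the square: tilting the standard density by exp(h z) gives exp(h^2/2) times
  the normal density with mean h.\<close>

lemma gauss_mgf:
  "integrable gauss (\<lambda>z. exp (h * z))" "(\<integral>z. exp (h * z) \<partial>gauss) = exp (h\<^sup>2 / 2)"
proof -
  have eq: "std_normal_density z * exp (h * z) = exp (h\<^sup>2 / 2) * normal_density h 1 z" for z
    by (simp add: normal_density_def exp_add[symmetric] field_simps power2_eq_square)
  show "integrable gauss (\<lambda>z. exp (h * z))"
    by (subst integrable_real_density) (auto simp: eq)
  show "(\<integral>z. exp (h * z) \<partial>gauss) = exp (h\<^sup>2 / 2)"
    by (subst integral_real_density) (auto simp: eq)
qed

text \<open>The cubic term of the exponential series gives |z|^3 \<le> 6 exp |z|, so the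
  exponentials with tilts 2 and -2 dominate.\<close>

lemma integrable_gauss_cube_exp: "integrable gauss (\<lambda>z. \<bar>z\<bar> ^ 3 * exp \<bar>z\<bar>)"
proof (rule Bochner_Integration.integrable_bound)
  show "integrable gauss (\<lambda>z. 6 * exp (2 * z) + 6 * exp ((-2) * z))"
    by (intro Bochner_Integration.integrable_add integrable_mult_right gauss_mgf)
  have "\<bar>z\<bar> ^ 3 * exp \<bar>z\<bar> \<le> 6 * exp (2 * z) + 6 * exp ((-2) * z)" for z :: real
  proof -
    have "(\<Sum>k\<in>{3::nat}. inverse (fact k) * \<bar>z\<bar> ^ k) \<le> (\<Sum>k. inverse (fact k) * \<bar>z\<bar> ^ k)"
      by (rule sum_le_suminf) (auto intro: summable_exp)
    then have "\<bar>z\<bar> ^ 3 / fact 3 \<le> exp \<bar>z\<bar>"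
      by (simp add: exp_def divide_inverse_commute)
    then have "\<bar>z\<bar> ^ 3 \<le> 6 * exp \<bar>z\<bar>" by (simp add: fact_numeral)
    then have "\<bar>z\<bar> ^ 3 * exp \<bar>z\<bar> \<le> 6 * exp \<bar>z\<bar> * exp \<bar>z\<bar>"
      by (intro mult_right_mono) auto
    also have "\<dots> = 6 * exp (2 * \<bar>z\<bar>)" by (simp add: exp_add[symmetric])
    also have "\<dots> \<le> 6 * exp (2 * z) + 6 * exp ((-2) * z)"
      by (cases "z \<ge> 0") auto
    finally show ?thesis .
  qed
  then show "AE z in gauss. norm (\<bar>z\<bar> ^ 3 * exp \<bar>z\<bar>) \<le> norm (6 * exp (2 * z) + 6 * exp ((-2) * z))"
    by (intro AE_I2) (simp add: abs_mult)
qed auto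

lemma gauss_interval_le:
  assumes "a \<le> b" "\<And>z. a \<le> z \<Longrightarrow> z \<le> b \<Longrightarrow> std_normal_density z \<le> K"
  shows "measure gauss {a<..b} \<le> (b - a) * K"
proof -
  have K: "0 \<le> K" using assms(2)[of a] assms(1) normal_density_nonneg[of 0 1 a] by linarith
  have "emeasure gauss {a<..b} = (\<integral>\<^sup>+z. ennreal (std_normal_density z) * indicator {a<..b} z \<partial>lborel)"
    by (subst emeasure_density) auto
  also have "\<dots> \<le> (\<integral>\<^sup>+z. ennreal K * indicator {a<..b} z \<partial>lborel)"
    by (intro nn_integral_mono) (auto simp: indicator_def intro!: ennreal_leI assms)
  also have "\<dots> = ennreal (K * (b - a))"
    using assms(1) K by (simp add: nn_integral_cmult ennreal_mult)
  finally show ?thesis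
    using K assms(1) by (simp add: gauss.emeasure_eq_measure mult.commute)
qed

lemma gauss_interval_ge:
  assumes "a \<le> b" "0 \<le> K" "\<And>z. a \<le> z \<Longrightarrow> z \<le> b \<Longrightarrow> K \<le> std_normal_density z"
  shows "(b - a) * K \<le> measure gauss {a<..b}"
proof -
  have "ennreal (K * (b - a)) = (\<integral>\<^sup>+z. ennreal K * indicator {a<..b} z \<partial>lborel)"
    using assms(1,2) by (simp add: nn_integral_cmult ennreal_mult)
  also have "\<dots> \<le> (\<integral>\<^sup>+z. ennreal (std_normal_density z) * indicator {a<..b} z \<partial>lborel)"
    by (intro nn_integral_mono) (auto simp: indicator_def intro!: ennreal_leI assms)
  also have "\<dots> = emeasure gauss {a<..b}"
    by (subst emeasure_density) auto
  finally show ?thesis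
    by (simp add: gauss.emeasure_eq_measure mult.commute)
qed

lemma normal_tail_antimono: "a \<le> b \<Longrightarrow> normal_tail b \<le> normal_tail a"
  unfolding normal_tail_def by (intro gauss.finite_measure_mono) auto

lemma normal_tail_nonneg [simp]: "0 \<le> normal_tail t"
  by (simp add: normal_tail_def)

lemma normal_tail_diff:
  assumes "a \<le> b" shows "normal_tail a = normal_tail b + measure gauss {a<..b}"
proof -
  have "measure gauss ({b<..} \<union> {a<..b}) = measure gauss {b<..} + measure gauss {a<..b}"
    by (rule gauss.finite_measure_Union) auto
  moreover have "{b<..} \<union> {a<..b} = {a<..}" using assms by auto
  ultimately show ?thesis by (simp add: normal_tail_def)
qed

text \<open>Mills ratio bound: on z > t the weight z/t is at least 1, and it makes the integrand an
  exact derivative.\<close>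

lemma normal_tail_le_density:
  assumes "0 < t" shows "normal_tail t \<le> exp (- t\<^sup>2 / 2) / (t * sqrt (2 * pi))"
proof -
  have "emeasure gauss {t<..} = (\<integral>\<^sup>+z. ennreal (std_normal_density z) * indicator {t<..} z \<partial>lborel)"
    by (subst emeasure_density) auto
  also have "\<dots> \<le> (\<integral>\<^sup>+z. ennreal (z / t * std_normal_density z) * indicator {t..} z \<partial>lborel)"
  proof (intro nn_integral_mono)
    fix z
    have "std_normal_density z \<le> z / t * std_normal_density z" if "t < z"
      using mult_right_mono[of 1 "z / t" "std_normal_density z"] that assms by simp
    then show "ennreal (std_normal_density z) * indicator {t<..} z
        \<le> ennreal (z / t * std_normal_density z) * indicator {t..} z"
      by (auto simp: indicator_def intro!: ennreal_leI)
  qed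
  also have "\<dots> = ennreal (0 - (- (std_normal_density t / t)))"
  proof (rule nn_integral_FTC_atLeast[where F = "\<lambda>z. - (std_normal_density z / t)" and T = 0])
    show "((\<lambda>z. - (std_normal_density z / t)) has_real_derivative z / t * std_normal_density z) (at z)" if "t \<le> z" for z
      unfolding std_normal_density_def using assms
      by (auto intro!: derivative_eq_intros simp: field_simps)
    show "((\<lambda>z. - (std_normal_density z / t)) \<longlongrightarrow> 0) at_top"
      unfolding std_normal_density_def using assms by real_asymp
  qed (use assms in auto)
  finally have "normal_tail t \<le> std_normal_density t / t"
    unfolding normal_tail_def using assms by (simp add: gauss.emeasure_eq_measure)
  then show ?thesis by (simp add: std_normal_density_def field_simps)
qed

text \<open>Converse Mills bound, from the window (t, t + 1/t] alone: over it the exponent drops by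
  at most 3/2, because t * (1/t) = 1 and 1/t \<le> 1. The constant 20 is a round bound for exp(3/2)
  * sqrt(2 pi).\<close>

lemma normal_tail_ge_density:
  assumes "1 \<le> t" shows "exp (- t\<^sup>2 / 2) \<le> 20 * t * normal_tail t"
proof -
  have "((t + 1 / t) - t) * std_normal_density (t + 1 / t) \<le> measure gauss {t<..t + 1 / t}"
    by (rule gauss_interval_ge) (use assms in \<open>auto simp: std_normal_density_def divide_right_mono intro!: power_mono\<close>)
  also have "\<dots> \<le> normal_tail t"
    unfolding normal_tail_def by (intro gauss.finite_measure_mono) auto
  finally have *: "std_normal_density (t + 1 / t) \<le> t * normal_tail t"
    using assms by (simp add: field_simps)
  have "1 / t \<le> 1" using assms by simp
  then have "(1 / t)\<^sup>2 \<le> 1" using assms by (simp add: power_le_one)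
  moreover have "(t + 1 / t)\<^sup>2 = t\<^sup>2 + 2 + (1 / t)\<^sup>2"
    using assms by (simp add: power2_eq_square field_simps)
  ultimately have "exp (- t\<^sup>2 / 2 - 3 / 2) \<le> exp (- (t + 1 / t)\<^sup>2 / 2)"
    by (simp add: field_simps)
  then have "exp (- t\<^sup>2 / 2) \<le> exp (3 / 2) * exp (- (t + 1 / t)\<^sup>2 / 2)"
    by (simp add: exp_diff divide_le_eq mult.commute)
  also have "exp (- (t + 1 / t)\<^sup>2 / 2) = sqrt (2 * pi) * std_normal_density (t + 1 / t)"
    by (simp add: std_normal_density_def)
  also have "\<dots> \<le> sqrt (2 * pi) * (t * normal_tail t)"
    using * by (intro mult_left_mono) auto
  finally have "exp (- t\<^sup>2 / 2) \<le> (exp (3 / 2) * sqrt (2 * pi)) * (t * normal_tail t)"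
    by (simp add: mult.assoc)
  also have "\<dots> \<le> 20 * (t * normal_tail t)"
  proof (intro mult_right_mono)
    have "exp (3 / 2 :: real) ^ 2 = exp 1 ^ 3" by (simp add: exp_of_nat_mult[symmetric] exp_add[symmetric] power2_eq_square)
    also have "\<dots> \<le> 3 ^ 3" using exp_le by (intro power_mono) auto
    finally have "exp (3 / 2 :: real) ^ 2 \<le> 27" by simp
    moreover have "sqrt (2 * pi) ^ 2 \<le> 8" using pi_less_4 by simp
    ultimately have "(exp (3 / 2) * sqrt (2 * pi))\<^sup>2 \<le> 27 * 8"
      unfolding power_mult_distrib by (intro mult_mono) auto
    also have "\<dots> \<le> (20::real)\<^sup>2" by simp
    finally show "exp (3 / 2) * sqrt (2 * pi) \<le> 20" by (rule power2_le_imp_le) simp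
  qed (use assms in auto)
  finally show ?thesis by simp
qed

text \<open>On [t - d, t] the density is at most exp(-t^2/2 + t d), and the converse Mills bound
  converts exp(-t^2/2) back into the tail at t. The relative error is small as soon as t d is, which
  dictates the width of the smoothing window.\<close>

lemma normal_tail_shift:
  assumes "0 \<le> d" "d \<le> t" "1 \<le> t"
  shows "normal_tail (t - d) \<le> normal_tail t * (1 + 20 * t * d * exp (t * d))"
proof -
  have dens: "std_normal_density z \<le> exp (- t\<^sup>2 / 2 + t * d)" if "t - d \<le> z" "z \<le> t" for z
  proof -
    have "(t - d)\<^sup>2 \<le> z\<^sup>2" using that assms by (intro power_mono) auto
    moreover have "(t - d)\<^sup>2 = t\<^sup>2 - 2 * (t * d) + d\<^sup>2"
      by (simp add: power2_eq_square algebra_simps)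
    ultimately have "- z\<^sup>2 / 2 \<le> - t\<^sup>2 / 2 + t * d"
      using zero_le_power2[of d] by linarith
    moreover have "1 / sqrt (2 * pi) \<le> 1" using pi_ge_two by simp
    ultimately have "1 / sqrt (2 * pi) * exp (- z\<^sup>2 / 2) \<le> 1 * exp (- t\<^sup>2 / 2 + t * d)"
      by (intro mult_mono) auto
    then show ?thesis by (simp add: std_normal_density_def)
  qed
  have "normal_tail (t - d) = normal_tail t + measure gauss {t - d<..t}"
    using assms by (intro normal_tail_diff) auto
  also have "measure gauss {t - d<..t} \<le> (t - (t - d)) * exp (- t\<^sup>2 / 2 + t * d)"
    using assms by (intro gauss_interval_le dens) auto
  also have "\<dots> = exp (- t\<^sup>2 / 2) * (d * exp (t * d))" by (simp only: exp_add) simp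
  also have "\<dots> \<le> (20 * t * normal_tail t) * (d * exp (t * d))"
    using assms by (intro mult_right_mono normal_tail_ge_density) auto
  finally show ?thesis by (simp add: algebra_simps)
qed

subsection \<open>The Lindeberg bound with exponential weights\<close>

text \<open>The normal half of every exchange error: there the tilt h and the standard deviation r
  satisfy h r \<le> 1, so the weight exp(h |r z|) is at most exp |z|.\<close>

definition gauss_cube :: real where
  "gauss_cube = (\<integral>z. \<bar>z\<bar> ^ 3 * exp \<bar>z\<bar> \<partial>gauss)"

lemma gauss_cube_nonneg [simp]: "0 \<le> gauss_cube"
  unfolding gauss_cube_def by (rule integral_nonneg_AE) auto

text \<open>Only the inequality of a second-order Taylor expansion is recorded, with
  \<open>f1\<close> and \<open>f2\<close> in the role of the derivatives but no differentiability
  asked for; such inequalities can be integrated directly. All bounds carry the weight exp(h v), so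
  that a later expectation over v produces a moment generating function, and the weight exp(h |x|)
  pays for evaluating a third derivative between v and v + x.\<close>

definition taylor2_bound ::
  "real \<Rightarrow> real \<Rightarrow> (real \<Rightarrow> real) \<Rightarrow> (real \<Rightarrow> real) \<Rightarrow> (real \<Rightarrow> real) \<Rightarrow> bool" where
  "taylor2_bound h B f f1 f2 \<longleftrightarrow>
     f \<in> borel_measurable borel \<and> f1 \<in> borel_measurable borel \<and> f2 \<in> borel_measurable borel \<and>
     (\<forall>v. \<bar>f v\<bar> \<le> 1 \<and> \<bar>f1 v\<bar> \<le> B * exp (h * v) \<and> \<bar>f2 v\<bar> \<le> B * exp (h * v)) \<and>
     (\<forall>v x. \<bar>f (v + x) - (f v + f1 v * x + f2 v * x\<^sup>2 / 2)\<bar>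
        \<le> B * exp (h * v) * (\<bar>x\<bar> ^ 3 * exp (h * \<bar>x\<bar>)) / 6)"

lemma taylor2_boundD:
  assumes "taylor2_bound h B f f1 f2"
  shows "f \<in> borel_measurable borel" "f1 \<in> borel_measurable borel" "f2 \<in> borel_measurable borel"
    and "\<bar>f v\<bar> \<le> 1" "\<bar>f1 v\<bar> \<le> B * exp (h * v)" "\<bar>f2 v\<bar> \<le> B * exp (h * v)" "0 \<le> B"
    and "\<bar>f (v + x) - (f v + f1 v * x + f2 v * x\<^sup>2 / 2)\<bar>
        \<le> B * exp (h * v) * (\<bar>x\<bar> ^ 3 * exp (h * \<bar>x\<bar>)) / 6"
proof -
  have "\<bar>f1 0\<bar> \<le> B * exp (h * 0)" using assms unfolding taylor2_bound_def by blast
  then show "0 \<le> B" by simp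
qed (use assms in \<open>auto simp: taylor2_bound_def\<close>)

lemma taylor2_boundI:
  assumes f1: "\<And>u. (f has_real_derivative f1 u) (at u)"
    and f2: "\<And>u. (f1 has_real_derivative f2 u) (at u)"
    and f3: "\<And>u. (f2 has_real_derivative f3 u) (at u)"
    and bounds: "\<And>u. \<bar>f u\<bar> \<le> 1" "\<And>u. \<bar>f1 u\<bar> \<le> B * exp (h * u)"
      "\<And>u. \<bar>f2 u\<bar> \<le> B * exp (h * u)" "\<And>u. \<bar>f3 u\<bar> \<le> B * exp (h * u)"
    and h: "0 \<le> h"
  shows "taylor2_bound h B f f1 f2"
  unfolding taylor2_bound_def
proof (intro conjI allI)
  have meas: "g \<in> borel_measurable borel" if "\<And>u. (g has_real_derivative g' u) (at u)" for g g' :: "real \<Rightarrow> real"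
    using that by (intro borel_measurable_continuous_onI) (auto intro!: continuous_at_imp_continuous_on DERIV_isCont)
  show "f \<in> borel_measurable borel" "f1 \<in> borel_measurable borel" "f2 \<in> borel_measurable borel"
    using meas f1 f2 f3 by blast+
  have B: "0 \<le> B" using bounds(2)[of 0] by simp
  fix v x :: real
  show "\<bar>f (v + x) - (f v + f1 v * x + f2 v * x\<^sup>2 / 2)\<bar>
      \<le> B * exp (h * v) * (\<bar>x\<bar> ^ 3 * exp (h * \<bar>x\<bar>)) / 6"
  proof (cases "x = 0")
    case False
    define D where "D = (\<lambda>m::nat. if m = 0 then f else if m = 1 then f1 else if m = 2 then f2 else f3)"
    have "\<exists>t. (if v + x < v then v + x < t \<and> t < v else v < t \<and> t < v + x) \<and>
        f (v + x) = (\<Sum>m<3. D m v / fact m * (v + x - v) ^ m) + D 3 t / fact 3 * (v + x - v) ^ 3"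
    proof (rule Taylor[where a = "min v (v + x)" and b = "max v (v + x)"])
      show "\<forall>m t. m < 3 \<and> min v (v + x) \<le> t \<and> t \<le> max v (v + x) \<longrightarrow>
          (D m has_real_derivative D (Suc m) t) (at t)"
      proof (intro allI impI)
        fix m :: nat and t assume "m < 3 \<and> min v (v + x) \<le> t \<and> t \<le> max v (v + x)"
        then have "m = 0 \<or> m = 1 \<or> m = 2" by auto
        then show "(D m has_real_derivative D (Suc m) t) (at t)"
          using f1 f2 f3 by (auto simp: D_def)
      qed
    qed (use False in \<open>auto simp: D_def\<close>)
    then obtain t where t: "if x < 0 then v + x < t \<and> t < v else v < t \<and> t < v + x"
      and eq: "f (v + x) = f v + f1 v * x + f2 v * x\<^sup>2 / 2 + f3 t / 6 * x ^ 3"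
      by (auto simp: D_def eval_nat_numeral)
    have "t \<le> v + \<bar>x\<bar>" using t by (auto split: if_splits)
    then have "h * t \<le> h * v + h * \<bar>x\<bar>"
      using h by (metis mult_left_mono distrib_left)
    then have "B * exp (h * t) \<le> B * (exp (h * v) * exp (h * \<bar>x\<bar>))"
      using B by (intro mult_left_mono) (auto simp flip: exp_add)
    then have "\<bar>f3 t\<bar> \<le> B * (exp (h * v) * exp (h * \<bar>x\<bar>))"
      using bounds(4)[of t] by linarith
    then have "\<bar>f3 t\<bar> * \<bar>x\<bar> ^ 3 \<le> B * (exp (h * v) * exp (h * \<bar>x\<bar>)) * \<bar>x\<bar> ^ 3"
      by (intro mult_right_mono) auto
    then show ?thesis
      unfolding eq by (simp add: abs_mult power_abs ac_simps)
  qed simp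
qed (use bounds in auto)

lemma gauss_mgf_shift:
  "integrable gauss (\<lambda>z. C * exp (h * (s + r * z)))"
  "(\<integral>z. C * exp (h * (s + r * z)) \<partial>gauss) = C * exp (h\<^sup>2 * r\<^sup>2 / 2) * exp (h * s)"
proof -
  have eq: "C * exp (h * (s + r * z)) = C * exp (h * s) * exp ((h * r) * z)" for z
    by (simp add: exp_add algebra_simps)
  show "integrable gauss (\<lambda>z. C * exp (h * (s + r * z)))"
    unfolding eq by (intro integrable_mult_right gauss_mgf)
  show "(\<integral>z. C * exp (h * (s + r * z)) \<partial>gauss) = C * exp (h\<^sup>2 * r\<^sup>2 / 2) * exp (h * s)"
    unfolding eq by (subst integral_mult_right_zero) (simp add: gauss_mgf power_mult_distrib)
qed

lemma gauss_cube_scaled: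
  assumes "0 \<le> r" "0 \<le> h" "h * r \<le> 1"
  shows "integrable gauss (\<lambda>z. \<bar>r * z\<bar> ^ 3 * exp (h * \<bar>r * z\<bar>))"
    "(\<integral>z. \<bar>r * z\<bar> ^ 3 * exp (h * \<bar>r * z\<bar>) \<partial>gauss) \<le> r ^ 3 * gauss_cube"
proof -
  have int: "integrable gauss (\<lambda>z. r ^ 3 * (\<bar>z\<bar> ^ 3 * exp \<bar>z\<bar>))"
    by (intro integrable_mult_right integrable_gauss_cube_exp)
  have le: "\<bar>r * z\<bar> ^ 3 * exp (h * \<bar>r * z\<bar>) \<le> r ^ 3 * (\<bar>z\<bar> ^ 3 * exp \<bar>z\<bar>)" for z
  proof -
    have "h * r * \<bar>z\<bar> \<le> 1 * \<bar>z\<bar>" using assms by (intro mult_right_mono) auto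
    then have "r ^ 3 * \<bar>z\<bar> ^ 3 * exp (h * r * \<bar>z\<bar>) \<le> r ^ 3 * \<bar>z\<bar> ^ 3 * exp \<bar>z\<bar>"
      using assms by (intro mult_left_mono) auto
    then show ?thesis using assms by (simp add: abs_mult power_mult_distrib ac_simps)
  qed
  show int': "integrable gauss (\<lambda>z. \<bar>r * z\<bar> ^ 3 * exp (h * \<bar>r * z\<bar>))"
  proof (rule Bochner_Integration.integrable_bound[OF int])
    show "AE z in gauss. norm (\<bar>r * z\<bar> ^ 3 * exp (h * \<bar>r * z\<bar>)) \<le> norm (r ^ 3 * (\<bar>z\<bar> ^ 3 * exp \<bar>z\<bar>))"
    proof (rule AE_I2)
      fix z
      have "norm (\<bar>r * z\<bar> ^ 3 * exp (h * \<bar>r * z\<bar>)) = \<bar>r * z\<bar> ^ 3 * exp (h * \<bar>r * z\<bar>)" by simp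
      also note le[of z]
      finally show "norm (\<bar>r * z\<bar> ^ 3 * exp (h * \<bar>r * z\<bar>)) \<le> norm (r ^ 3 * (\<bar>z\<bar> ^ 3 * exp \<bar>z\<bar>))"
        by (simp only: real_norm_def) linarith
    qed
  qed auto
  show "(\<integral>z. \<bar>r * z\<bar> ^ 3 * exp (h * \<bar>r * z\<bar>) \<partial>gauss) \<le> r ^ 3 * gauss_cube"
    unfolding gauss_cube_def integral_mult_right_zero[symmetric]
    by (rule integral_mono[OF int' int]) (rule le)
qed

text \<open>Smoothing by a normal variable keeps a second order Taylor bound without any
  differentiation under the integral sign.\<close>

lemma taylor2_bound_smooth:
  assumes tb: "taylor2_bound h B f f1 f2"
  shows "taylor2_bound h (B * exp (h\<^sup>2 * r\<^sup>2 / 2)) (\<lambda>s. \<integral>z. f (s + r * z) \<partial>gauss)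
      (\<lambda>s. \<integral>z. f1 (s + r * z) \<partial>gauss) (\<lambda>s. \<integral>z. f2 (s + r * z) \<partial>gauss)"
proof -
  note D = taylor2_boundD[OF tb]
  note [measurable] = D(1-3)
  have int: "integrable gauss (\<lambda>z. f (s + r * z))" for s
    by (rule gauss.integrable_const_bound[where B = 1]) (use D(4) in auto)
  have dom: "integrable gauss g" "\<bar>\<integral>z. g z \<partial>gauss\<bar> \<le> C * exp (h\<^sup>2 * r\<^sup>2 / 2) * exp (h * s)"
    if g: "\<And>z. \<bar>g z\<bar> \<le> C * exp (h * (s + r * z))" and [measurable]: "g \<in> borel_measurable borel" for g C s
  proof -
    show i: "integrable gauss g"
      by (rule Bochner_Integration.integrable_bound[OF gauss_mgf_shift(1)[of C h s r]])
        (use order_trans[OF g abs_ge_self] in auto)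
    have "\<bar>\<integral>z. g z \<partial>gauss\<bar> \<le> (\<integral>z. \<bar>g z\<bar> \<partial>gauss)" by (rule integral_abs_bound)
    also have "\<dots> \<le> (\<integral>z. C * exp (h * (s + r * z)) \<partial>gauss)"
      by (intro integral_mono integrable_abs i gauss_mgf_shift g)
    finally show "\<bar>\<integral>z. g z \<partial>gauss\<bar> \<le> C * exp (h\<^sup>2 * r\<^sup>2 / 2) * exp (h * s)"
      by (simp only: gauss_mgf_shift)
  qed
  have int12: "integrable gauss (\<lambda>z. f1 (s + r * z))" "integrable gauss (\<lambda>z. f2 (s + r * z))" for s
    by (rule dom(1)[where C = B and s = s]; use D(5,6) in auto)+
  show ?thesis
    unfolding taylor2_bound_def
  proof (intro conjI allI)
    show "(\<lambda>s. \<integral>z. f (s + r * z) \<partial>gauss) \<in> borel_measurable borel"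
      "(\<lambda>s. \<integral>z. f1 (s + r * z) \<partial>gauss) \<in> borel_measurable borel"
      "(\<lambda>s. \<integral>z. f2 (s + r * z) \<partial>gauss) \<in> borel_measurable borel"
      by measurable
    fix v
    have "\<bar>\<integral>z. f (v + r * z) \<partial>gauss\<bar> \<le> (\<integral>z. \<bar>f (v + r * z)\<bar> \<partial>gauss)" by (rule integral_abs_bound)
    also have "\<dots> \<le> (\<integral>z. 1 \<partial>gauss)"
      by (intro integral_mono integrable_abs int D) auto
    finally show "\<bar>\<integral>z. f (v + r * z) \<partial>gauss\<bar> \<le> 1" using gauss.prob_space by simp
    show "\<bar>\<integral>z. f1 (v + r * z) \<partial>gauss\<bar> \<le> B * exp (h\<^sup>2 * r\<^sup>2 / 2) * exp (h * v)"
      "\<bar>\<integral>z. f2 (v + r * z) \<partial>gauss\<bar> \<le> B * exp (h\<^sup>2 * r\<^sup>2 / 2) * exp (h * v)"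
      by (rule dom(2); use D(5,6) in auto)+
    fix x
    let ?g = "\<lambda>z. f (v + r * z + x) - (f (v + r * z) + f1 (v + r * z) * x + f2 (v + r * z) * x\<^sup>2 / 2)"
    have intx: "integrable gauss (\<lambda>z. f (v + r * z + x))"
      using int[of "v + x"] by (simp add: ac_simps)
    have "(\<integral>z. ?g z \<partial>gauss) = (\<integral>z. f (v + r * z + x) \<partial>gauss) - ((\<integral>z. f (v + r * z) \<partial>gauss)
        + (\<integral>z. f1 (v + r * z) \<partial>gauss) * x + (\<integral>z. f2 (v + r * z) \<partial>gauss) * x\<^sup>2 / 2)"
      using int int12 intx by simp
    moreover have "\<bar>\<integral>z. ?g z \<partial>gauss\<bar>
        \<le> (B * (\<bar>x\<bar> ^ 3 * exp (h * \<bar>x\<bar>)) / 6) * exp (h\<^sup>2 * r\<^sup>2 / 2) * exp (h * v)"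
    proof (rule dom(2))
      show "\<bar>?g z\<bar> \<le> B * (\<bar>x\<bar> ^ 3 * exp (h * \<bar>x\<bar>)) / 6 * exp (h * (v + r * z))" for z
        using D(8)[of "v + r * z" x] by (simp add: ac_simps)
    qed measurable
    ultimately show "\<bar>(\<integral>z. f (v + x + r * z) \<partial>gauss) - ((\<integral>z. f (v + r * z) \<partial>gauss)
        + (\<integral>z. f1 (v + r * z) \<partial>gauss) * x + (\<integral>z. f2 (v + r * z) \<partial>gauss) * x\<^sup>2 / 2)\<bar>
      \<le> B * exp (h\<^sup>2 * r\<^sup>2 / 2) * exp (h * v) * (\<bar>x\<bar> ^ 3 * exp (h * \<bar>x\<bar>)) / 6"
      by (simp add: ac_simps)
  qed
qed

text \<open>The cost of replacing a summand by a centred normal of standard deviation r: the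
  mismatches of the first two moments and the third-order Taylor remainders of both
  variables.\<close>

definition (in prob_space) exchange_error :: "real \<Rightarrow> ('a \<Rightarrow> real) \<Rightarrow> real \<Rightarrow> real" where
  "exchange_error h X r = \<bar>expectation X\<bar> + \<bar>expectation (\<lambda>w. (X w)\<^sup>2) - r\<^sup>2\<bar>
     + expectation (\<lambda>w. \<bar>X w\<bar> ^ 3 * exp (h * \<bar>X w\<bar>)) + r ^ 3 * gauss_cube"

text \<open>Both expectations are expanded at v. The second-order polynomials differ only through
  the mean of \<open>X\<close> and through its second moment minus r^2, since the normal variable
  has mean 0 and variance r^2; the factors 1/2 and 1/6 are given away.\<close>

lemma (in prob_space) lindeberg_step:
  assumes tb: "taylor2_bound h B f f1 f2"
    and [measurable]: "X \<in> borel_measurable M" and bdd: "\<And>w. w \<in> space M \<Longrightarrow> \<bar>X w\<bar> \<le> y"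
    and r: "0 \<le> r" "0 \<le> h" "h * r \<le> 1"
  shows "\<bar>expectation (\<lambda>w. f (v + X w)) - (\<integral>z. f (v + r * z) \<partial>gauss)\<bar>
    \<le> B * exp (h * v) * exchange_error h X r"
proof -
  note D = taylor2_boundD[OF tb]
  note [measurable] = D(1-3)
  have intX: "integrable M (\<lambda>w. X w ^ k)" for k
    by (rule integrable_const_bound[where B = "y ^ k"])
      (use bdd in \<open>auto intro!: AE_I2 power_mono simp: power_abs\<close>)
  have int3: "integrable M (\<lambda>w. \<bar>X w\<bar> ^ 3 * exp (h * \<bar>X w\<bar>))"
    by (rule integrable_const_bound[where B = "y ^ 3 * exp (h * y)"])
      (use bdd r in \<open>auto intro!: AE_I2 mult_mono power_mono mult_left_mono zero_le_power simp: abs_mult intro: order_trans[OF abs_ge_zero]\<close>)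
  have intf: "integrable M (\<lambda>w. f (v + X w))"
    by (rule integrable_const_bound[where B = 1]) (use D(4) in auto)
  have intg: "integrable gauss (\<lambda>z. f (v + r * z))"
    by (rule gauss.integrable_const_bound[where B = 1]) (use D(4) in auto)
  let ?K = "B * exp (h * v)"
  have K: "0 \<le> ?K" using D(7) by simp
  let ?a = "f v + f1 v * expectation X + f2 v * expectation (\<lambda>w. (X w)\<^sup>2) / 2"
  let ?b = "f v + f2 v * r\<^sup>2 / 2"
  have "\<bar>expectation (\<lambda>w. f (v + X w)) - ?a\<bar>
      = \<bar>expectation (\<lambda>w. f (v + X w) - (f v + f1 v * X w + f2 v * (X w)\<^sup>2 / 2))\<bar>"
    using intf intX[of 1] intX[of 2] by (simp add: prob_space)
  also have "\<dots> \<le> expectation (\<lambda>w. \<bar>f (v + X w) - (f v + f1 v * X w + f2 v * (X w)\<^sup>2 / 2)\<bar>)"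
    by (rule integral_abs_bound)
  also have "\<dots> \<le> expectation (\<lambda>w. ?K * (\<bar>X w\<bar> ^ 3 * exp (h * \<bar>X w\<bar>)) / 6)"
    using intf intX[of 1] intX[of 2] int3 by (intro integral_mono D(8)) auto
  finally have 1: "\<bar>expectation (\<lambda>w. f (v + X w)) - ?a\<bar>
      \<le> ?K * expectation (\<lambda>w. \<bar>X w\<bar> ^ 3 * exp (h * \<bar>X w\<bar>)) / 6"
    by simp
  have m1: "(\<integral>z. z \<partial>gauss) = 0" using integral_std_normal_distribution_moment_odd[of 1] by simp
  have m2: "(\<integral>z. z\<^sup>2 \<partial>gauss) = 1"
    using std_normal_distribution_even_moments(1)[of 1] by (simp add: fact_numeral)
  note i1 = integrable_std_normal_distribution_moment[of 1] and i2 = integrable_std_normal_distribution_moment[of 2]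
  have "\<bar>(\<integral>z. f (v + r * z) \<partial>gauss) - ?b\<bar>
      = \<bar>\<integral>z. f (v + r * z) - (f v + f1 v * (r * z) + f2 v * (r * z)\<^sup>2 / 2) \<partial>gauss\<bar>"
    using intg i1 i2 gauss.prob_space by (simp add: m1 m2 power_mult_distrib)
  also have "\<dots> \<le> (\<integral>z. \<bar>f (v + r * z) - (f v + f1 v * (r * z) + f2 v * (r * z)\<^sup>2 / 2)\<bar> \<partial>gauss)"
    by (rule integral_abs_bound)
  also have "\<dots> \<le> (\<integral>z. ?K * (\<bar>r * z\<bar> ^ 3 * exp (h * \<bar>r * z\<bar>)) / 6 \<partial>gauss)"
    using intg i1 i2 gauss_cube_scaled(1)[OF r]
    by (intro integral_mono D(8)) (auto simp: power_mult_distrib)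
  also have "\<dots> \<le> ?K * (r ^ 3 * gauss_cube) / 6"
    using gauss_cube_scaled(2)[OF r] K by (simp add: mult_left_mono)
  finally have 2: "\<bar>(\<integral>z. f (v + r * z) \<partial>gauss) - ?b\<bar> \<le> ?K * (r ^ 3 * gauss_cube) / 6" .
  have "\<bar>?a - ?b\<bar> = \<bar>f1 v * expectation X + f2 v / 2 * (expectation (\<lambda>w. (X w)\<^sup>2) - r\<^sup>2)\<bar>"
    by (simp add: algebra_simps diff_divide_distrib)
  also have "\<dots> \<le> \<bar>f1 v\<bar> * \<bar>expectation X\<bar> + \<bar>f2 v\<bar> / 2 * \<bar>expectation (\<lambda>w. (X w)\<^sup>2) - r\<^sup>2\<bar>"
    by (rule order_trans[OF abs_triangle_ineq]) (simp add: abs_mult)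
  also have "\<dots> \<le> ?K * \<bar>expectation X\<bar> + ?K * \<bar>expectation (\<lambda>w. (X w)\<^sup>2) - r\<^sup>2\<bar>"
    using D(5,6)[of v] by (intro add_mono mult_right_mono) auto
  finally have 3: "\<bar>?a - ?b\<bar> \<le> ?K * \<bar>expectation X\<bar> + ?K * \<bar>expectation (\<lambda>w. (X w)\<^sup>2) - r\<^sup>2\<bar>" .
  have "0 \<le> expectation (\<lambda>w. \<bar>X w\<bar> ^ 3 * exp (h * \<bar>X w\<bar>))" by (rule integral_nonneg_AE) auto
  from mult_nonneg_nonneg[OF K this]
  have "?K * expectation (\<lambda>w. \<bar>X w\<bar> ^ 3 * exp (h * \<bar>X w\<bar>)) / 6
      \<le> ?K * expectation (\<lambda>w. \<bar>X w\<bar> ^ 3 * exp (h * \<bar>X w\<bar>))" by linarith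
  moreover have "0 \<le> r ^ 3 * gauss_cube" using r by simp
  from mult_nonneg_nonneg[OF K this]
  have "?K * (r ^ 3 * gauss_cube) / 6 \<le> ?K * (r ^ 3 * gauss_cube)" by linarith
  ultimately show ?thesis using 1 2 3 unfolding exchange_error_def distrib_left by linarith
qed

lemma (in prob_space) mgf_sum_le:
  assumes fin: "finite I" and indep: "indep_vars (\<lambda>_. borel) X I"
    and int: "\<And>i. i \<in> I \<Longrightarrow> integrable M (\<lambda>w. exp (h * X i w) :: real)"
    and mgf: "\<And>i. i \<in> I \<Longrightarrow> expectation (\<lambda>w. exp (h * X i w)) \<le> exp (a i)"
  shows "integrable M (\<lambda>w. exp (h * (\<Sum>i\<in>I. X i w)))"
    "expectation (\<lambda>w. exp (h * (\<Sum>i\<in>I. X i w))) \<le> exp (sum a I)"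
proof -
  have eq: "exp (h * (\<Sum>i\<in>I. X i w)) = (\<Prod>i\<in>I. exp (h * X i w))" for w
    by (simp add: exp_sum[OF fin] sum_distrib_left)
  have ind: "indep_vars (\<lambda>_. borel) (\<lambda>i w. exp (h * X i w)) I"
    by (rule indep_vars_compose2[OF indep]) auto
  show "integrable M (\<lambda>w. exp (h * (\<Sum>i\<in>I. X i w)))"
    unfolding eq by (rule indep_vars_integrable[OF fin ind int])
  show "expectation (\<lambda>w. exp (h * (\<Sum>i\<in>I. X i w))) \<le> exp (sum a I)"
    unfolding eq exp_sum[OF fin]
    by (subst indep_vars_lebesgue_integral[OF fin ind int], assumption, intro prod_mono) (auto intro!: mgf integral_nonneg_AE)
qed

lemma (in prob_space) prob_le_expectation:
  fixes g :: "'a \<Rightarrow> real"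
  assumes "integrable M g" "{w \<in> space M. P w} \<in> events"
    and "\<And>w. w \<in> space M \<Longrightarrow> 0 \<le> g w" "\<And>w. w \<in> space M \<Longrightarrow> P w \<Longrightarrow> 1 \<le> g w"
  shows "\<P>(w in M. P w) \<le> expectation g"
proof -
  have "\<P>(w in M. P w) = expectation (indicator {w \<in> space M. P w})"
    using assms(2) by simp
  also have "\<dots> \<le> expectation g"
    using assms by (intro integral_mono) (auto simp: integrable_indicator_iff emeasure_eq_measure indicator_def)
  finally show ?thesis .
qed

text \<open>The event is phrased through h times the sum, so that negative h, for lower tails, is
  covered as well.\<close>

lemma (in prob_space) chernoff_bound:
  assumes "finite I" and indep: "indep_vars (\<lambda>_. borel) X I"
    and "\<And>i. i \<in> I \<Longrightarrow> integrable M (\<lambda>w. exp (h * X i w) :: real)"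
    and "\<And>i. i \<in> I \<Longrightarrow> expectation (\<lambda>w. exp (h * X i w)) \<le> exp (a i)"
  shows "\<P>(w in M. b \<le> h * (\<Sum>i\<in>I. X i w)) \<le> exp (sum a I - b)"
proof -
  note m = mgf_sum_le[OF assms]
  have [measurable]: "(\<lambda>w. \<Sum>i\<in>I. X i w) \<in> borel_measurable M"
    using indep by (intro borel_measurable_sum) (auto simp: indep_vars_def)
  have "\<P>(w in M. b \<le> h * (\<Sum>i\<in>I. X i w)) \<le> expectation (\<lambda>w. exp (- b) * exp (h * (\<Sum>i\<in>I. X i w)))"
    using m(1) by (intro prob_le_expectation integrable_mult_right) (auto simp flip: exp_add)
  also have "\<dots> \<le> exp (- b) * exp (sum a I)" using m(2) by simp
  finally show ?thesis by (simp add: exp_diff exp_minus field_simps)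
qed

text \<open>Induction over the summands with the test function generalised: once a summand has been
  exchanged, the claim for the others is applied to the smoothing of \<open>f\<close> by the
  matching normal variable, which satisfies the same kind of Taylor bound with B enlarged by exp(h^2
  r^2/2). The exponents \<open>a i\<close> dominate both this factor and the moment generating
  function of \<open>X i\<close>, so every stage fits under the common factor
  \<open>exp (sum a I)\<close>.\<close>

lemma (in prob_space) lindeberg:
  assumes "finite I" and "indep_vars (\<lambda>_. borel) X I"
    and "\<And>i w. i \<in> I \<Longrightarrow> w \<in> space M \<Longrightarrow> \<bar>X i w\<bar> \<le> y"
    and h: "0 \<le> h" and "\<And>i. i \<in> I \<Longrightarrow> 0 \<le> r i" "\<And>i. i \<in> I \<Longrightarrow> h * r i \<le> 1"
    and "\<And>i. i \<in> I \<Longrightarrow> expectation (\<lambda>w. exp (h * X i w)) \<le> exp (a i)"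
    and "\<And>i. i \<in> I \<Longrightarrow> h\<^sup>2 * (r i)\<^sup>2 / 2 \<le> a i"
    and "\<And>i. i \<in> I \<Longrightarrow> exchange_error h (X i) (r i) \<le> R i"
    and "taylor2_bound h B f f1 f2"
  shows "\<bar>expectation (\<lambda>w. f (\<Sum>i\<in>I. X i w)) - (\<integral>z. f (sqrt (\<Sum>i\<in>I. (r i)\<^sup>2) * z) \<partial>gauss)\<bar>
    \<le> B * exp (sum a I) * sum R I"
  using assms
proof (induction I arbitrary: f f1 f2 B rule: finite_induct)
  case empty
  then show ?case
    using prob_space gauss.prob_space by simp
next
  case (insert i I)
  note D = taylor2_boundD[OF insert.prems(9)]
  note [measurable] = D(1)
  let ?S = "\<lambda>w. \<Sum>i\<in>I. X i w"
  define g where "g = (\<lambda>s. \<integral>z. f (s + r i * z) \<partial>gauss)"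
  have rv [measurable]: "X j \<in> borel_measurable M" if "j \<in> insert i I" for j
    using insert.prems(1) that by (auto simp: indep_vars_def)
  have [measurable]: "?S \<in> borel_measurable M" by (intro borel_measurable_sum rv) auto
  have Xi [measurable]: "X i \<in> borel_measurable M" by (rule rv) simp
  have indI: "indep_vars (\<lambda>_. borel) X I"
    by (rule indep_vars_subset[OF insert.prems(1)]) auto
  have "indep_var borel (X i) borel ?S"
    by (rule indep_vars_sum) (use insert in auto)
  \<comment> \<open>Independence factorizes the joint law of \<open>X i\<close> and the remaining
    sum, so Fubini can integrate \<open>X i\<close> first with that sum held fixed.\<close>
  then have joint: "distr M borel (X i) \<Otimes>\<^sub>M distr M borel ?S
      = distr M (borel \<Otimes>\<^sub>M borel) (\<lambda>w. (X i w, ?S w))"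
    by (simp add: indep_var_distribution_eq)
  interpret A: prob_space "distr M borel (X i)" by (rule prob_space_distr) simp
  interpret C: prob_space "distr M borel ?S" by (rule prob_space_distr) simp
  interpret P: pair_prob_space "distr M borel (X i)" "distr M borel ?S" ..
  have "integrable (distr M borel (X i) \<Otimes>\<^sub>M distr M borel ?S) (\<lambda>(x, s). f (s + x))"
    by (rule P.integrable_const_bound[where B = 1]) (use D(4) in auto)
  then have "(\<integral>s. (\<integral>x. f (s + x) \<partial>distr M borel (X i)) \<partial>distr M borel ?S)
      = (\<integral>w. (case w of (x, s) \<Rightarrow> f (s + x)) \<partial>(distr M borel (X i) \<Otimes>\<^sub>M distr M borel ?S))"
    by (rule P.integral_snd)
  also have "\<dots> = expectation (\<lambda>w. f (?S w + X i w))"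
    unfolding joint by (subst integral_distr) auto
  finally have split: "expectation (\<lambda>w. f (?S w + X i w))
      = expectation (\<lambda>w. expectation (\<lambda>w'. f (?S w + X i w')))"
    by (simp add: integral_distr)
  define F where "F = (\<lambda>s. expectation (\<lambda>w'. f (s + X i w')))"
  have F_meas [measurable]: "F \<in> borel_measurable borel"
    unfolding F_def by measurable
  have g_meas [measurable]: "g \<in> borel_measurable borel"
    using taylor2_boundD(1)[OF taylor2_bound_smooth[OF insert.prems(9)]] unfolding g_def .
  have step: "\<bar>F s - g s\<bar> \<le> B * R i * exp (h * s)" for s
  proof -
    have "\<bar>F s - g s\<bar> \<le> B * exp (h * s) * exchange_error h (X i) (r i)"
      unfolding F_def g_def by (rule lindeberg_step[OF insert.prems(9)]) (use insert.prems in auto)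
    also have "\<dots> \<le> B * exp (h * s) * R i"
      by (intro mult_left_mono insert.prems) (use D(7) in auto)
    finally show ?thesis by (simp add: ac_simps)
  qed
  have bnd: "\<bar>X j w\<bar> \<le> y" if "j \<in> insert i I" "w \<in> space M" for j w
    using insert.prems(2) that by blast
  have intX: "integrable M (\<lambda>w. exp (h * X j w))" if "j \<in> I" for j
    by (rule integrable_const_bound[where B = "exp (h * y)"])
      (use that h bnd rv in \<open>auto intro!: AE_I2 mult_left_mono dest: abs_le_D1\<close>)
  have mgfI: "integrable M (\<lambda>w. exp (h * ?S w))" "expectation (\<lambda>w. exp (h * ?S w)) \<le> exp (sum a I)"
    by (rule mgf_sum_le[OF insert.hyps(1) indI intX insert.prems(6)[OF insertI2]]; assumption)+
  have a_nonneg: "0 \<le> a j" if "j \<in> insert i I" for j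
    by (rule order_trans[OF _ insert.prems(7)[OF that]]) simp
  have R_nonneg: "0 \<le> R j" if "j \<in> insert i I" for j
  proof -
    have "0 \<le> expectation (\<lambda>w. \<bar>X j w\<bar> ^ 3 * exp (h * \<bar>X j w\<bar>))" by (rule integral_nonneg_AE) auto
    moreover have "0 \<le> (r j) ^ 3 * gauss_cube" using insert.prems(4)[OF that] by simp
    ultimately show ?thesis using insert.prems(8)[OF that] unfolding exchange_error_def by linarith
  qed
  have intF: "integrable M (\<lambda>w. F (?S w))"
  proof (rule integrable_const_bound[where B = 1])
    show "AE w in M. norm (F (?S w)) \<le> 1"
    proof (rule AE_I2)
      fix w
      have "\<bar>F (?S w)\<bar> \<le> expectation (\<lambda>w'. \<bar>f (?S w + X i w')\<bar>)"
        unfolding F_def by (rule integral_abs_bound)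
      also have "\<dots> \<le> expectation (\<lambda>w'. 1)"
        by (intro integral_mono integrable_abs D(4) integrable_const_bound[where B = 1]) (use D(4) in auto)
      finally show "norm (F (?S w)) \<le> 1" by (simp add: prob_space)
    qed
  qed simp
  have tb': "taylor2_bound h (B * exp (h\<^sup>2 * (r i)\<^sup>2 / 2)) g
      (\<lambda>s. \<integral>z. f1 (s + r i * z) \<partial>gauss) (\<lambda>s. \<integral>z. f2 (s + r i * z) \<partial>gauss)"
    unfolding g_def by (rule taylor2_bound_smooth[OF insert.prems(9)])
  have intg: "integrable M (\<lambda>w. g (?S w))"
    by (rule integrable_const_bound[where B = 1]) (use taylor2_boundD(4)[OF tb'] in auto)
  \<comment> \<open>At a fixed value s of the remaining sum the exchange costs B * R i * exp(h s);
    averaging over s turns the weight into a moment generating function.\<close>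
  have "\<bar>expectation (\<lambda>w. F (?S w)) - expectation (\<lambda>w. g (?S w))\<bar>
      = \<bar>expectation (\<lambda>w. F (?S w) - g (?S w))\<bar>"
    using intF intg by simp
  also have "\<dots> \<le> expectation (\<lambda>w. \<bar>F (?S w) - g (?S w)\<bar>)"
    by (rule integral_abs_bound)
  also have "\<dots> \<le> expectation (\<lambda>w. B * R i * exp (h * ?S w))"
    by (intro integral_mono integrable_abs Bochner_Integration.integrable_diff intF intg
        integrable_mult_right mgfI step)
  also have "\<dots> \<le> B * R i * exp (sum a I)"
    using mgfI(2) D(7) R_nonneg[of i] by (simp add: mult_left_mono)
  also have "\<dots> \<le> B * R i * exp (sum a (insert i I))"
    using D(7) R_nonneg[of i] a_nonneg[of i] insert.hyps by (intro mult_left_mono) auto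
  finally have 1: "\<bar>expectation (\<lambda>w. F (?S w)) - expectation (\<lambda>w. g (?S w))\<bar>
      \<le> B * R i * exp (sum a (insert i I))" .
  have "\<bar>expectation (\<lambda>w. g (?S w)) - (\<integral>z. g (sqrt (\<Sum>i\<in>I. (r i)\<^sup>2) * z) \<partial>gauss)\<bar>
      \<le> (B * exp (h\<^sup>2 * (r i)\<^sup>2 / 2)) * exp (sum a I) * sum R I"
    by (rule insert.IH) (use insert.prems indI tb' in auto)
  also have "\<dots> = B * exp (h\<^sup>2 * (r i)\<^sup>2 / 2 + sum a I) * sum R I" by (simp add: exp_add)
  also have "\<dots> \<le> B * exp (sum a (insert i I)) * sum R I"
    using insert.prems(7)[of i] insert.hyps D(7)
    by (intro mult_right_mono mult_left_mono) (auto intro!: sum_nonneg R_nonneg)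
  finally have 2: "\<bar>expectation (\<lambda>w. g (?S w)) - (\<integral>z. g (sqrt (\<Sum>i\<in>I. (r i)\<^sup>2) * z) \<partial>gauss)\<bar>
      \<le> B * exp (sum a (insert i I)) * sum R I" .
  have 3: "(\<integral>z. g (sqrt (\<Sum>i\<in>I. (r i)\<^sup>2) * z) \<partial>gauss)
      = (\<integral>z. f (sqrt (\<Sum>i\<in>insert i I. (r i)\<^sup>2) * z) \<partial>gauss)"
    unfolding g_def by (subst integral_gauss_conv[where K = 1])
      (use D(4) insert.hyps in \<open>auto simp: sum_nonneg add.commute\<close>)
  have 4: "expectation (\<lambda>w. f (\<Sum>i\<in>insert i I. X i w)) = expectation (\<lambda>w. F (?S w))"
    using split insert.hyps by (simp add: F_def add.commute)
  have "B * exp (sum a (insert i I)) * sum R (insert i I)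
      = B * R i * exp (sum a (insert i I)) + B * exp (sum a (insert i I)) * sum R I"
    using insert.hyps by (simp add: algebra_simps)
  then show ?case using 1 2 unfolding 3 4 by linarith
qed

subsection \<open>A smooth step function\<close>

definition unit_clamp :: "real \<Rightarrow> real" where
  "unit_clamp u = max 0 (min 1 u)"

lemma unit_clamp_bounds [simp]: "0 \<le> unit_clamp u" "unit_clamp u \<le> 1"
  by (auto simp: unit_clamp_def)

lemma DERIV_comp_unit_clamp:
  assumes P: "\<And>u. (P has_real_derivative P' u) (at u)" and P0: "P' 0 = 0" and P1: "P' 1 = 0"
  shows "((\<lambda>u. P (unit_clamp u)) has_real_derivative P' (unit_clamp u)) (at u)"
proof (cases "0 < u \<and> u < 1")
  case True
  have "((\<lambda>u. P (unit_clamp u)) has_real_derivative P' u) (at u)"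
    by (rule has_field_derivative_transform_within_open[OF P, where S = "{0<..<1}"])
      (use True in \<open>auto simp: unit_clamp_def\<close>)
  then show ?thesis using True by (simp add: unit_clamp_def)
next
  case False
  define c where "c = unit_clamp u"
  have c: "c = 0 \<or> c = 1" using False by (auto simp: c_def unit_clamp_def)
  then have D0: "P' c = 0" using P0 P1 by auto
  then have "(P has_real_derivative 0) (at c)" using P[of c] by simp
  then obtain g where g: "\<And>z. P z - P c = g z * (z - c)" "isCont g c" "g c = 0"
    unfolding CARAT_DERIV by blast
  have cont: "isCont unit_clamp u" unfolding unit_clamp_def by (intro continuous_intros)
  have "isCont (\<lambda>v. g (unit_clamp v)) u"
    by (rule continuous_within_compose3[OF _ cont]) (use g(2) in \<open>simp add: c_def\<close>)
  then have lim: "((\<lambda>v. \<bar>g (unit_clamp v)\<bar>) \<longlongrightarrow> 0) (at u)"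
    using g(3) by (intro tendsto_rabs_zero) (auto simp: isCont_def c_def)
  have "((\<lambda>v. (P (unit_clamp v) - P (unit_clamp u)) / (v - u)) \<longlongrightarrow> 0) (at u)"
  proof (rule Lim_null_comparison[OF _ lim], rule always_eventually, rule allI)
    fix v
    have "\<bar>unit_clamp v - c\<bar> \<le> \<bar>v - u\<bar>" by (auto simp: unit_clamp_def c_def)
    then have "\<bar>g (unit_clamp v)\<bar> * \<bar>unit_clamp v - c\<bar> \<le> \<bar>g (unit_clamp v)\<bar> * \<bar>v - u\<bar>"
      by (intro mult_left_mono) auto
    then show "norm ((P (unit_clamp v) - P (unit_clamp u)) / (v - u)) \<le> \<bar>g (unit_clamp v)\<bar>"
      unfolding c_def[symmetric] g(1)
      by (cases "v = u") (auto simp: abs_mult pos_divide_le_eq)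
  qed
  then show ?thesis
    unfolding has_field_derivative_iff using D0 by (simp add: c_def)
qed

text \<open>The antiderivative of \<open>140 u\<^sup>3 (1 - u)\<^sup>3\<close>: its first three derivatives vanish at 0 and 1, and it
  increases from 0 to 1 between them.\<close>

definition step_poly :: "real \<Rightarrow> real" where
  "step_poly u = 35 * u ^ 4 - 84 * u ^ 5 + 70 * u ^ 6 - 20 * u ^ 7"

definition smooth_step :: "real \<Rightarrow> real \<Rightarrow> real \<Rightarrow> real" where
  "smooth_step a d u = step_poly (unit_clamp ((u - a) / d))"

lemma step_poly_deriv:
  "(step_poly has_real_derivative 140 * u ^ 3 * (1 - u) ^ 3) (at u)"
  "((\<lambda>u. 140 * u ^ 3 * (1 - u) ^ 3) has_real_derivative 420 * u ^ 2 * (1 - u) ^ 2 * (1 - 2 * u)) (at u)"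
  "((\<lambda>u. 420 * u ^ 2 * (1 - u) ^ 2 * (1 - 2 * u)) has_real_derivative
      840 * u * (1 - u) * ((1 - 2 * u)\<^sup>2 - u * (1 - u))) (at u)"
  unfolding step_poly_def
  by (auto intro!: derivative_eq_intros simp: eval_nat_numeral algebra_simps)

lemma step_poly_mono: "0 \<le> u \<Longrightarrow> u \<le> v \<Longrightarrow> v \<le> 1 \<Longrightarrow> step_poly u \<le> step_poly v"
  by (erule DERIV_nonneg_imp_nondecreasing, intro exI conjI, rule step_poly_deriv(1)) auto

lemma smooth_step_mono: "0 < d \<Longrightarrow> b \<le> a \<Longrightarrow> smooth_step a d u \<le> smooth_step b d u"
  unfolding smooth_step_def
  by (intro step_poly_mono) (auto simp: unit_clamp_def divide_right_mono max_def min_def intro: order_trans)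

lemma smooth_step_bounds: "0 \<le> smooth_step a d u" "smooth_step a d u \<le> 1"
  using step_poly_mono[of 0 "unit_clamp ((u - a) / d)"] step_poly_mono[of "unit_clamp ((u - a) / d)" 1]
  by (auto simp: smooth_step_def step_poly_def)

lemma smooth_step_eq_0: "0 < d \<Longrightarrow> u \<le> a \<Longrightarrow> smooth_step a d u = 0"
  by (auto simp: smooth_step_def step_poly_def unit_clamp_def min_def max_def field_simps)

lemma smooth_step_eq_1: "0 < d \<Longrightarrow> a + d \<le> u \<Longrightarrow> smooth_step a d u = 1"
  by (auto simp: smooth_step_def step_poly_def unit_clamp_def min_def max_def field_simps)

text \<open>The derivatives vanish to the left of a, and to the right exp(h (u - a)) \<ge> 1, so
  plain bounds upgrade to exponentially weighted ones for free. The number 1680 = 2 * 840 bounds the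
  third derivative of the polynomial and covers the 140 and 420 of the lower ones; d \<le> 1 lets
  1/d^3 absorb 1/d and 1/d^2.\<close>

lemma smooth_step_taylor2_bound:
  assumes d: "0 < d" "d \<le> 1" and h: "0 \<le> h"
  shows "\<exists>f1 f2. taylor2_bound h (1680 / d ^ 3 * exp (- h * a)) (smooth_step a d) f1 f2"
proof -
  define c where "c = (\<lambda>u. unit_clamp ((u - a) / d))"
  define p1 where "p1 = (\<lambda>u::real. 140 * u ^ 3 * (1 - u) ^ 3)"
  define p2 where "p2 = (\<lambda>u::real. 420 * u ^ 2 * (1 - u) ^ 2 * (1 - 2 * u))"
  define p3 where "p3 = (\<lambda>u::real. 840 * u * (1 - u) * ((1 - 2 * u)\<^sup>2 - u * (1 - u)))"
  have deriv: "((\<lambda>u. k * P (c u)) has_real_derivative (k / d) * P' (c u)) (at u)"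
    if "\<And>u. (P has_real_derivative P' u) (at u)" "P' 0 = 0" "P' 1 = 0" for P P' k u
  proof -
    have "((\<lambda>u. P (unit_clamp u)) has_real_derivative P' (c u)) (at ((u - a) / d))"
      unfolding c_def by (rule DERIV_comp_unit_clamp[OF that])
    moreover have "((\<lambda>u. (u - a) / d) has_real_derivative 1 / d) (at u)"
      using d by (auto intro!: derivative_eq_intros)
    ultimately have "((\<lambda>u. P (c u)) has_real_derivative P' (c u) * (1 / d)) (at u)"
      unfolding c_def by (rule DERIV_chain2)
    from DERIV_cmult[OF this, of k] show ?thesis by (simp add: field_simps)
  qed
  have "(smooth_step a d has_real_derivative (1 / d) * p1 (c u)) (at u)" for u
    using deriv[OF step_poly_deriv(1), of 1 u] by (simp add: c_def p1_def smooth_step_def[abs_def])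
  moreover have "((\<lambda>u. (1 / d) * p1 (c u)) has_real_derivative (1 / d / d) * p2 (c u)) (at u)" for u
    using deriv[OF step_poly_deriv(2), of "1 / d" u] unfolding p1_def p2_def by simp
  moreover have "((\<lambda>u. (1 / d / d) * p2 (c u)) has_real_derivative (1 / d / d / d) * p3 (c u)) (at u)" for u
    using deriv[OF step_poly_deriv(3), of "1 / d / d" u] unfolding p2_def p3_def by simp
  moreover have "\<bar>k * P (c u)\<bar> \<le> 1680 / d ^ 3 * exp (- h * a) * exp (h * u)"
    if "\<And>w. 0 \<le> w \<Longrightarrow> w \<le> 1 \<Longrightarrow> \<bar>P w\<bar> \<le> 1680" "P 0 = 0" "0 \<le> k" "k \<le> 1 / d ^ 3" for P k u
  proof (cases "u \<le> a")
    case True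
    then have "c u = 0" using d by (auto simp: c_def unit_clamp_def divide_nonpos_pos)
    then show ?thesis using that(2) d by simp
  next
    case False
    then have "1 \<le> exp (h * (u - a))" using h by simp
    moreover have "\<bar>k * P (c u)\<bar> \<le> 1 / d ^ 3 * 1680"
      unfolding abs_mult using that d by (intro mult_mono that) (auto simp: c_def)
    ultimately have "\<bar>k * P (c u)\<bar> * 1 \<le> (1 / d ^ 3 * 1680) * exp (h * (u - a))"
      using d by (intro mult_mono) auto
    moreover have "exp (h * (u - a)) = exp (- h * a) * exp (h * u)"
      by (simp add: exp_add[symmetric] algebra_simps)
    ultimately show ?thesis by (simp add: ac_simps)
  qed
  note bound = this
  have w1: "u * (1 - u) \<le> 1" "0 \<le> u * (1 - u)" if "0 \<le> u" "u \<le> 1" for u :: real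
    using that by (auto intro: mult_le_one)
  have "\<bar>p1 u\<bar> \<le> 1680" if "0 \<le> u" "u \<le> 1" for u
  proof -
    have "(u * (1 - u)) ^ 3 \<le> 1" by (intro power_le_one w1 that)
    then show ?thesis using that w1[OF that] by (simp add: p1_def power_mult_distrib abs_mult)
  qed
  moreover have "\<bar>p2 u\<bar> \<le> 1680" if "0 \<le> u" "u \<le> 1" for u
  proof -
    have "(u * (1 - u)) ^ 2 \<le> 1" by (intro power_le_one w1 that)
    moreover have "\<bar>1 - 2 * u\<bar> \<le> 1" using that by auto
    ultimately have "(u * (1 - u)) ^ 2 * \<bar>1 - 2 * u\<bar> \<le> 1" by (intro mult_le_one) auto
    then show ?thesis by (simp add: p2_def power_mult_distrib abs_mult)
  qed
  moreover have "\<bar>p3 u\<bar> \<le> 1680" if "0 \<le> u" "u \<le> 1" for u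
  proof -
    have "\<bar>1 - 2 * u\<bar> \<le> 1" using that by auto
    then have "(1 - 2 * u)\<^sup>2 \<le> 1" by (simp add: abs_square_le_1)
    moreover have "0 \<le> (1 - 2 * u)\<^sup>2" by simp
    ultimately have "\<bar>(1 - 2 * u)\<^sup>2 - u * (1 - u)\<bar> \<le> 2" using w1[OF that] by linarith
    then have "(u * (1 - u)) * \<bar>(1 - 2 * u)\<^sup>2 - u * (1 - u)\<bar> \<le> 1 * 2"
      by (intro mult_mono w1 that) auto
    then show ?thesis using that by (simp add: p3_def abs_mult)
  qed
  moreover have "p1 0 = 0" "p2 0 = 0" "p3 0 = 0" by (auto simp: p1_def p2_def p3_def)
  moreover have "1 / d \<le> 1 / d ^ 3" "1 / d / d \<le> 1 / d ^ 3" "1 / d / d / d \<le> 1 / d ^ 3"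
    using d power_decreasing[of 1 3 d] power_decreasing[of 2 3 d]
    by (auto simp: power2_eq_square power3_eq_cube intro!: divide_left_mono)
  ultimately have "taylor2_bound h (1680 / d ^ 3 * exp (- h * a)) (smooth_step a d)
      (\<lambda>u. (1 / d) * p1 (c u)) (\<lambda>u. (1 / d / d) * p2 (c u))"
    using d h smooth_step_bounds[of a d]
    by (intro taylor2_boundI[where ?f3.0 = "\<lambda>u. (1 / d / d / d) * p3 (c u)"] bound) auto
  then show ?thesis by blast
qed

subsection \<open>Moderate deviations of weighted sums\<close>

definition trunc_at :: "real \<Rightarrow> real \<Rightarrow> real" where
  "trunc_at y z = (if \<bar>z\<bar> \<le> y then z else 0)"

lemma trunc_at_measurable [measurable]: "trunc_at y \<in> borel_measurable borel"
  unfolding trunc_at_def[abs_def] by measurable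

lemma trunc_at_bounded: "0 \<le> y \<Longrightarrow> \<bar>trunc_at y z\<bar> \<le> y"
  by (auto simp: trunc_at_def)

lemma powr_tail_bound:
  fixes z :: real
  assumes "0 < y" "y < \<bar>z\<bar>" "0 \<le> k" "k \<le> q"
  shows "\<bar>z\<bar> powr k \<le> y powr k * (y powr (- q) * \<bar>z\<bar> powr q)"
proof -
  have "(\<bar>z\<bar> / y) powr k \<le> (\<bar>z\<bar> / y) powr q"
    using assms by (intro powr_mono) auto
  then show ?thesis
    using assms by (simp add: powr_divide powr_minus field_simps)
qed

text \<open>Whatever truncation at y removes is dominated by the single variable y^(-q) |Z|^q, whose
  mean is at most \<theta>; this handles the probability of truncation and the changes of the first
  two moments at once. The untruncated second moment v is kept in the exponent, so that summing over
  normalised weights later yields h^2/2 with no loss in the leading term.\<close>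

lemma (in prob_space) truncation_moments:
  assumes Z: "has_bochner_integral M Z 0" and Z2: "has_bochner_integral M (\<lambda>w. (Z w)\<^sup>2) v"
    and Zq: "integrable M (\<lambda>w. \<bar>Z w\<bar> powr q)" and m: "expectation (\<lambda>w. \<bar>Z w\<bar> powr q) \<le> m"
    and q: "2 < q" and y: "0 < y" "y \<le> 1" and h: "0 \<le> h" "h * y \<le> 1"
  defines "X \<equiv> (\<lambda>w. trunc_at y (Z w))" and "\<theta> \<equiv> y powr (- q) * m"
  shows "\<P>(w in M. y < \<bar>Z w\<bar>) \<le> \<theta>"
    and "\<bar>expectation X\<bar> \<le> \<theta>"
    and "\<bar>expectation (\<lambda>w. (X w)\<^sup>2) - v\<bar> \<le> \<theta>"
    and "expectation (\<lambda>w. \<bar>X w\<bar> ^ 3 * exp (h * \<bar>X w\<bar>)) \<le> 3 * y * v"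
    and "expectation (\<lambda>w. exp (h * X w)) \<le> exp (h * \<theta> + h\<^sup>2 * v / 2 + h ^ 3 * y * v)"
proof -
  have [measurable]: "Z \<in> borel_measurable M" using Z by (auto dest: borel_measurable_has_bochner_integral)
  have Xm [measurable]: "X \<in> borel_measurable M" unfolding X_def by measurable
  have bX: "\<bar>X w\<bar> \<le> y" for w unfolding X_def using y by (simp add: trunc_at_bounded)
  let ?E = "\<lambda>w. y powr (- q) * \<bar>Z w\<bar> powr q"
  have E: "integrable M ?E" "expectation ?E \<le> \<theta>"
    using Zq m by (auto simp: \<theta>_def intro!: mult_left_mono)
  have d0: "1 \<le> ?E w" if "y < \<bar>Z w\<bar>" for w
    using powr_tail_bound[of y "Z w" 0 q] y q that by (auto split: if_splits)
  have d1: "\<bar>X w - Z w\<bar> \<le> ?E w" for w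
  proof (cases "\<bar>Z w\<bar> \<le> y")
    case False
    then have "\<bar>Z w\<bar> \<le> y * ?E w" using powr_tail_bound[of y "Z w" 1 q] y q by simp
    also have "\<dots> \<le> 1 * ?E w" using y by (intro mult_right_mono) auto
    finally show ?thesis using False by (simp add: X_def trunc_at_def)
  qed (simp add: X_def trunc_at_def)
  have d2: "\<bar>(X w)\<^sup>2 - (Z w)\<^sup>2\<bar> \<le> ?E w" for w
  proof (cases "\<bar>Z w\<bar> \<le> y")
    case False
    then have "\<bar>Z w\<bar>\<^sup>2 \<le> y\<^sup>2 * ?E w" using powr_tail_bound[of y "Z w" 2 q] y q by simp
    also have "\<dots> \<le> 1 * ?E w" using y by (intro mult_right_mono) (auto simp: power_le_one)
    finally show ?thesis using False by (simp add: X_def trunc_at_def)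
  qed (simp add: X_def trunc_at_def)
  have intX: "integrable M X"
    by (rule integrable_const_bound[where B = y]) (use bX in auto)
  have intX2: "integrable M (\<lambda>w. (X w)\<^sup>2)"
    by (rule integrable_const_bound[where B = "y\<^sup>2"]) (use bX y in \<open>auto intro!: AE_I2 simp: abs_le_square_iff[symmetric]\<close>)
  note iZ = has_bochner_integral_iff[THEN iffD1, OF Z] and iZ2 = has_bochner_integral_iff[THEN iffD1, OF Z2]
  have "\<P>(w in M. y < \<bar>Z w\<bar>) \<le> expectation ?E"
    by (rule prob_le_expectation[OF E(1)]) (use d0 in auto)
  then show "\<P>(w in M. y < \<bar>Z w\<bar>) \<le> \<theta>" using E(2) by linarith
  have "\<bar>expectation X\<bar> = \<bar>expectation (\<lambda>w. X w - Z w)\<bar>" using intX iZ by simp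
  also have "\<dots> \<le> expectation (\<lambda>w. \<bar>X w - Z w\<bar>)" by (rule integral_abs_bound)
  also have "\<dots> \<le> expectation ?E" using intX iZ by (intro integral_mono E d1) auto
  finally show EX: "\<bar>expectation X\<bar> \<le> \<theta>" using E(2) by linarith
  have "\<bar>expectation (\<lambda>w. (X w)\<^sup>2) - v\<bar> = \<bar>expectation (\<lambda>w. (X w)\<^sup>2 - (Z w)\<^sup>2)\<bar>" using intX2 iZ2 by simp
  also have "\<dots> \<le> expectation (\<lambda>w. \<bar>(X w)\<^sup>2 - (Z w)\<^sup>2\<bar>)" by (rule integral_abs_bound)
  also have "\<dots> \<le> expectation ?E" using intX2 iZ2 by (intro integral_mono E d2) auto
  finally show "\<bar>expectation (\<lambda>w. (X w)\<^sup>2) - v\<bar> \<le> \<theta>" using E(2) by linarith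
  have XZ2: "(X w)\<^sup>2 \<le> (Z w)\<^sup>2" for w by (simp add: X_def trunc_at_def)
  have cube: "\<bar>X w\<bar> ^ 3 * exp (h * \<bar>X w\<bar>) \<le> 3 * y * (Z w)\<^sup>2" for w
  proof -
    have "h * \<bar>X w\<bar> \<le> 1" using mult_left_mono[OF bX h(1), of w] h(2) by linarith
    then have "exp (h * \<bar>X w\<bar>) \<le> exp 1" by simp
    then have 1: "exp (h * \<bar>X w\<bar>) \<le> 3" using exp_le by linarith
    have "\<bar>X w\<bar> ^ 3 = \<bar>X w\<bar> * (X w)\<^sup>2" by (simp add: power3_eq_cube power2_eq_square)
    also have "\<dots> \<le> y * (Z w)\<^sup>2" using bX XZ2 y by (intro mult_mono) auto
    finally have "\<bar>X w\<bar> ^ 3 * exp (h * \<bar>X w\<bar>) \<le> (y * (Z w)\<^sup>2) * 3" using 1 y by (intro mult_mono) auto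
    then show ?thesis by simp
  qed
  have int3: "integrable M (\<lambda>w. \<bar>X w\<bar> ^ 3 * exp (h * \<bar>X w\<bar>))"
  proof (rule Bochner_Integration.integrable_bound)
    show "integrable M (\<lambda>w. 3 * y * (Z w)\<^sup>2)" using iZ2 by simp
    show "AE w in M. norm (\<bar>X w\<bar> ^ 3 * exp (h * \<bar>X w\<bar>)) \<le> norm (3 * y * (Z w)\<^sup>2)"
      using cube y by (auto intro!: AE_I2 simp: abs_mult)
  qed measurable
  have "expectation (\<lambda>w. \<bar>X w\<bar> ^ 3 * exp (h * \<bar>X w\<bar>)) \<le> expectation (\<lambda>w. 3 * y * (Z w)\<^sup>2)"
    using iZ2 by (intro integral_mono int3 cube) auto
  then show "expectation (\<lambda>w. \<bar>X w\<bar> ^ 3 * exp (h * \<bar>X w\<bar>)) \<le> 3 * y * v" using iZ2 by simp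
  \<comment> \<open>Taylor expansion to third order with h |X| \<le> 1: the exponential at the
    intermediate point is at most 3, so its sixth is below 1, and X^2 \<le> Z^2 restores the
    untruncated square.\<close>
  have expo: "exp (h * X w) \<le> 1 + h * X w + h\<^sup>2 / 2 * (Z w)\<^sup>2 + h ^ 3 * y * (Z w)\<^sup>2" for w
  proof -
    define u where "u = h * X w"
    have u: "\<bar>u\<bar> \<le> 1" using mult_left_mono[OF bX h(1), of w] h by (simp add: u_def abs_mult)
    obtain s where s: "\<bar>s\<bar> \<le> \<bar>u\<bar>" and "exp u = (\<Sum>k<3. u ^ k / fact k) + exp s / fact 3 * u ^ 3"
      using Maclaurin_exp_le[of u 3] by blast
    then have eq: "exp u = 1 + u + u\<^sup>2 / 2 + exp s / 6 * u ^ 3" by (simp add: eval_nat_numeral)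
    have "exp s \<le> exp 1" using s u by simp
    then have "exp s \<le> 3" using exp_le by linarith
    then have "exp s / 6 * \<bar>u\<bar> ^ 3 \<le> 1 * \<bar>u\<bar> ^ 3" by (intro mult_right_mono) auto
    moreover have "exp s / 6 * u ^ 3 \<le> exp s / 6 * \<bar>u\<bar> ^ 3"
      by (intro mult_left_mono) (simp_all flip: power_abs)
    moreover have "\<bar>u\<bar> ^ 3 = h ^ 3 * (\<bar>X w\<bar> * (X w)\<^sup>2)"
      using h by (simp add: u_def abs_mult power_mult_distrib power3_eq_cube power2_eq_square)
    moreover have "h ^ 3 * (\<bar>X w\<bar> * (X w)\<^sup>2) \<le> h ^ 3 * (y * (Z w)\<^sup>2)"
      using bX XZ2 y h by (intro mult_left_mono mult_mono) auto
    moreover have "h ^ 3 * (y * (Z w)\<^sup>2) = h ^ 3 * y * (Z w)\<^sup>2" by simp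
    moreover have "u\<^sup>2 / 2 \<le> h\<^sup>2 / 2 * (Z w)\<^sup>2"
      using XZ2[of w] by (simp add: u_def power_mult_distrib mult_left_mono)
    ultimately have "exp u \<le> 1 + u + h\<^sup>2 / 2 * (Z w)\<^sup>2 + h ^ 3 * y * (Z w)\<^sup>2"
      using eq by linarith
    then show ?thesis by (simp only: u_def)
  qed
  have "expectation (\<lambda>w. exp (h * X w))
      \<le> expectation (\<lambda>w. 1 + h * X w + h\<^sup>2 / 2 * (Z w)\<^sup>2 + h ^ 3 * y * (Z w)\<^sup>2)"
  proof (intro integral_mono expo)
    show "integrable M (\<lambda>w. exp (h * X w))"
    proof (rule integrable_const_bound[where B = "exp (h * y)"])
      have "h * X w \<le> h * y" for w using bX[of w] h(1) by (intro mult_left_mono) auto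
      then show "AE w in M. norm (exp (h * X w)) \<le> exp (h * y)" by simp
    qed measurable
  qed (use intX iZ2 in auto)
  also have "\<dots> = 1 + h * expectation X + h\<^sup>2 / 2 * v + h ^ 3 * y * v"
    using intX iZ2 by (simp add: prob_space)
  also have "\<dots> \<le> 1 + (h * \<theta> + h\<^sup>2 * v / 2 + h ^ 3 * y * v)"
    using EX h(1) by (auto intro!: mult_left_mono)
  also have "\<dots> \<le> exp (h * \<theta> + h\<^sup>2 * v / 2 + h ^ 3 * y * v)" by (rule exp_ge_add_one_self)
  finally show "expectation (\<lambda>w. exp (h * X w)) \<le> exp (h * \<theta> + h\<^sup>2 * v / 2 + h ^ 3 * y * v)" .
qed

text \<open>Only independence and moments are asked of the errors, neither a common law nor a
  particular space. The locale thereby covers both the errors of the model and the coordinates of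
  the product measure through which the quantiles are defined.\<close>

locale standardized_errors = prob_space M for M :: "'a measure" +
  fixes I :: "nat set" and e :: "nat \<Rightarrow> 'a \<Rightarrow> real" and q K :: real
  assumes finite_I: "finite I"
    and indep: "indep_vars (\<lambda>_. borel) e I"
    and mean_0: "\<And>i. i \<in> I \<Longrightarrow> has_bochner_integral M (e i) 0"
    and variance_1: "\<And>i. i \<in> I \<Longrightarrow> has_bochner_integral M (\<lambda>w. (e i w)\<^sup>2) 1"
    and q: "2 < q"
    and moment_int: "\<And>i. i \<in> I \<Longrightarrow> integrable M (\<lambda>w. \<bar>e i w\<bar> powr q)"
    and moment_le: "\<And>i. i \<in> I \<Longrightarrow> expectation (\<lambda>w. \<bar>e i w\<bar> powr q) \<le> K"
begin

lemma e_measurable [measurable]: "i \<in> I \<Longrightarrow> e i \<in> borel_measurable M"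
  using mean_0 by (auto dest: borel_measurable_has_bochner_integral)

text \<open>In the applications \<open>b i\<close> is x_ij / sqrt n up to sign: the squares add up
  to 1 and the q-th powers to something small. The truncation level y also bounds every single
  weight, which gives h |b i| \<le> 1 once h y \<le> 1; \<theta> is the total truncated
  mass.\<close>

context
  fixes b :: "nat \<Rightarrow> real" and L y \<theta> :: real
  assumes b2: "(\<Sum>i\<in>I. (b i)\<^sup>2) = 1" and bq: "(\<Sum>i\<in>I. \<bar>b i\<bar> powr q) \<le> L"
    and K: "0 \<le> K"
    and y: "0 < y" "y \<le> 1" and b_le: "\<And>i. i \<in> I \<Longrightarrow> \<bar>b i\<bar> \<le> y"
    and \<theta>: "\<theta> = K * L * y powr (- q)"
begin

definition weighted_moment :: "nat \<Rightarrow> real" where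
  "weighted_moment i = \<bar>b i\<bar> powr q * K"

lemma weighted_facts:
  assumes i: "i \<in> I"
  shows "has_bochner_integral M (\<lambda>w. b i * e i w) 0"
    and "has_bochner_integral M (\<lambda>w. (b i * e i w)\<^sup>2) ((b i)\<^sup>2)"
    and "integrable M (\<lambda>w. \<bar>b i * e i w\<bar> powr q)"
    and "expectation (\<lambda>w. \<bar>b i * e i w\<bar> powr q) \<le> weighted_moment i"
proof -
  show "has_bochner_integral M (\<lambda>w. b i * e i w) 0"
    using has_bochner_integral_mult_right[OF mean_0[OF i], of "b i"] by simp
  show "has_bochner_integral M (\<lambda>w. (b i * e i w)\<^sup>2) ((b i)\<^sup>2)"
    using has_bochner_integral_mult_right[OF variance_1[OF i], of "(b i)\<^sup>2"]
    by (simp add: power_mult_distrib)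
  have eq: "\<bar>b i * e i w\<bar> powr q = \<bar>b i\<bar> powr q * \<bar>e i w\<bar> powr q" for w
    by (simp add: abs_mult powr_mult)
  show "integrable M (\<lambda>w. \<bar>b i * e i w\<bar> powr q)"
    unfolding eq using moment_int[OF i] by simp
  show "expectation (\<lambda>w. \<bar>b i * e i w\<bar> powr q) \<le> weighted_moment i"
    unfolding eq weighted_moment_def using moment_le[OF i] by (simp add: mult_left_mono)
qed

lemma sum_weighted_moment_le: "(\<Sum>i\<in>I. y powr (- q) * weighted_moment i) \<le> \<theta>"
proof -
  have "(\<Sum>i\<in>I. y powr (- q) * weighted_moment i) = (y powr (- q) * K) * (\<Sum>i\<in>I. \<bar>b i\<bar> powr q)"
    by (simp add: weighted_moment_def sum_distrib_left sum_distrib_right ac_simps)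
  also have "\<dots> \<le> (y powr (- q) * K) * L" using K bq by (intro mult_left_mono) auto
  finally show ?thesis by (simp add: \<theta> ac_simps)
qed

lemma truncation_prob:
  "\<P>(w in M. (\<Sum>i\<in>I. b i * e i w) \<noteq> (\<Sum>i\<in>I. trunc_at y (b i * e i w))) \<le> \<theta>"
proof -
  have "\<P>(w in M. (\<Sum>i\<in>I. b i * e i w) \<noteq> (\<Sum>i\<in>I. trunc_at y (b i * e i w)))
      \<le> prob (\<Union>i\<in>I. {w \<in> space M. y < \<bar>b i * e i w\<bar>})"
  proof (rule finite_measure_mono)
    show "{w \<in> space M. (\<Sum>i\<in>I. b i * e i w) \<noteq> (\<Sum>i\<in>I. trunc_at y (b i * e i w))}
        \<subseteq> (\<Union>i\<in>I. {w \<in> space M. y < \<bar>b i * e i w\<bar>})"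
    proof (rule subsetI, rule ccontr)
      fix w assume *: "w \<in> {w \<in> space M. (\<Sum>i\<in>I. b i * e i w) \<noteq> (\<Sum>i\<in>I. trunc_at y (b i * e i w))}"
        and "w \<notin> (\<Union>i\<in>I. {w \<in> space M. y < \<bar>b i * e i w\<bar>})"
      then have "\<bar>b i * e i w\<bar> \<le> y" if "i \<in> I" for i using that by force
      then have "(\<Sum>i\<in>I. b i * e i w) = (\<Sum>i\<in>I. trunc_at y (b i * e i w))"
        by (intro sum.cong refl) (auto simp: trunc_at_def)
      then show False using * by simp
    qed
    show "(\<Union>i\<in>I. {w \<in> space M. y < \<bar>b i * e i w\<bar>}) \<in> events"
      by (intro sets.finite_UN finite_I) measurable
  qed
  also have "\<dots> \<le> (\<Sum>i\<in>I. \<P>(w in M. y < \<bar>b i * e i w\<bar>))"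
    by (intro finite_measure_subadditive_finite finite_I) auto
  also have "\<dots> \<le> (\<Sum>i\<in>I. y powr (- q) * weighted_moment i)"
    by (intro sum_mono truncation_moments(1)[OF weighted_facts q y order_refl]) auto
  also note sum_weighted_moment_le
  finally show ?thesis .
qed

text \<open>The squares of the weights sum to 1, so the exponents of the summands add up to at most
  h^2/2 plus the small terms h \<theta> and h^3 y, and the substituted normals combine into one
  standard normal. The error is proportional to exp(h^2/2), which the factor exp(- h a) of a step at
  a near h reduces to about exp(- h^2/2).\<close>

lemma smooth_clt:
  assumes tb: "taylor2_bound h B f f1 f2" and h: "0 \<le> h" "h * y \<le> 1"
  shows "\<bar>expectation (\<lambda>w. f (\<Sum>i\<in>I. trunc_at y (b i * e i w))) - (\<integral>z. f z \<partial>gauss)\<bar>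
    \<le> B * exp (h\<^sup>2 / 2 + h * \<theta> + h ^ 3 * y) * (2 * \<theta> + (3 + gauss_cube) * y)"
proof -
  define X where "X = (\<lambda>i w. trunc_at y (b i * e i w))"
  define a where "a = (\<lambda>i. h * (y powr (- q) * weighted_moment i) + h\<^sup>2 * (b i)\<^sup>2 / 2 + h ^ 3 * y * (b i)\<^sup>2)"
  define R where "R = (\<lambda>i. 2 * (y powr (- q) * weighted_moment i) + (3 + gauss_cube) * y * (b i)\<^sup>2)"
  note tm = truncation_moments[OF weighted_facts q y h]
  have m0: "0 \<le> weighted_moment i" for i using K by (simp add: weighted_moment_def)
  have "\<bar>expectation (\<lambda>w. f (\<Sum>i\<in>I. X i w)) - (\<integral>z. f (sqrt (\<Sum>i\<in>I. \<bar>b i\<bar>\<^sup>2) * z) \<partial>gauss)\<bar>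
      \<le> B * exp (sum a I) * sum R I"
  proof (rule lindeberg[OF finite_I _ _ h(1) _ _ _ _ _ tb])
    show "indep_vars (\<lambda>_. borel) X I"
      unfolding X_def by (rule indep_vars_compose2[OF indep]) measurable
    show "\<bar>X i w\<bar> \<le> y" for i w unfolding X_def using y by (simp add: trunc_at_bounded)
    fix i assume i: "i \<in> I"
    show "h * \<bar>b i\<bar> \<le> 1" using mult_left_mono[OF b_le[OF i] h(1)] h(2) by linarith
    show "expectation (\<lambda>w. exp (h * X i w)) \<le> exp (a i)"
      unfolding X_def a_def by (rule tm(5)[OF i i i i])
    show "h\<^sup>2 * \<bar>b i\<bar>\<^sup>2 / 2 \<le> a i"
      unfolding a_def using h(1) y m0[of i] by simp
    have "\<bar>b i\<bar> ^ 3 = \<bar>b i\<bar> * (b i)\<^sup>2" by (simp add: power3_eq_cube power2_eq_square)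
    also have "\<dots> \<le> y * (b i)\<^sup>2" by (intro mult_right_mono b_le i) auto
    finally have "\<bar>b i\<bar> ^ 3 * gauss_cube \<le> y * (b i)\<^sup>2 * gauss_cube" by (intro mult_right_mono) auto
    then show "exchange_error h (X i) \<bar>b i\<bar> \<le> R i"
      using tm(2-4)[OF i i i i] unfolding exchange_error_def X_def R_def by (simp add: algebra_simps)
  qed auto
  also have "B * exp (sum a I) * sum R I
      \<le> B * exp (h\<^sup>2 / 2 + h * \<theta> + h ^ 3 * y) * (2 * \<theta> + (3 + gauss_cube) * y)"
  proof (intro mult_mono mult_left_mono)
    have "sum a I = h * (\<Sum>i\<in>I. y powr (- q) * weighted_moment i) + h\<^sup>2 / 2 * (\<Sum>i\<in>I. (b i)\<^sup>2) + h ^ 3 * y * (\<Sum>i\<in>I. (b i)\<^sup>2)"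
      unfolding a_def sum.distrib by (simp add: sum_distrib_left)
    also have "\<dots> \<le> h * \<theta> + h\<^sup>2 / 2 + h ^ 3 * y"
      unfolding b2 using mult_left_mono[OF sum_weighted_moment_le h(1)] by simp
    finally show "exp (sum a I) \<le> exp (h\<^sup>2 / 2 + h * \<theta> + h ^ 3 * y)" by simp
    have "sum R I = 2 * (\<Sum>i\<in>I. y powr (- q) * weighted_moment i) + (3 + gauss_cube) * y * (\<Sum>i\<in>I. (b i)\<^sup>2)"
      unfolding R_def sum.distrib by (simp add: sum_distrib_left)
    also have "\<dots> \<le> 2 * \<theta> + (3 + gauss_cube) * y"
      unfolding b2 using sum_weighted_moment_le by simp
    finally show "sum R I \<le> 2 * \<theta> + (3 + gauss_cube) * y" .
    show "0 \<le> sum R I" unfolding R_def using m0 y by (intro sum_nonneg) auto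
  qed (use taylor2_boundD(7)[OF tb] in auto)
  finally show ?thesis unfolding X_def by (simp add: b2)
qed

text \<open>Off the truncation event the two sums agree, so P may be tested on the truncated sum and
  majorised there by g.\<close>

lemma prob_sum_le_truncated:
  assumes [measurable]: "Measurable.pred borel P" "g \<in> borel_measurable borel"
    and g: "\<And>u. 0 \<le> g u" "\<And>u. g u \<le> 1" "\<And>u. P u \<Longrightarrow> 1 \<le> g u"
  shows "\<P>(w in M. P (\<Sum>i\<in>I. b i * e i w)) \<le> \<theta> + expectation (\<lambda>w. g (\<Sum>i\<in>I. trunc_at y (b i * e i w)))"
proof -
  let ?S = "\<lambda>w. \<Sum>i\<in>I. b i * e i w" and ?X = "\<lambda>w. \<Sum>i\<in>I. trunc_at y (b i * e i w)"
  have [measurable]: "?X \<in> borel_measurable M" "?S \<in> borel_measurable M"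
    by (auto intro!: borel_measurable_sum)
  have "\<P>(w in M. P (?S w)) \<le> prob ({w \<in> space M. ?S w \<noteq> ?X w} \<union> {w \<in> space M. P (?X w)})"
    by (intro finite_measure_mono) auto
  also have "\<dots> \<le> \<P>(w in M. ?S w \<noteq> ?X w) + \<P>(w in M. P (?X w))"
    by (intro measure_Un_le) auto
  also have "\<P>(w in M. P (?X w)) \<le> expectation (\<lambda>w. g (?X w))"
    by (intro prob_le_expectation integrable_const_bound[where B = 1]) (use g in auto)
  finally show ?thesis using truncation_prob by linarith
qed

text \<open>The tilt equals the threshold t, which minimises exp(h^2/2 - h t). The step rises from t
  - 2d to t - d: one d is spent on smoothing, the other is reserved for the random denominator,
  which lowers the threshold from t to t - d.\<close>

lemma moderate_deviation_bound:
  assumes d: "0 < d" "d \<le> 1" and t: "0 \<le> t" "t * y \<le> 1"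
  shows "\<P>(w in M. t - d < (\<Sum>i\<in>I. b i * e i w))
    \<le> \<theta> + normal_tail (t - 2 * d)
      + 1680 / d ^ 3 * exp (- t\<^sup>2 / 2 + 2 * t * d + t * \<theta> + t ^ 3 * y) * (2 * \<theta> + (3 + gauss_cube) * y)"
proof -
  let ?f = "smooth_step (t - 2 * d) d"
  let ?B = "1680 / d ^ 3 * exp (- t * (t - 2 * d))"
  obtain f1 f2 where tb: "taylor2_bound t ?B ?f f1 f2"
    using smooth_step_taylor2_bound[OF d t(1), of "t - 2 * d"] by blast
  note [measurable] = taylor2_boundD(1)[OF tb]
  have "\<P>(w in M. t - d < (\<Sum>i\<in>I. b i * e i w))
      \<le> \<theta> + expectation (\<lambda>w. ?f (\<Sum>i\<in>I. trunc_at y (b i * e i w)))"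
    by (rule prob_sum_le_truncated) (use smooth_step_bounds smooth_step_eq_1[of d "t - 2 * d"] d in auto)
  moreover have "expectation (\<lambda>w. ?f (\<Sum>i\<in>I. trunc_at y (b i * e i w))) \<le> (\<integral>z. ?f z \<partial>gauss)
      + ?B * exp (t\<^sup>2 / 2 + t * \<theta> + t ^ 3 * y) * (2 * \<theta> + (3 + gauss_cube) * y)"
    using smooth_clt[OF tb t] by linarith
  moreover have "(\<integral>z. ?f z \<partial>gauss) \<le> (\<integral>z. indicator {t - 2 * d<..} z \<partial>gauss)"
  proof (rule integral_mono)
    show "integrable gauss ?f"
      by (rule gauss.integrable_const_bound[where B = 1]) (use smooth_step_bounds in auto)
    fix z
    show "?f z \<le> indicator {t - 2 * d<..} z"
      using smooth_step_eq_0[of d z "t - 2 * d"] smooth_step_bounds(2)[of "t - 2 * d" d z] d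
      by (auto simp: indicator_def)
  qed (auto simp: integrable_indicator_iff gauss.emeasure_eq_measure)
  moreover have "(\<integral>z. indicator {t - 2 * d<..} z \<partial>gauss) = normal_tail (t - 2 * d)"
    by (simp add: normal_tail_def)
  moreover have "?B * exp (t\<^sup>2 / 2 + t * \<theta> + t ^ 3 * y)
      = 1680 / d ^ 3 * exp (- t * (t - 2 * d) + (t\<^sup>2 / 2 + t * \<theta> + t ^ 3 * y))"
    by (simp only: exp_add mult.assoc)
  moreover have "- t * (t - 2 * d) + (t\<^sup>2 / 2 + t * \<theta> + t ^ 3 * y) = - t\<^sup>2 / 2 + 2 * t * d + t * \<theta> + t ^ 3 * y"
    by (simp add: power2_eq_square algebra_simps)
  ultimately show ?thesis by (simp only:)
qed

text \<open>Anticoncentration at 0, which later keeps the quantiles positive. The difference of the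
  steps starting at -d and at 0 equals 1 at 0 and lives on (-d, d]; the threshold is fixed, so the
  tilt is h = 0. The term 2 d is the width times the bound 1 for the normal density, and 3360 = 2 *
  1680 counts two applications of the smooth central limit bound.\<close>

lemma prob_sum_eq_0:
  assumes d: "0 < d" "d \<le> 1"
  shows "\<P>(w in M. (\<Sum>i\<in>I. b i * e i w) = 0)
    \<le> \<theta> + 2 * d + 3360 / d ^ 3 * (2 * \<theta> + (3 + gauss_cube) * y)"
proof -
  let ?f = "smooth_step (- d) d" and ?g = "smooth_step 0 d"
  let ?X = "\<lambda>w. \<Sum>i\<in>I. trunc_at y (b i * e i w)"
  define R where "R = 1680 / d ^ 3 * (2 * \<theta> + (3 + gauss_cube) * y)"
  obtain f1 f2 where tf: "taylor2_bound 0 (1680 / d ^ 3) ?f f1 f2"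
    using smooth_step_taylor2_bound[OF d order_refl, of "- d"] by auto
  obtain g1 g2 where tg: "taylor2_bound 0 (1680 / d ^ 3) ?g g1 g2"
    using smooth_step_taylor2_bound[OF d order_refl, of 0] by auto
  note [measurable] = taylor2_boundD(1)[OF tf] taylor2_boundD(1)[OF tg]
  have [measurable]: "?X \<in> borel_measurable M"
    by (auto intro!: borel_measurable_sum)
  have intM: "integrable M (\<lambda>w. ?f (?X w))" "integrable M (\<lambda>w. ?g (?X w))"
    by (rule integrable_const_bound[where B = 1]; use smooth_step_bounds in auto)+
  have intG: "integrable gauss ?f" "integrable gauss ?g"
    by (rule gauss.integrable_const_bound[where B = 1]; use smooth_step_bounds in auto)+
  have "\<P>(w in M. (\<Sum>i\<in>I. b i * e i w) = 0) \<le> \<theta> + expectation (\<lambda>w. ?f (?X w) - ?g (?X w))"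
  proof (rule prob_sum_le_truncated)
    fix u
    show "0 \<le> ?f u - ?g u" using smooth_step_mono[of d "- d" 0 u] d by simp
    show "?f u - ?g u \<le> 1" using smooth_step_bounds(2)[of "- d" d u] smooth_step_bounds(1)[of 0 d u] by linarith
    show "1 \<le> ?f u - ?g u" if "u = 0"
      using smooth_step_eq_1[of d "- d" 0] smooth_step_eq_0[of d 0 0] d that by simp
  qed measurable
  also have "expectation (\<lambda>w. ?f (?X w) - ?g (?X w)) \<le> ((\<integral>z. ?f z \<partial>gauss) - (\<integral>z. ?g z \<partial>gauss)) + 2 * R"
  proof -
    have "\<bar>expectation (\<lambda>w. ?f (?X w)) - (\<integral>z. ?f z \<partial>gauss)\<bar> \<le> R"
      using smooth_clt[OF tf order_refl] by (simp add: R_def)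
    moreover have "\<bar>expectation (\<lambda>w. ?g (?X w)) - (\<integral>z. ?g z \<partial>gauss)\<bar> \<le> R"
      using smooth_clt[OF tg order_refl] by (simp add: R_def)
    ultimately show ?thesis using intM by simp
  qed
  also have "(\<integral>z. ?f z \<partial>gauss) - (\<integral>z. ?g z \<partial>gauss) = (\<integral>z. ?f z - ?g z \<partial>gauss)"
    using intG by simp
  also have "\<dots> \<le> (\<integral>z. indicator {- d<..d} z \<partial>gauss)"
  proof (rule integral_mono)
    fix z
    show "?f z - ?g z \<le> indicator {- d<..d} z"
    proof (cases "z \<le> - d \<or> d < z")
      case True
      then show ?thesis
        using smooth_step_eq_0[of d z "- d"] smooth_step_eq_0[of d z 0]
          smooth_step_eq_1[of d "- d" z] smooth_step_eq_1[of d 0 z] d by auto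
    next
      case False
      then show ?thesis
        using smooth_step_bounds[of "- d" d z] smooth_step_bounds[of 0 d z] by (auto simp: indicator_def)
    qed
  qed (use intG in \<open>auto simp: integrable_indicator_iff gauss.emeasure_eq_measure\<close>)
  also have "\<dots> = measure gauss {- d<..d}" by simp
  also have "\<dots> \<le> (d - (- d)) * 1"
  proof (rule gauss_interval_le)
    fix z :: real
    have "1 \<le> sqrt (2 * pi)" using pi_ge_two by simp
    then have "exp (- z\<^sup>2 / 2) / sqrt (2 * pi) \<le> 1 / 1" by (intro frac_le) auto
    then show "std_normal_density z \<le> 1" by (simp add: std_normal_density_def)
  qed (use d in auto)
  finally show ?thesis by (simp add: R_def)
qed

end

end

subsection \<open>Deviations of the sum of squares\<close>

text \<open>A squared error has q/2 moments, possibly fewer than two, so the quadratic remainder of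
  exp is replaced by a power g between 1 and 2. On |v| \<le> 1 the square is below this power, for v
  < -1 the power dominates the linear term, and for v > 1 the cap U bounds exp v itself.\<close>

lemma exp_le_powr_remainder:
  fixes v U g :: real
  assumes "v \<le> U" "0 \<le> U" "1 \<le> g" "g \<le> 2"
  shows "exp v \<le> 1 + v + 3 * exp U * \<bar>v\<bar> powr g"
proof -
  have U: "1 \<le> exp U" using assms by simp
  consider "\<bar>v\<bar> \<le> 1" | "v < -1" | "1 < v" by linarith
  then show ?thesis
  proof cases
    case 1
    obtain s where s: "\<bar>s\<bar> \<le> \<bar>v\<bar>" and "exp v = (\<Sum>k<2. v ^ k / fact k) + exp s / fact 2 * v ^ 2"
      using Maclaurin_exp_le[of v 2] by blast
    then have eq: "exp v = 1 + v + exp s / 2 * v\<^sup>2" by (simp add: eval_nat_numeral)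
    have "exp s \<le> exp 1" using s 1 by simp
    then have s3: "exp s / 2 \<le> 3" using exp_le by linarith
    have "v\<^sup>2 \<le> \<bar>v\<bar> powr g"
    proof (cases "v = 0")
      case False
      then have "\<bar>v\<bar> powr 2 \<le> \<bar>v\<bar> powr g" using 1 assms by (intro powr_mono') auto
      then show ?thesis using False by simp
    qed simp
    then have "exp s / 2 * v\<^sup>2 \<le> 3 * \<bar>v\<bar> powr g" using s3 by (intro mult_mono) auto
    also have "\<dots> \<le> 3 * exp U * \<bar>v\<bar> powr g" using U by (intro mult_right_mono) auto
    finally show ?thesis using eq by linarith
  next
    case 2
    have "\<bar>v\<bar> powr 1 \<le> \<bar>v\<bar> powr g" using 2 assms by (intro powr_mono) auto
    moreover have "1 \<le> 3 * exp U" using U by linarith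
    ultimately have "\<bar>v\<bar> * 1 \<le> \<bar>v\<bar> powr g * (3 * exp U)" using 2 by (intro mult_mono) auto
    moreover have "\<bar>v\<bar> powr g * (3 * exp U) = 3 * exp U * \<bar>v\<bar> powr g" by simp
    moreover have "exp v \<le> 1" using 2 by simp
    ultimately show ?thesis using 2 by linarith
  next
    case 3
    have "1 \<le> \<bar>v\<bar> powr g" using 3 assms by (intro ge_one_powr_ge_zero) auto
    then have "exp U * 1 \<le> exp U * \<bar>v\<bar> powr g" by (intro mult_left_mono) auto
    moreover have "exp v \<le> exp U" using assms by simp
    moreover have "0 \<le> exp U * \<bar>v\<bar> powr g" by simp
    ultimately show ?thesis using 3 by linarith
  qed
qed

context standardized_errors
begin

text \<open>The squares of the errors have q/2 moments; the cap 2 is the order of the Taylor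
  remainder of exp.\<close>

definition sq_exponent :: real where
  "sq_exponent = min (q / 2) 2"

lemma sq_exponent: "1 \<le> sq_exponent" "sq_exponent \<le> 2"
  using q by (auto simp: sq_exponent_def)

lemma sq_moment_pointwise: "\<bar>z\<^sup>2\<bar> powr sq_exponent \<le> 1 + \<bar>z\<bar> powr q" for z :: real
proof (cases "\<bar>z\<bar> \<le> 1")
  case True
  then have "z\<^sup>2 \<le> 1" by (simp add: abs_square_le_1)
  then have "\<bar>z\<^sup>2\<bar> powr sq_exponent \<le> 1" using sq_exponent by (intro powr_le1) auto
  then show ?thesis by (simp add: add_increasing2)
next
  case False
  have "\<bar>z\<^sup>2\<bar> = \<bar>z\<bar> powr 2" using False by simp
  then have "\<bar>z\<^sup>2\<bar> powr sq_exponent = \<bar>z\<bar> powr (2 * sq_exponent)" by (simp only: powr_powr)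
  also have "\<dots> \<le> \<bar>z\<bar> powr q" using False by (intro powr_mono) (auto simp: sq_exponent_def)
  finally show ?thesis by simp
qed

text \<open>One estimate for both tails of the sum of squares: v = - h e^2 with c = - h and U = 0
  for the lower one, v = h times the truncated square with c = h and U = h y for the upper
  one.\<close>

lemma mgf_dominated_by_square:
  assumes i: "i \<in> I" and [measurable]: "v \<in> borel_measurable M"
    and v: "\<And>w. v w \<le> U" "\<And>w. v w \<le> c * (e i w)\<^sup>2" "\<And>w. \<bar>v w\<bar> \<le> \<bar>c * (e i w)\<^sup>2\<bar>" and U: "0 \<le> U"
  shows "integrable M (\<lambda>w. exp (v w))"
    "expectation (\<lambda>w. exp (v w)) \<le> exp (3 * exp U * (1 + K) * \<bar>c\<bar> powr sq_exponent + c)"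
proof -
  note i2 = has_bochner_integral_iff[THEN iffD1, OF variance_1[OF i]]
  let ?D = "3 * exp U * \<bar>c\<bar> powr sq_exponent"
  show int: "integrable M (\<lambda>w. exp (v w))"
    by (rule integrable_const_bound[where B = "exp U"]) (use v in auto)
  have "expectation (\<lambda>w. exp (v w)) \<le> expectation (\<lambda>w. 1 + c * (e i w)\<^sup>2 + ?D * (1 + \<bar>e i w\<bar> powr q))"
  proof (rule integral_mono[OF int])
    fix w
    have "\<bar>v w\<bar> powr sq_exponent \<le> \<bar>c * (e i w)\<^sup>2\<bar> powr sq_exponent"
      using v(3) sq_exponent by (intro powr_mono2) auto
    also have "\<dots> = \<bar>c\<bar> powr sq_exponent * \<bar>(e i w)\<^sup>2\<bar> powr sq_exponent"
      by (simp add: abs_mult powr_mult)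
    also have "\<dots> \<le> \<bar>c\<bar> powr sq_exponent * (1 + \<bar>e i w\<bar> powr q)"
      by (intro mult_left_mono sq_moment_pointwise) auto
    finally have "3 * exp U * \<bar>v w\<bar> powr sq_exponent \<le> 3 * exp U * (\<bar>c\<bar> powr sq_exponent * (1 + \<bar>e i w\<bar> powr q))"
      by (rule mult_left_mono) simp
    moreover have "exp (v w) \<le> 1 + v w + 3 * exp U * \<bar>v w\<bar> powr sq_exponent"
      by (rule exp_le_powr_remainder) (use sq_exponent v(1) U in auto)
    ultimately show "exp (v w) \<le> 1 + c * (e i w)\<^sup>2 + ?D * (1 + \<bar>e i w\<bar> powr q)"
      using v(2)[of w] by (simp only: mult.assoc)
  qed (use i2 moment_int[OF i] in auto)
  also have "\<dots> = 1 + c + ?D * (1 + expectation (\<lambda>w. \<bar>e i w\<bar> powr q))"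
    using i2 moment_int[OF i] by (simp add: prob_space)
  also have "\<dots> \<le> 1 + c + ?D * (1 + K)"
    using moment_le[OF i] by (intro add_left_mono mult_left_mono) auto
  also have "\<dots> = 1 + (3 * exp U * (1 + K) * \<bar>c\<bar> powr sq_exponent + c)" by simp
  also have "\<dots> \<le> exp (3 * exp U * (1 + K) * \<bar>c\<bar> powr sq_exponent + c)" by (rule exp_ge_add_one_self)
  finally show "expectation (\<lambda>w. exp (v w)) \<le> exp (3 * exp U * (1 + K) * \<bar>c\<bar> powr sq_exponent + c)" .
qed

lemma squares_lower_tail:
  assumes h: "0 \<le> h"
  shows "\<P>(w in M. (\<Sum>i\<in>I. (e i w)\<^sup>2) < real (card I) * (1 - r))
    \<le> exp (real (card I) * (3 * (1 + K) * h powr sq_exponent - h * r))"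
proof -
  let ?n = "real (card I)" and ?C = "3 * exp 0 * (1 + K) * \<bar>- h\<bar> powr sq_exponent"
  let ?S = "\<lambda>w. \<Sum>i\<in>I. (e i w)\<^sup>2"
  have ind: "indep_vars (\<lambda>_. borel) (\<lambda>i w. (e i w)\<^sup>2) I"
    by (rule indep_vars_compose2[OF indep]) measurable
  have mgf: "integrable M (\<lambda>w. exp ((- h) * (e i w)\<^sup>2))"
    "expectation (\<lambda>w. exp ((- h) * (e i w)\<^sup>2)) \<le> exp (?C + - h)" if "i \<in> I" for i
    using mgf_dominated_by_square[OF that, of "\<lambda>w. (- h) * (e i w)\<^sup>2" 0 "- h"] h that by auto
  have [measurable]: "?S \<in> borel_measurable M" by (auto intro!: borel_measurable_sum)
  have "\<P>(w in M. ?S w < ?n * (1 - r)) \<le> \<P>(w in M. (- h) * (?n * (1 - r)) \<le> (- h) * ?S w)"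
    using h by (intro finite_measure_mono) (auto intro: mult_left_mono)
  also have "\<dots> \<le> exp ((\<Sum>i\<in>I. ?C + - h) - (- h) * (?n * (1 - r)))"
    by (rule chernoff_bound[OF finite_I ind mgf])
  finally show ?thesis using h by (simp add: algebra_simps)
qed

text \<open>Squares are unbounded above, so they are truncated at y before the exponential Markov
  inequality; exceeding y costs at most K y^(-q/2) per observation, by Markov's inequality for the
  q-th moment.\<close>

lemma squares_upper_tail:
  assumes h: "0 \<le> h" and y: "0 < y"
  shows "\<P>(w in M. real (card I) * (1 + r) < (\<Sum>i\<in>I. (e i w)\<^sup>2))
    \<le> real (card I) * K * y powr (- q / 2)
      + exp (real (card I) * (3 * exp (h * y) * (1 + K) * h powr sq_exponent - h * r))"
proof -
  let ?n = "real (card I)" and ?C = "3 * exp (h * y) * (1 + K) * h powr sq_exponent"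
  let ?Y = "\<lambda>i w. trunc_at y ((e i w)\<^sup>2)"
  let ?S = "\<lambda>w. \<Sum>i\<in>I. (e i w)\<^sup>2" and ?T = "\<lambda>w. \<Sum>i\<in>I. ?Y i w"
  have Yb: "0 \<le> ?Y i w" "?Y i w \<le> y" "?Y i w \<le> (e i w)\<^sup>2" for i w
    using y by (auto simp: trunc_at_def)
  have ind: "indep_vars (\<lambda>_. borel) ?Y I"
    by (rule indep_vars_compose2[OF indep]) measurable
  have mgf: "integrable M (\<lambda>w. exp (h * ?Y i w))" "expectation (\<lambda>w. exp (h * ?Y i w)) \<le> exp (?C + h)"
    if "i \<in> I" for i
    using mgf_dominated_by_square[OF that, of "\<lambda>w. h * ?Y i w" "h * y" h] that h y Yb
    by (auto simp: abs_mult mult_left_mono)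
  have [measurable]: "?S \<in> borel_measurable M" "?T \<in> borel_measurable M" by (auto intro!: borel_measurable_sum)
  have "\<P>(w in M. ?n * (1 + r) < ?T w) \<le> \<P>(w in M. h * (?n * (1 + r)) \<le> h * ?T w)"
    using h by (intro finite_measure_mono) (auto intro: mult_left_mono)
  also have "\<dots> \<le> exp ((\<Sum>i\<in>I. ?C + h) - h * (?n * (1 + r)))"
    by (rule chernoff_bound[OF finite_I ind mgf])
  finally have 1: "\<P>(w in M. ?n * (1 + r) < ?T w) \<le> exp (?n * (?C - h * r))"
    by (simp add: algebra_simps)
  have tail: "\<P>(w in M. y < (e i w)\<^sup>2) \<le> K * y powr (- q / 2)" if i: "i \<in> I" for i
  proof -
    have "\<P>(w in M. y < (e i w)\<^sup>2) \<le> expectation (\<lambda>w. \<bar>e i w\<bar> powr q * y powr (- q / 2))"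
    proof (rule prob_le_expectation)
      fix w assume that: "y < (e i w)\<^sup>2"
      have "sqrt y \<le> \<bar>e i w\<bar>" using that real_sqrt_less_mono[OF that] by simp
      then have "y powr (1 / 2) \<le> \<bar>e i w\<bar>" using y by (simp add: powr_half_sqrt)
      then have "(y powr (1 / 2)) powr q \<le> \<bar>e i w\<bar> powr q" using q by (intro powr_mono2) auto
      then have "y powr (q / 2) * y powr (- q / 2) \<le> \<bar>e i w\<bar> powr q * y powr (- q / 2)"
        by (intro mult_right_mono) (auto simp: powr_powr)
      then show "1 \<le> \<bar>e i w\<bar> powr q * y powr (- q / 2)" using y by (simp flip: powr_add)
    qed (use moment_int[OF i] i in auto)
    also have "\<dots> \<le> K * y powr (- q / 2)"
      using moment_le[OF i] by (simp add: mult_right_mono)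
    finally show ?thesis .
  qed
  have "\<P>(w in M. ?n * (1 + r) < ?S w)
      \<le> prob ((\<Union>i\<in>I. {w \<in> space M. y < (e i w)\<^sup>2}) \<union> {w \<in> space M. ?n * (1 + r) < ?T w})"
  proof (rule finite_measure_mono)
    show "{w \<in> space M. ?n * (1 + r) < ?S w}
        \<subseteq> (\<Union>i\<in>I. {w \<in> space M. y < (e i w)\<^sup>2}) \<union> {w \<in> space M. ?n * (1 + r) < ?T w}"
    proof (rule subsetI, rule ccontr)
      fix w assume *: "w \<in> {w \<in> space M. ?n * (1 + r) < ?S w}"
        and **: "w \<notin> (\<Union>i\<in>I. {w \<in> space M. y < (e i w)\<^sup>2}) \<union> {w \<in> space M. ?n * (1 + r) < ?T w}"
      then have "(e i w)\<^sup>2 \<le> y" if "i \<in> I" for i using that by force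
      then have "?S w = ?T w" by (intro sum.cong refl) (auto simp: trunc_at_def)
      then show False using * ** by simp
    qed
    show "(\<Union>i\<in>I. {w \<in> space M. y < (e i w)\<^sup>2}) \<union> {w \<in> space M. ?n * (1 + r) < ?T w} \<in> events"
      by (intro sets.Un sets.finite_UN finite_I) measurable
  qed
  also have "\<dots> \<le> prob (\<Union>i\<in>I. {w \<in> space M. y < (e i w)\<^sup>2}) + \<P>(w in M. ?n * (1 + r) < ?T w)"
    by (intro measure_Un_le sets.finite_UN finite_I) measurable
  also have "prob (\<Union>i\<in>I. {w \<in> space M. y < (e i w)\<^sup>2}) \<le> (\<Sum>i\<in>I. \<P>(w in M. y < (e i w)\<^sup>2))"
    by (intro finite_measure_subadditive_finite finite_I) auto
  also have "\<dots> \<le> (\<Sum>i\<in>I. K * y powr (- q / 2))" by (intro sum_mono tail)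
  finally show ?thesis using 1 by simp
qed

end

subsection \<open>The statistic Lambda\<close>

lemma standardized_errorsI:
  assumes M: "prob_space M" and I: "finite I" and indep: "prob_space.indep_vars M (\<lambda>_. borel) e I"
    and law: "\<And>i. i \<in> I \<Longrightarrow> distr M borel (e i) = F"
    and F: "real_distribution F" "standardized_law F" and q: "2 < q"
    and K: "(\<integral>\<^sup>+ e. ennreal (\<bar>e\<bar> powr q) \<partial>F) \<le> ennreal K" "0 \<le> K"
  shows "standardized_errors M I e q K"
proof -
  interpret M: prob_space M by fact
  interpret F: real_distribution F by fact
  have rv: "e i \<in> borel_measurable M" if "i \<in> I" for i
    using indep that by (auto simp: M.indep_vars_def)
  have tr: "has_bochner_integral M (\<lambda>w. g (e i w)) v" if "has_bochner_integral F g v" "i \<in> I" for g :: "real \<Rightarrow> real" and i v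
  proof -
    have [measurable]: "g \<in> borel_measurable borel"
      using borel_measurable_has_bochner_integral[OF that(1)] by simp
    have "has_bochner_integral (distr M borel (e i)) g v" unfolding law[OF that(2)] by (rule that(1))
    then show ?thesis using rv[OF that(2)]
      by (auto simp: has_bochner_integral_iff integrable_distr_eq integral_distr)
  qed
  have "(\<integral>\<^sup>+ e. ennreal (\<bar>e\<bar> powr q) \<partial>F) < \<infinity>"
    using K(1) by (rule le_less_trans) simp
  then have intq: "integrable F (\<lambda>e. \<bar>e\<bar> powr q)"
    by (intro integrableI_nonneg) auto
  have leq: "(\<integral>e. \<bar>e\<bar> powr q \<partial>F) \<le> K"
  proof -
    have "ennreal (\<integral>e. \<bar>e\<bar> powr q \<partial>F) \<le> ennreal K"
      using K(1) by (simp add: nn_integral_eq_integral[OF intq])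
    then show ?thesis using K(2) by simp
  qed
  note trq = tr[OF has_bochner_integral_integrable[OF intq]]
  show ?thesis
  proof
    fix i assume i: "i \<in> I"
    show "has_bochner_integral M (e i) 0" "has_bochner_integral M (\<lambda>w. (e i w)\<^sup>2) 1"
      using F(2) tr[OF _ i] by (auto simp: standardized_law_def)
    show "integrable M (\<lambda>w. \<bar>e i w\<bar> powr q)" "M.expectation (\<lambda>w. \<bar>e i w\<bar> powr q) \<le> K"
      using trq[OF i] leq by (auto simp: has_bochner_integral_iff)
  qed (use I q indep in auto)
qed

text \<open>\<open>Lambda_quantile\<close> refers to the product measure, so the tail bounds must be
  available for its coordinate functions.\<close>

lemma standardized_errors_PiM:
  assumes F: "real_distribution F" "standardized_law F" and q: "2 < q" and n: "1 \<le> n"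
    and K: "(\<integral>\<^sup>+ e. ennreal (\<bar>e\<bar> powr q) \<partial>F) \<le> ennreal K" "0 \<le> K"
  shows "standardized_errors (PiM {1..n} (\<lambda>_. F)) {1..n} (\<lambda>i w. w i) q K"
proof (rule standardized_errorsI[OF _ _ _ _ F q K])
  interpret F: real_distribution F by fact
  let ?P = "PiM {1..n} (\<lambda>_. F)"
  interpret P: prob_space ?P by (rule prob_space_PiM) (rule F.prob_space_axioms)
  show "prob_space ?P" by (rule P.prob_space_axioms)
  have rv: "(\<lambda>w. w i) \<in> borel_measurable ?P" if "i \<in> {1..n}" for i
    using measurable_component_singleton[OF that, of "\<lambda>_. F"]
    by (simp only: measurable_cong_sets[OF refl F.events_eq_borel])
  show law: "distr ?P borel (\<lambda>w. w i) = F" if "i \<in> {1..n}" for i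
  proof -
    have "distr ?P borel (\<lambda>w. w i) = distr ?P F (\<lambda>w. w i)"
      by (rule distr_cong) auto
    also have "\<dots> = F"
      by (rule distr_PiM_component[OF _ that]) (rule F.prob_space_axioms)
    finally show ?thesis .
  qed
  show "P.indep_vars (\<lambda>_. borel) (\<lambda>i w. w i) {1..n}"
  proof (subst P.indep_vars_iff_distr_eq_PiM')
    have "distr ?P (PiM {1..n} (\<lambda>_. borel)) (\<lambda>w. restrict (\<lambda>i. w i) {1..n}) = distr ?P ?P (\<lambda>w. w)"
      by (rule distr_cong) (auto simp: space_PiM intro!: sets_PiM_cong)
    also have "\<dots> = PiM {1..n} (\<lambda>i. distr ?P borel (\<lambda>w. w i))"
      unfolding distr_id by (rule PiM_cong[OF refl law[symmetric]])
    finally show "distr ?P (PiM {1..n} (\<lambda>_. borel)) (\<lambda>w. restrict (\<lambda>i. w i) {1..n})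
        = PiM {1..n} (\<lambda>i. distr ?P borel (\<lambda>w. w i))" .
  qed (use n rv in auto)
qed simp

lemma Lambda_stat_measurable [measurable]:
  assumes "\<And>i. i \<in> {1..n} \<Longrightarrow> e i \<in> borel_measurable M"
  shows "(\<lambda>w. Lambda_stat n p x (\<lambda>i. e i w)) \<in> borel_measurable M"
  unfolding Lambda_stat_def emp_mean_def using assms by measurable

lemma Lambda_stat_restrict: "Lambda_stat n p x (restrict \<xi> {1..n}) = Lambda_stat n p x \<xi>"
  by (simp add: Lambda_stat_def emp_mean_def)

text \<open>By independence the joint law of the errors on {1..n} is the product of copies of F, and
  the statistic reads no other coordinate. A quantile defined on the product space therefore
  controls the probability on the original space.\<close>

lemma measure_Lambda_stat_le_PiM:
  assumes M: "prob_space M" and n: "1 \<le> n"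
    and indep: "prob_space.indep_vars M (\<lambda>_. borel) e {1..n}"
    and law: "\<And>i. i \<in> {1..n} \<Longrightarrow> distr M borel (e i) = F"
  shows "\<P>(w in M. Lambda_stat n p x (\<lambda>i. e i w) \<le> m)
    = \<P>(w in (PiM {1..n} (\<lambda>_. F)). Lambda_stat n p x w \<le> m)"
proof -
  interpret M: prob_space M by fact
  let ?X = "\<lambda>w. restrict (\<lambda>i. e i w) {1..n}" and ?B = "PiM {1..n} (\<lambda>_. borel :: real measure)"
  have rv: "e i \<in> borel_measurable M" if "i \<in> {1..n}" for i
    using indep that by (auto simp: M.indep_vars_def)
  have X: "?X \<in> measurable M ?B" by (intro measurable_restrict rv)
  have "distr M ?B ?X = PiM {1..n} (\<lambda>i. distr M borel (e i))"
    using indep n rv by (subst (asm) M.indep_vars_iff_distr_eq_PiM') auto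
  also have "\<dots> = PiM {1..n} (\<lambda>_. F)" by (rule PiM_cong[OF refl law])
  finally have D: "distr M ?B ?X = PiM {1..n} (\<lambda>_. F)" .
  have [measurable]: "(\<lambda>w. Lambda_stat n p x (\<lambda>i. w i)) \<in> borel_measurable ?B"
    by (rule Lambda_stat_measurable) measurable
  have "measure (distr M ?B ?X) {w \<in> space ?B. Lambda_stat n p x w \<le> m}
      = measure M (?X -` {w \<in> space ?B. Lambda_stat n p x w \<le> m} \<inter> space M)"
    by (rule measure_distr[OF X]) measurable
  also have "?X -` {w \<in> space ?B. Lambda_stat n p x w \<le> m} \<inter> space M
      = {w \<in> space M. Lambda_stat n p x (\<lambda>i. e i w) \<le> m}"
    using measurable_space[OF X] by (auto simp: Lambda_stat_restrict[unfolded One_nat_def])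
  moreover have "space ?B = space (PiM {1..n} (\<lambda>_. F))"
    unfolding D[symmetric] by simp
  ultimately show ?thesis by (simp only: D)
qed

lemma Lambda_stat_nonneg: "1 \<le> p \<Longrightarrow> 0 \<le> Lambda_stat n p x \<xi>"
  unfolding Lambda_stat_def emp_mean_def
  by (intro divide_nonneg_nonneg mult_nonneg_nonneg) (auto simp: Max_ge_iff intro!: sum_nonneg divide_nonneg_nonneg)

text \<open>When all \<open>\<xi> i\<close> vanish, the statistic is \<open>0 / 0 = 0\<close> and the bound still holds.\<close>

lemma score_le_Lambda_stat:
  assumes n: "1 \<le> n" and j: "j \<in> {1..p}"
  shows "\<bar>\<Sum>i=1..n. x i j * \<xi> i\<bar> \<le> Lambda_stat n p x \<xi> * sqrt (emp_mean n (\<lambda>i. (\<xi> i)\<^sup>2))"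
proof (cases "emp_mean n (\<lambda>i. (\<xi> i)\<^sup>2) = 0")
  case True
  then have "(\<Sum>i=1..n. (\<xi> i)\<^sup>2) = 0" using n by (simp add: emp_mean_def)
  then have "\<forall>i\<in>{1..n}. \<xi> i = 0" by (subst (asm) sum_nonneg_eq_0_iff) auto
  then have "(\<Sum>i=1..n. x i j * \<xi> i) = 0" by (intro sum.neutral) auto
  then show ?thesis using True by simp
next
  case False
  have "0 \<le> emp_mean n (\<lambda>i. (\<xi> i)\<^sup>2)" by (auto simp: emp_mean_def intro!: sum_nonneg divide_nonneg_nonneg)
  then have V: "0 < sqrt (emp_mean n (\<lambda>i. (\<xi> i)\<^sup>2))" using False by simp
  have "\<bar>\<Sum>i=1..n. x i j * \<xi> i\<bar> = real n * \<bar>emp_mean n (\<lambda>i. x i j * \<xi> i)\<bar>"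
    using n by (simp add: emp_mean_def abs_divide)
  also have "\<dots> \<le> real n * Max ((\<lambda>j. \<bar>emp_mean n (\<lambda>i. x i j * \<xi> i)\<bar>) ` {1..p})"
    using j by (intro mult_left_mono Max_ge) auto
  also have "\<dots> = Lambda_stat n p x \<xi> * sqrt (emp_mean n (\<lambda>i. (\<xi> i)\<^sup>2))"
    unfolding Lambda_stat_def using V by simp
  finally show ?thesis .
qed

text \<open>Some coordinate attains the maximum. A number r in [0, 1] satisfies r^2 \<le> r, so a
  mean square of at least 1 - d/t leaves a denominator of at least 1 - d/t, and the threshold t
  shrinks only to t (1 - d/t) = t - d.\<close>

lemma Lambda_stat_gtD:
  assumes n: "1 \<le> n" and p: "1 \<le> p" and t: "0 < t" and d: "0 \<le> d" "d \<le> t"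
    and gt: "sqrt n * t < Lambda_stat n p x \<xi>"
    and sq: "real n * (1 - d / t) \<le> (\<Sum>i=1..n. (\<xi> i)\<^sup>2)"
  shows "\<exists>j\<in>{1..p}. t - d < \<bar>\<Sum>i=1..n. x i j / sqrt n * \<xi> i\<bar>"
proof -
  let ?V = "emp_mean n (\<lambda>i. (\<xi> i)\<^sup>2)"
  have r: "0 \<le> 1 - d / t" "1 - d / t \<le> 1" using t d by auto
  have V: "1 - d / t \<le> ?V" using sq n by (simp add: emp_mean_def field_simps)
  have "?V \<noteq> 0"
  proof
    assume "?V = 0"
    then have "Lambda_stat n p x \<xi> = 0" by (simp add: Lambda_stat_def)
    moreover have "0 \<le> sqrt n * t" using t by simp
    ultimately show False using gt by linarith
  qed
  then have Vpos: "0 < ?V" using V r by linarith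
  have "(1 - d / t)\<^sup>2 \<le> 1 - d / t" using mult_left_mono[OF r(2) r(1)] by (simp add: power2_eq_square)
  then have "(1 - d / t)\<^sup>2 \<le> ?V" using V by linarith
  then have rV: "1 - d / t \<le> sqrt ?V" by (rule real_le_rsqrt)
  have "Max ((\<lambda>j. \<bar>emp_mean n (\<lambda>i. x i j * \<xi> i)\<bar>) ` {1..p}) \<in> (\<lambda>j. \<bar>emp_mean n (\<lambda>i. x i j * \<xi> i)\<bar>) ` {1..p}"
    using p by (intro Max_in) auto
  then obtain j where j: "j \<in> {1..p}"
    and max: "Max ((\<lambda>j. \<bar>emp_mean n (\<lambda>i. x i j * \<xi> i)\<bar>) ` {1..p}) = \<bar>emp_mean n (\<lambda>i. x i j * \<xi> i)\<bar>"
    by auto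
  let ?S = "\<Sum>i=1..n. x i j / sqrt n * \<xi> i"
  have "real n * \<bar>emp_mean n (\<lambda>i. x i j * \<xi> i)\<bar> = sqrt n * \<bar>?S\<bar>"
  proof -
    have "?S = (\<Sum>i=1..n. x i j * \<xi> i) / sqrt n" by (simp add: sum_divide_distrib)
    then have "sqrt n * \<bar>?S\<bar> = \<bar>\<Sum>i=1..n. x i j * \<xi> i\<bar>" using n by (simp add: abs_divide)
    then show ?thesis using n by (simp add: emp_mean_def abs_divide)
  qed
  then have "Lambda_stat n p x \<xi> = sqrt n * \<bar>?S\<bar> / sqrt ?V"
    unfolding Lambda_stat_def max by simp
  then have "sqrt n * t * sqrt ?V < sqrt n * \<bar>?S\<bar>"
    using gt Vpos by (simp add: pos_less_divide_eq)
  then have "t * sqrt ?V < \<bar>?S\<bar>" using n by (simp add: mult.assoc)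
  moreover have "t * (1 - d / t) \<le> t * sqrt ?V" using rV t by (intro mult_left_mono) auto
  moreover have "t * (1 - d / t) = t - d" using t by (simp add: field_simps)
  ultimately have "t - d < \<bar>?S\<bar>" by linarith
  then show ?thesis using j by (rule rev_bexI[rotated])
qed

text \<open>Dividing by sqrt n multiplies q-th powers by n^(-q/2) while summation contributes a
  factor n; for q > 2 the total decays, so no single observation dominates.\<close>

lemma sum_norm_powr_le:
  assumes n: "1 \<le> n" and q: "0 < q" and C: "emp_mean n (\<lambda>i. \<bar>x i\<bar> powr q) \<le> C"
  shows "(\<Sum>i=1..n. \<bar>x i / sqrt n\<bar> powr q) \<le> C * real n powr (1 - q / 2)"
proof -
  have "(\<Sum>i=1..n. \<bar>x i\<bar> powr q) \<le> C * n"
    using C n by (simp add: emp_mean_def pos_divide_le_eq)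
  moreover have "\<bar>x i / sqrt n\<bar> powr q = \<bar>x i\<bar> powr q * real n powr (- q / 2)" for i
  proof -
    have "\<bar>x i / sqrt n\<bar> = \<bar>x i\<bar> / real n powr (1 / 2)" by (simp add: abs_divide powr_half_sqrt)
    then have "\<bar>x i / sqrt n\<bar> powr q = \<bar>x i\<bar> powr q / (real n powr (1 / 2)) powr q"
      by (simp only: powr_divide abs_ge_zero powr_ge_zero)
    also have "(real n powr (1 / 2)) powr q = real n powr (q / 2)"
      by (simp only: powr_powr mult_1_left times_divide_eq_left)
    finally have "\<bar>x i / sqrt n\<bar> powr q = \<bar>x i\<bar> powr q / real n powr (q / 2)" .
    moreover have "real n powr (- q / 2) = 1 / real n powr (q / 2)"
      using powr_minus_divide[of "real n" "q / 2"] by simp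
    ultimately show ?thesis by (simp only: times_divide_eq_right mult_1_right)
  qed
  ultimately have "(\<Sum>i=1..n. \<bar>x i / sqrt n\<bar> powr q) \<le> (C * n) * real n powr (- q / 2)"
    by (simp add: sum_distrib_right[symmetric] mult_right_mono)
  also have "\<dots> = C * real n powr (1 - q / 2)"
    using n by (simp add: powr_add[of "real n" 1 "- q / 2", simplified])
  finally show ?thesis .
qed

lemma sum_norm_square:
  assumes n: "1 \<le> n" and "emp_mean n (\<lambda>i. (x i)\<^sup>2) = 1"
  shows "(\<Sum>i=1..n. (x i / sqrt n)\<^sup>2) = 1"
  using assms by (simp add: emp_mean_def power_divide sum_divide_distrib[symmetric])

lemma abs_norm_le:
  fixes b :: "nat \<Rightarrow> real"
  assumes "(\<Sum>i=1..n. \<bar>b i\<bar> powr q) \<le> L" "L \<le> y powr q" "0 < q" "0 < y" "i \<in> {1..n}"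
  shows "\<bar>b i\<bar> \<le> y"
proof (rule ccontr)
  assume "\<not> \<bar>b i\<bar> \<le> y"
  then have "y powr q < \<bar>b i\<bar> powr q"
    using assms by (intro powr_less_mono2) auto
  moreover
  have "\<bar>b i\<bar> powr q \<le> (\<Sum>i=1..n. \<bar>b i\<bar> powr q)"
    using assms(5) by (intro member_le_sum) auto
  ultimately show False using assms by linarith
qed

definition md_error :: "real \<Rightarrow> real \<Rightarrow> real \<Rightarrow> real \<Rightarrow> real" where
  "md_error t d \<theta> y = 1680 / d ^ 3 * exp (- t\<^sup>2 / 2 + 2 * t * d + t * \<theta> + t ^ 3 * y)
     * (2 * \<theta> + (3 + gauss_cube) * y)"

text \<open>Union bound over p coordinates and two signs on the event that the sum of squares is not
  small; the exponential term bounds the complement of that event, with a free tilt h.\<close>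

lemma Lambda_stat_tail:
  assumes se: "standardized_errors M {1..n} e q K" and n: "1 \<le> n" and p: "1 \<le> p"
    and design: "\<And>j. j \<in> {1..p} \<Longrightarrow> emp_mean n (\<lambda>i. (x i j)\<^sup>2) = 1"
    and C: "\<And>j. j \<in> {1..p} \<Longrightarrow> emp_mean n (\<lambda>i. \<bar>x i j\<bar> powr q) \<le> C"
    and K: "0 \<le> K" and y: "0 < y" "y \<le> 1" "C * real n powr (1 - q / 2) \<le> y powr q"
    and \<theta>: "\<theta> = K * (C * real n powr (1 - q / 2)) * y powr (- q)"
    and t: "0 < t" "t * y \<le> 1" and d: "0 < d" "d \<le> 1" "d \<le> t" and h: "0 \<le> h"
  shows "\<P>(w in M. sqrt n * t < Lambda_stat n p x (\<lambda>i. e i w))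
    \<le> exp (real n * (3 * (1 + K) * h powr (min (q / 2) 2) - h * (d / t)))
      + 2 * real p * (\<theta> + normal_tail (t - 2 * d) + md_error t d \<theta> y)"
proof -
  interpret standardized_errors M "{1..n}" e q K by fact
  have q0: "0 < q" using q by simp
  define U where "U = \<theta> + normal_tail (t - 2 * d) + md_error t d \<theta> y"
  let ?A = "{w \<in> space M. (\<Sum>i=1..n. (e i w)\<^sup>2) < real (card {1..n}) * (1 - d / t)}"
  let ?B = "\<lambda>j. {w \<in> space M. t - d < (\<Sum>i=1..n. x i j / sqrt n * e i w)}"
  \<comment> \<open>The left tail is the right tail for the negated weights.\<close>
  let ?C = "\<lambda>j. {w \<in> space M. t - d < (\<Sum>i=1..n. - (x i j / sqrt n) * e i w)}"
  note L = sum_norm_powr_le[OF n q0 C]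
  have BC: "prob (?B j) \<le> U" "prob (?C j) \<le> U" if j: "j \<in> {1..p}" for j
  proof -
    note b = abs_norm_le[OF L[OF j] y(3) q0 y(1)]
    show "prob (?B j) \<le> U"
      unfolding U_def md_error_def
      by (rule moderate_deviation_bound[OF sum_norm_square[OF n design[OF j]] L[OF j] K y(1,2) b \<theta> d(1,2) less_imp_le[OF t(1)] t(2)])
    show "prob (?C j) \<le> U"
      unfolding U_def md_error_def
      by (rule moderate_deviation_bound[OF _ _ K y(1,2) _ \<theta> d(1,2) less_imp_le[OF t(1)] t(2)])
        (use sum_norm_square[OF n design[OF j]] L[OF j] b in \<open>auto\<close>)
  qed
  have [measurable]: "?A \<in> events" "?B j \<in> events" "?C j \<in> events" for j by measurable
  have "\<P>(w in M. sqrt n * t < Lambda_stat n p x (\<lambda>i. e i w))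
      \<le> prob (?A \<union> (\<Union>j\<in>{1..p}. ?B j \<union> ?C j))"
  proof (rule finite_measure_mono)
    show "{w \<in> space M. sqrt n * t < Lambda_stat n p x (\<lambda>i. e i w)} \<subseteq> ?A \<union> (\<Union>j\<in>{1..p}. ?B j \<union> ?C j)"
    proof
      fix w assume w: "w \<in> {w \<in> space M. sqrt n * t < Lambda_stat n p x (\<lambda>i. e i w)}"
      show "w \<in> ?A \<union> (\<Union>j\<in>{1..p}. ?B j \<union> ?C j)"
      proof (cases "w \<in> ?A")
        case False
        then have "real n * (1 - d / t) \<le> (\<Sum>i=1..n. (e i w)\<^sup>2)" using w by auto
        then obtain j where j: "j \<in> {1..p}" "t - d < \<bar>\<Sum>i=1..n. x i j / sqrt n * e i w\<bar>"
          using Lambda_stat_gtD[OF n p t(1) less_imp_le[OF d(1)] d(3), of x "\<lambda>i. e i w"] w by auto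
        have "(\<Sum>i=1..n. - (x i j / sqrt n) * e i w) = - (\<Sum>i=1..n. x i j / sqrt n * e i w)"
          by (simp add: sum_negf)
        then have "w \<in> ?B j \<union> ?C j" using j(2) w by (auto simp: abs_if split: if_splits)
        then show ?thesis using j(1) by blast
      qed auto
    qed
  qed measurable
  also have "\<dots> \<le> prob ?A + prob (\<Union>j\<in>{1..p}. ?B j \<union> ?C j)"
    by (intro measure_Un_le) measurable
  also have "prob (\<Union>j\<in>{1..p}. ?B j \<union> ?C j) \<le> (\<Sum>j\<in>{1..p}. prob (?B j \<union> ?C j))"
    by (intro finite_measure_subadditive_finite) auto
  also have "\<dots> \<le> (\<Sum>j\<in>{1..p}. U + U)"
    by (intro sum_mono order_trans[OF measure_Un_le] add_mono BC) auto
  also have "\<dots> = 2 * real p * U" by simp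
  also have "prob ?A \<le> exp (real (card {1..n}) * (3 * (1 + K) * h powr sq_exponent - h * (d / t)))"
    by (rule squares_lower_tail[OF h])
  finally show ?thesis by (simp add: U_def sq_exponent_def)
qed

subsection \<open>Asymptotics of the moderate deviations\<close>

lemma eventually_le_of_tendsto_0:
  fixes f :: "nat \<Rightarrow> real"
  assumes "f \<longlonglongrightarrow> 0" "0 < \<epsilon>"
  shows "eventually (\<lambda>n. f n \<le> \<epsilon>) sequentially"
  using order_tendstoD(2)[OF assms] by (rule eventually_mono) auto

text \<open>Since p \<ge> 1, the upper bound on p turns into a polynomial lower bound on \<alpha>,
  against which smaller probabilities are then measured.\<close>

lemma alpha_lower_bound:
  assumes "1 \<le> n" "1 \<le> p" "real p \<le> \<alpha> * real n powr (A / 2) / 2"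
  shows "real n powr (- A / 2) \<le> \<alpha>"
proof -
  have "1 * 2 * real n powr (- A / 2) \<le> (\<alpha> * real n powr (A / 2)) * real n powr (- A / 2)"
    using assms by (intro mult_right_mono) auto
  also have "\<dots> = \<alpha>" using assms(1) by (simp flip: powr_add)
  finally show ?thesis using powr_ge_zero[of "real n" "- A / 2"] by linarith
qed

text \<open>K and C are the uniform moment bounds of errors and design. No error law is fixed: the
  estimates hold for all errors with these bounds simultaneously, as a supremum over a possibly
  infinite family requires.\<close>

locale asymptotic_design =
  fixes p :: "nat \<Rightarrow> nat" and \<alpha> :: "nat \<Rightarrow> real" and x :: "nat \<Rightarrow> nat \<Rightarrow> nat \<Rightarrow> real" and q \<eta> K C :: real
  assumes q: "2 < q" and \<eta>: "0 < \<eta>" "\<eta> < 1" and K: "0 \<le> K" and C: "0 \<le> C"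
    and p_lim: "filterlim p at_top sequentially"
    and \<alpha>: "\<And>n. n \<ge> 1 \<Longrightarrow> 0 < \<alpha> n \<and> \<alpha> n < 1"
    and rate: "eventually (\<lambda>n. real (p n) \<le> \<alpha> n * real n powr (\<eta> * (q - 2) / 2) / 2) sequentially"
    and design: "\<And>n j. 1 \<le> n \<Longrightarrow> j \<in> {1..p n} \<Longrightarrow> emp_mean n (\<lambda>i. (x n i j)\<^sup>2) = 1"
    and mom: "\<And>n j. 1 \<le> n \<Longrightarrow> j \<in> {1..p n} \<Longrightarrow> emp_mean n (\<lambda>i. \<bar>x n i j\<bar> powr q) \<le> C"
begin

lemma p1: "eventually (\<lambda>n. 1 \<le> p n) sequentially"
  using p_lim by (simp add: filterlim_at_top)

lemma \<alpha>_pos: "eventually (\<lambda>n. 0 < \<alpha> n) sequentially"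
  using eventually_ge_at_top[of 1] by eventually_elim (use \<alpha> in auto)

text \<open>At this truncation level \<open>\<theta>\<close> is smaller than \<open>\<alpha>/p\<close> by a factor \<open>n powr (- (1 - \<eta>) (q - 2) / 4)\<close>, while the
  truncated summands are still polynomially small.\<close>

lemma moderate_deviation_numeric:
  assumes \<epsilon>: "0 < \<epsilon>" and t: "filterlim t at_top sequentially"
    and t_le: "eventually (\<lambda>n. t n \<le> sqrt (\<eta> * (q - 2) * ln n)) sequentially"
  defines "y \<equiv> (\<lambda>n. real n powr (- ((1 - \<eta>) * (q - 2) / (4 * q))))"
  defines "\<theta> \<equiv> (\<lambda>n. K * (C * real n powr (1 - q / 2)) * y n powr (- q))"
  shows "eventually (\<lambda>n. 1 \<le> n \<and> y n \<le> 1 \<and> C * real n powr (1 - q / 2) \<le> y n powr q \<and> 2 \<le> t n \<and> t n * y n \<le> 1 \<and>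
      exp (real n * (3 * (1 + K) * (real n powr (- 1 / 2)) powr (min (q / 2) 2)
          - real n powr (- 1 / 2) * (1 / (t n)\<^sup>2 / t n)))
        + 2 * real (p n) * (\<theta> n + normal_tail (t n - 2 * (1 / (t n)\<^sup>2)) + md_error (t n) (1 / (t n)\<^sup>2) (\<theta> n) (y n))
      \<le> 2 * real (p n) * normal_tail (t n) * (1 + \<epsilon>) + \<epsilon> * \<alpha> n) sequentially"
proof -
  \<comment> \<open>A and B split q - 2. The rate condition gives n^(-A/2) \<le> \<alpha>/(2p), and
    B > 0 is the slack left by \<eta> < 1: of the factor n^(-B/2), the truncation level spends one
    half and the other half makes \<theta> negligible.\<close>
  define A where "A = \<eta> * (q - 2)"
  define B where "B = (1 - \<eta>) * (q - 2)"
  define a where "a = B / (4 * q)"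
  define u where "u = (min (q / 2) 2 - 1) / 2"
  define c where "c = 3 + gauss_cube"
  \<comment> \<open>An explicit ceiling for t: t is an arbitrary sequence below it, so limits are
    computed for T and transferred by monotonicity.\<close>
  define T where "T = (\<lambda>n::nat. sqrt (A * ln n))"
  have A: "0 < A" and B: "0 < B" using q \<eta> by (auto simp: A_def B_def)
  have AB: "A + B = q - 2" by (simp add: A_def B_def algebra_simps)
  have a: "0 < a" and aq: "a * q = B / 4" using B q by (auto simp: a_def)
  have u: "0 < u" using q by (auto simp: u_def)
  have c: "0 < c" unfolding c_def using gauss_cube_nonneg by linarith
  have y_eq: "y n = real n powr (- a)" for n by (simp add: y_def a_def B_def)
  have yq: "y n powr q = real n powr (- B / 4)" "y n powr (- q) = real n powr (B / 4)" for n
    unfolding y_eq powr_powr using aq by (auto simp: algebra_simps)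
  have nq: "real n powr (1 - q / 2) = real n powr (- (A + B) / 2)" for n
  proof -
    have "1 - q / 2 = - (A + B) / 2" unfolding AB by (simp add: diff_divide_distrib)
    then show ?thesis by (simp only:)
  qed
  have pw: "real n powr (- (A + B) / 2) * real n powr (B / 4) = real n powr (- A / 2) * real n powr (- B / 4)" for n
    unfolding powr_add[symmetric] by (rule arg_cong[where f = "\<lambda>e. real n powr e"]) (simp add: field_simps)
  have \<theta>_eq: "\<theta> n = K * C * real n powr (- A / 2) * real n powr (- B / 4)" for n
    using pw[of n] unfolding \<theta>_def yq nq by simp
  define k where "k = 1 + K"
  have k: "0 < k" using K by (simp add: k_def)
  have "(\<lambda>n::nat. real n powr (- (A + B) / 2) * real n powr (B / 4)) \<longlonglongrightarrow> 0"
    unfolding pw using A B by real_asymp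
  then have l1: "(\<lambda>n::nat. C * (real n powr (- (A + B) / 2) * real n powr (B / 4))) \<longlonglongrightarrow> 0"
    by (rule tendsto_mult_right_zero)
  have l2: "(\<lambda>n. T n * y n) \<longlonglongrightarrow> 0" unfolding T_def y_eq using A a by real_asymp
  have "(\<lambda>n::nat. T n * (real n powr (- A / 2) * real n powr (- B / 4))) \<longlonglongrightarrow> 0"
    "(\<lambda>n::nat. T n ^ 3 * real n powr (- a)) \<longlonglongrightarrow> 0"
    unfolding T_def using A B a by real_asymp+
  from tendsto_add[OF tendsto_mult_right_zero[OF this(1), of "K * C"] this(2)]
  have l3: "(\<lambda>n. T n * \<theta> n + T n ^ 3 * y n) \<longlonglongrightarrow> 0"
    by (simp add: y_eq \<theta>_eq ac_simps)
  \<comment> \<open>The power 7 is t^6 from 1/d^3 at d = 1/t^2 and one more t from the converse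
    Mills bound; exp 3 bounds the rest of the exponential.\<close>
  have "(\<lambda>n::nat. T n ^ 7 * (real n powr (- A / 2) * real n powr (- B / 4))) \<longlonglongrightarrow> 0"
    "(\<lambda>n::nat. T n ^ 7 * real n powr (- a)) \<longlonglongrightarrow> 0"
    unfolding T_def using A B a by real_asymp+
  from tendsto_add[OF tendsto_mult_right_zero[OF this(1), of "20 * (1680 * exp 3) * 2 * (K * C)"]
      tendsto_mult_right_zero[OF this(2), of "20 * (1680 * exp 3) * c"]]
  have l4: "(\<lambda>n. 20 * (1680 * exp 3) * T n ^ 7 * (2 * \<theta> n + c * y n)) \<longlonglongrightarrow> 0"
    by (simp add: y_eq \<theta>_eq algebra_simps)
  \<comment> \<open>With tilt n^(-1/2) the exponent for the lower tail of the squares is of order -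
    sqrt n / T^3, which beats every power of n.\<close>
  have l5: "(\<lambda>n::nat. exp (sqrt n * (3 * k * n powr (- u) - 1 / T n ^ 3)) * n powr (A / 2)) \<longlonglongrightarrow> 0"
    unfolding T_def using A u k by real_asymp
  have "(\<lambda>n::nat. real n powr (- B / 4)) \<longlonglongrightarrow> 0" using B by real_asymp
  then have l6: "(\<lambda>n::nat. K * C * real n powr (- B / 4)) \<longlonglongrightarrow> 0" by (rule tendsto_mult_right_zero)
  have "((\<lambda>t::real. 40 * exp 2 / t) \<longlongrightarrow> 0) at_top" by real_asymp
  then have l7: "(\<lambda>n. 40 * exp 2 / t n) \<longlonglongrightarrow> 0" by (rule filterlim_compose[OF _ t])
  have e8: "eventually (\<lambda>n. 2 \<le> t n) sequentially" using t by (simp add: filterlim_at_top)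
  have \<epsilon>2: "0 < \<epsilon> / 2" using \<epsilon> by simp
  show ?thesis
    using eventually_ge_at_top[of 1] p1 \<alpha>_pos rate t_le
      eventually_le_of_tendsto_0[OF l1 zero_less_one] eventually_le_of_tendsto_0[OF l2 zero_less_one]
      eventually_le_of_tendsto_0[OF l3 zero_less_one] eventually_le_of_tendsto_0[OF l4 \<epsilon>2]
      eventually_le_of_tendsto_0[OF l5 \<epsilon>2] eventually_le_of_tendsto_0[OF l6 \<epsilon>2]
      eventually_le_of_tendsto_0[OF l7 \<epsilon>2] e8
  proof eventually_elim
    case (elim n)
    then have n: "1 \<le> n" by simp
    have t2: "2 \<le> t n" by fact
    have y0: "0 < y n" "y n \<le> 1" using n a powr_mono[of "- a" 0 "real n"] by (auto simp: y_eq)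
    have \<theta>0: "0 \<le> \<theta> n" unfolding \<theta>_eq using K C by simp
    have tT: "t n \<le> T n" using elim by (simp add: T_def A_def)
    \<comment> \<open>Then t d = 1/t, and the shift of the tail costs a relative error of at most 40
      exp 2 / t.\<close>
    define d where "d = 1 / (t n)\<^sup>2"
    have d: "0 < d" using t2 by (simp add: d_def)
    have td: "t n * d = 1 / t n" using t2 by (simp add: d_def power2_eq_square)
    have tinv: "1 / t n \<le> 1 / 2" using t2 by (intro divide_left_mono) auto
    have g1: "C * real n powr (1 - q / 2) \<le> y n powr q"
    proof -
      have "C * (real n powr (- (A + B) / 2) * real n powr (B / 4)) * real n powr (- B / 4) \<le> 1 * real n powr (- B / 4)"
        using elim by (intro mult_right_mono) auto
      moreover have "real n powr (B / 4) * real n powr (- B / 4) = 1"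
        using n by (simp flip: powr_add)
      ultimately show ?thesis by (simp add: yq nq mult.assoc)
    qed
    have g2: "t n * y n \<le> 1"
      using mult_right_mono[OF tT less_imp_le[OF y0(1)]] elim by linarith
    have e1: "t n * \<theta> n + t n ^ 3 * y n \<le> 1"
    proof -
      have "t n * \<theta> n + t n ^ 3 * y n \<le> T n * \<theta> n + T n ^ 3 * y n"
        using tT t2 \<theta>0 y0 by (intro add_mono mult_right_mono power_mono) auto
      then show ?thesis using elim by linarith
    qed
    have powA: "2 * real (p n) * real n powr (- A / 2) \<le> \<alpha> n"
    proof -
      have "2 * real (p n) * real n powr (- A / 2) \<le> \<alpha> n * real n powr (A / 2) * real n powr (- A / 2)"
        using elim by (intro mult_right_mono) (auto simp: A_def)
      also have "\<dots> = \<alpha> n" using n by (simp flip: powr_add)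
      finally show ?thesis .
    qed
    have powA1: "real n powr (- A / 2) \<le> \<alpha> n"
      by (rule alpha_lower_bound[of _ "p n"]) (use elim in \<open>auto simp: A_def\<close>)
    let ?h = "real n powr (- 1 / 2)"
    define E where "E = real n * (3 * (1 + K) * ?h powr (min (q / 2) 2) - ?h * (1 / (t n)\<^sup>2 / t n))"
    have E: "exp E \<le> \<epsilon> / 2 * \<alpha> n"
    proof -
      have s: "sqrt n = real n powr (1 / 2)" using n by (simp add: powr_half_sqrt)
      have "real n * ?h = real n powr (1 + - 1 / 2)"
        unfolding powr_add using n by simp
      then have n1: "real n * ?h = sqrt n" by (simp add: s)
      have "real n * ?h powr (min (q / 2) 2) = real n powr (1 + - 1 / 2 * min (q / 2) 2)"
        unfolding powr_add powr_powr using n by simp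
      also have "1 + - 1 / 2 * min (q / 2) 2 = 1 / 2 + - u" by (simp add: u_def field_simps)
      also have "real n powr (1 / 2 + - u) = sqrt n * real n powr (- u)" by (simp only: powr_add s)
      finally have n2: "real n * ?h powr (min (q / 2) 2) = sqrt n * real n powr (- u)" .
      have "1 / T n ^ 3 \<le> 1 / t n ^ 3"
        using tT t2 by (intro divide_left_mono power_mono mult_pos_pos zero_less_power) auto
      also have "\<dots> = 1 / (t n)\<^sup>2 / t n" by (simp add: power2_eq_square power3_eq_cube)
      finally have "sqrt n * (1 / T n ^ 3) \<le> sqrt n * (1 / (t n)\<^sup>2 / t n)" by (intro mult_left_mono) auto
      moreover have "E = 3 * (1 + K) * (real n * ?h powr (min (q / 2) 2)) - (real n * ?h) * (1 / (t n)\<^sup>2 / t n)"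
        by (simp only: E_def right_diff_distrib mult.assoc mult.left_commute)
      ultimately have "E \<le> 3 * (1 + K) * (sqrt n * real n powr (- u)) - sqrt n * (1 / T n ^ 3)"
        unfolding n1 n2 by linarith
      also have "\<dots> = sqrt n * (3 * k * n powr (- u) - 1 / T n ^ 3)"
        by (simp only: k_def right_diff_distrib mult.assoc mult.left_commute)
      finally have "exp E \<le> exp (sqrt n * (3 * k * n powr (- u) - 1 / T n ^ 3)) * (real n powr (A / 2) * real n powr (- A / 2))"
        using n by (simp flip: powr_add)
      also have "\<dots> \<le> \<epsilon> / 2 * real n powr (- A / 2)"
        unfolding mult.assoc[symmetric] using elim by (intro mult_right_mono) auto
      also have "\<dots> \<le> \<epsilon> / 2 * \<alpha> n" using powA1 \<epsilon> by (intro mult_left_mono) auto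
      finally show ?thesis .
    qed
    have P\<theta>: "2 * real (p n) * \<theta> n \<le> \<epsilon> / 2 * \<alpha> n"
    proof -
      have "2 * real (p n) * \<theta> n = (K * C * real n powr (- B / 4)) * (2 * real (p n) * real n powr (- A / 2))"
        by (simp add: \<theta>_eq)
      also have "\<dots> \<le> \<epsilon> / 2 * \<alpha> n"
        using elim powA \<epsilon> K C by (intro mult_mono) auto
      finally show ?thesis .
    qed
    have Q: "normal_tail (t n - 2 * d) \<le> normal_tail (t n) * (1 + \<epsilon> / 2)"
    proof -
      have d1: "2 * d \<le> t n"
      proof -
        have "t n * d \<le> 1" using td tinv by simp
        moreover have "2 * d \<le> t n * d" using t2 d by (intro mult_right_mono) auto
        ultimately show ?thesis using t2 by linarith
      qed
      have "normal_tail (t n - 2 * d) \<le> normal_tail (t n) * (1 + 20 * t n * (2 * d) * exp (t n * (2 * d)))"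
        using d d1 t2 by (intro normal_tail_shift) auto
      also have "\<dots> \<le> normal_tail (t n) * (1 + \<epsilon> / 2)"
      proof (intro mult_left_mono add_left_mono)
        have "20 * t n * (2 * d) * exp (t n * (2 * d)) = 40 * (t n * d) * exp (2 * (t n * d))"
          by (simp add: ac_simps)
        also have "\<dots> = 40 / t n * exp (2 * (1 / t n))"
          unfolding td by simp
        also have "\<dots> \<le> 40 / t n * exp 2"
        proof (rule mult_left_mono)
          have "2 * (1 / t n) \<le> 2" using tinv by linarith
          then show "exp (2 * (1 / t n)) \<le> exp 2" by (simp only: exp_le_cancel_iff)
        qed (use t2 in simp)
        finally show "20 * t n * (2 * d) * exp (t n * (2 * d)) \<le> \<epsilon> / 2" using elim by simp
      qed simp
      finally show ?thesis .
    qed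
    have W: "md_error (t n) d (\<theta> n) (y n) \<le> normal_tail (t n) * (\<epsilon> / 2)"
    proof -
      have "exp (- (t n)\<^sup>2 / 2 + 2 * t n * d + t n * \<theta> n + t n ^ 3 * y n)
          = exp (- (t n)\<^sup>2 / 2) * exp (2 * (1 / t n) + (t n * \<theta> n + t n ^ 3 * y n))"
        using td by (simp add: mult.assoc flip: exp_add)
      also have "\<dots> \<le> (20 * t n * normal_tail (t n)) * exp 3"
      proof (rule mult_mono)
        have "2 * (1 / t n) + (t n * \<theta> n + t n ^ 3 * y n) \<le> 3" using tinv e1 by linarith
        then show "exp (2 * (1 / t n) + (t n * \<theta> n + t n ^ 3 * y n)) \<le> exp 3" by (simp only: exp_le_cancel_iff)
      qed (use normal_tail_ge_density[of "t n"] t2 in auto)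
      finally have ex: "exp (- (t n)\<^sup>2 / 2 + 2 * t n * d + t n * \<theta> n + t n ^ 3 * y n)
          \<le> (20 * t n * normal_tail (t n)) * exp 3" .
      have d3: "1680 / d ^ 3 = 1680 * t n ^ 6" by (simp add: d_def power_divide flip: power_mult)
      have w0: "0 \<le> 2 * \<theta> n + c * y n" using \<theta>0 y0 c by simp
      have "md_error (t n) d (\<theta> n) (y n)
          \<le> 1680 * t n ^ 6 * ((20 * t n * normal_tail (t n)) * exp 3) * (2 * \<theta> n + c * y n)"
        unfolding md_error_def d3 c_def[symmetric]
        using ex w0 t2 by (intro mult_right_mono mult_left_mono) auto
      also have "\<dots> = normal_tail (t n) * (20 * (1680 * exp 3) * t n ^ 7 * (2 * \<theta> n + c * y n))"
        by (simp add: eval_nat_numeral)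
      also have "\<dots> \<le> normal_tail (t n) * (20 * (1680 * exp 3) * T n ^ 7 * (2 * \<theta> n + c * y n))"
        using tT t2 w0 by (intro mult_left_mono mult_right_mono power_mono) auto
      also have "\<dots> \<le> normal_tail (t n) * (\<epsilon> / 2)"
        using elim by (intro mult_left_mono) auto
      finally show ?thesis .
    qed
    have "normal_tail (t n) * (1 + \<epsilon> / 2) + normal_tail (t n) * (\<epsilon> / 2) = normal_tail (t n) * (1 + \<epsilon>)"
      by (simp add: algebra_simps)
    then have "normal_tail (t n - 2 * d) + md_error (t n) d (\<theta> n) (y n) \<le> normal_tail (t n) * (1 + \<epsilon>)"
      using Q W by linarith
    then have "2 * real (p n) * (normal_tail (t n - 2 * d) + md_error (t n) d (\<theta> n) (y n))
        \<le> 2 * real (p n) * (normal_tail (t n) * (1 + \<epsilon>))"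
      by (rule mult_left_mono) simp
    then have "2 * real (p n) * (\<theta> n + normal_tail (t n - 2 * d) + md_error (t n) d (\<theta> n) (y n))
        \<le> 2 * real (p n) * \<theta> n + 2 * real (p n) * (normal_tail (t n) * (1 + \<epsilon>))"
      by (simp add: distrib_left)
    then show ?case using n y0 g1 t2 g2 E P\<theta> unfolding d_def E_def by (simp add: mult.assoc)
  qed
qed

text \<open>The quantifier over probability spaces and errors sits inside the eventuality, so one
  threshold for n serves a whole family of laws.\<close>

lemma Lambda_stat_moderate_deviation:
  assumes \<epsilon>: "0 < \<epsilon>" and t: "filterlim t at_top sequentially"
    and t_le: "eventually (\<lambda>n. t n \<le> sqrt (\<eta> * (q - 2) * ln n)) sequentially"
  shows "eventually (\<lambda>n. \<forall>(M :: 'b measure) e. standardized_errors M {1..n} e q K \<longrightarrow>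
      \<P>(w in M. sqrt n * t n < Lambda_stat n (p n) (x n) (\<lambda>i. e i w))
        \<le> 2 * real (p n) * normal_tail (t n) * (1 + \<epsilon>) + \<epsilon> * \<alpha> n) sequentially"
  using moderate_deviation_numeric[OF \<epsilon> t t_le] p1
proof eventually_elim
  case (elim n)
  let ?y = "real n powr (- ((1 - \<eta>) * (q - 2) / (4 * q)))"
  show ?case
  proof (intro allI impI)
    fix M :: "'b measure" and e
    assume se: "standardized_errors M {1..n} e q K"
    have n: "1 \<le> n" and t2: "2 \<le> t n" using elim by auto
    have "1 \<le> (t n)\<^sup>2" using t2 by (simp add: one_le_power)
    then have d: "0 < 1 / (t n)\<^sup>2" "1 / (t n)\<^sup>2 \<le> 1" using t2 by (auto simp: divide_le_eq)
    then have dt: "1 / (t n)\<^sup>2 \<le> t n" using t2 by linarith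
    have "\<P>(w in M. sqrt n * t n < Lambda_stat n (p n) (x n) (\<lambda>i. e i w))
      \<le> exp (real n * (3 * (1 + K) * (real n powr (- 1 / 2)) powr (min (q / 2) 2)
          - real n powr (- 1 / 2) * (1 / (t n)\<^sup>2 / t n)))
        + 2 * real (p n) * (K * (C * real n powr (1 - q / 2)) * ?y powr (- q)
          + normal_tail (t n - 2 * (1 / (t n)\<^sup>2))
          + md_error (t n) (1 / (t n)\<^sup>2) (K * (C * real n powr (1 - q / 2)) * ?y powr (- q)) ?y)"
      by (rule Lambda_stat_tail[OF se n _ design[OF n] mom[OF n] K]) (use elim d dt t2 in auto)
    then show "\<P>(w in M. sqrt n * t n < Lambda_stat n (p n) (x n) (\<lambda>i. e i w))
        \<le> 2 * real (p n) * normal_tail (t n) * (1 + \<epsilon>) + \<epsilon> * \<alpha> n"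
      using elim by linarith
  qed
qed

end

section \<open>Noise level and anticoncentration along the sequence of designs\<close>

context asymptotic_design
begin

text \<open>Truncating the squares at n / ln n costs K n (n / ln n)^(-q/2) = K (ln n)^(q/2) / n^(q/2
  - 1), which the growth bound on 1/\<alpha> makes o(\<alpha>), as its exponent of n is at most q/2
  - 1. The remaining exponential part is of order n^(-q), whereas \<alpha> is at least n^(-\<eta>(q
  - 2)/2).\<close>

lemma squares_upper_tail_rate:
  assumes \<epsilon>: "0 < \<epsilon>"
    and rate2: "(\<lambda>n. 1 / \<alpha> n) \<in> o(\<lambda>n. real n powr (max (min (q / 2 - 1) (q / 4)) (q / 2 - 2))
                              / ln (real n) powr (q / 2))"
  shows "eventually (\<lambda>n. \<forall>(M :: 'b measure) e. standardized_errors M {1..n} e q K \<longrightarrow>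
      \<P>(w in M. real n * (1 + 1 / sqrt (ln n)) < (\<Sum>i=1..n. (e i w)\<^sup>2)) \<le> \<epsilon> * \<alpha> n) sequentially"
proof -
  define g where "g = min (q / 2) 2"
  define A where "A = \<eta> * (q - 2)"
  define k where "k = 1 + K"
  define H where "H = (\<lambda>n. real n powr (max (min (q / 2 - 1) (q / 4)) (q / 2 - 2)) / ln (real n) powr (q / 2))"
  \<comment> \<open>For the deviation r = 1 / sqrt(ln n) this tilt gives h r = q ln n / n, hence a
    Chernoff factor n^(-q), while h times the truncation level is only q sqrt(ln n), whose
    exponential is below every positive power of n.\<close>
  define h where "h = (\<lambda>n::nat. q * (ln n * sqrt (ln n)) / n)"
  have g: "1 < g" using q by (simp add: g_def)
  have k: "0 < k" "0 \<le> k" using K by (auto simp: k_def)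
  have q0: "0 < q" using q by simp
  have "A < 1 * (q - 2)" unfolding A_def using \<eta> q by (intro mult_strict_right_mono) auto
  then have Aq: "0 < q - A / 2" using q by simp
  \<comment> \<open>Up to factors below every power of n the remainder is n^(1 - g), which vanishes
    because g > 1; what is left is exp(- q ln n) n^q = 1.\<close>
  have "(\<lambda>n::nat. exp (real n * (3 * exp (q * sqrt (ln n)) * k * (q * (ln n * sqrt (ln n)) / n) powr g - q * ln n / n)) * n powr q) \<longlonglongrightarrow> 1"
    using q0 k(1) g by real_asymp
  then have e1: "eventually (\<lambda>n::nat. exp (real n * (3 * exp (q * sqrt (ln n)) * k * h n powr g - q * ln n / n)) * n powr q < 2) sequentially"
    unfolding h_def by (rule order_tendstoD) simp
  have "(\<lambda>n::nat. 2 * real n powr (- (q - A / 2))) \<longlonglongrightarrow> 0" using Aq by real_asymp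
  then have e2: "eventually (\<lambda>n::nat. 2 * real n powr (- (q - A / 2)) \<le> \<epsilon> / 2) sequentially"
    by (rule eventually_le_of_tendsto_0) (use \<epsilon> in simp)
  have c: "0 < \<epsilon> / 2 / (K + 1)" using \<epsilon> K by simp
  have e3: "eventually (\<lambda>n. norm (1 / \<alpha> n) \<le> \<epsilon> / 2 / (K + 1) * norm (H n)) sequentially"
    using rate2 c unfolding H_def by (rule landau_o.smallD)
  show ?thesis
    using eventually_ge_at_top[of 3] p1 \<alpha>_pos rate e1 e2 e3
  proof eventually_elim
    case (elim n)
    have n: "3 \<le> n" by fact
    have n0: "0 < real n" using n by simp
    have ln1: "1 \<le> ln n"
    proof -
      have "exp 1 \<le> real n" using exp_le n by linarith
      then show ?thesis using n0 by (simp add: ln_ge_iff)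
    qed
    have \<alpha>: "0 < \<alpha> n" by fact
    have lowA: "real n powr (- A / 2) \<le> \<alpha> n"
      by (rule alpha_lower_bound[of _ "p n"]) (use elim in \<open>auto simp: A_def\<close>)
    have b2: "exp (real n * (3 * exp (q * sqrt (ln n)) * k * h n powr g - q * ln n / n)) \<le> \<epsilon> / 2 * \<alpha> n"
    proof -
      let ?E = "exp (real n * (3 * exp (q * sqrt (ln n)) * k * h n powr g - q * ln n / n))"
      have "?E = ?E * real n powr q * real n powr (- q)"
        using n by (simp add: mult.assoc flip: powr_add)
      also have "\<dots> \<le> 2 * real n powr (- q)" using elim by (intro mult_right_mono) auto
      also have "real n powr (- q) = real n powr (- (q - A / 2)) * real n powr (- A / 2)"
        by (simp flip: powr_add)
      also have "2 * (real n powr (- (q - A / 2)) * real n powr (- A / 2)) \<le> \<epsilon> / 2 * \<alpha> n"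
        unfolding mult.assoc[symmetric] using elim lowA \<epsilon> by (intro mult_mono) auto
      finally show ?thesis .
    qed
    have b1: "real n * K * (n / ln n) powr (- q / 2) \<le> \<epsilon> / 2 * \<alpha> n"
    proof -
      let ?G = "real n powr (q / 2 - 1) / ln n powr (q / 2)"
      have G: "0 < ?G" using n ln1 by simp
      have "real n powr (max (min (q / 2 - 1) (q / 4)) (q / 2 - 2)) \<le> real n powr (q / 2 - 1)"
        using n by (intro powr_mono) auto
      then have "H n \<le> ?G" unfolding H_def by (rule divide_right_mono) simp
      then have "\<epsilon> / 2 / (K + 1) * H n \<le> \<epsilon> / 2 / (K + 1) * ?G"
        using c by (intro mult_left_mono) auto
      moreover have "0 \<le> H n" by (simp add: H_def)
      ultimately have "1 / \<alpha> n \<le> \<epsilon> / 2 / (K + 1) * ?G"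
        using elim(7) \<alpha> by simp
      then have *: "1 \<le> \<epsilon> / 2 / (K + 1) * ?G * \<alpha> n"
        using \<alpha> by (simp add: pos_divide_le_eq)
      have "(n / ln n) powr (- q / 2) = ln n powr (q / 2) / real n powr (q / 2)"
      proof -
        have "(n / ln n) powr (- q / 2) = (n / ln n) powr (- (q / 2))" by simp
        also have "\<dots> = 1 / (n / ln n) powr (q / 2)" by (rule powr_minus_divide)
        also have "\<dots> = ln n powr (q / 2) / real n powr (q / 2)" using ln1 by (simp add: powr_divide)
        finally show ?thesis .
      qed
      moreover have "real n powr (q / 2) = real n * real n powr (q / 2 - 1)"
        using n0 powr_add[of "real n" 1 "q / 2 - 1"] by simp
      ultimately have eq: "real n * K * (n / ln n) powr (- q / 2) = K / ?G"
        using n0 by (simp only:) simp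
      have cancel: "k' * (\<epsilon> / 2 / k' * G * w) = \<epsilon> / 2 * w * G" if "k' \<noteq> 0" for k' G w :: real
        using that by simp
      have "K * 1 \<le> (K + 1) * (\<epsilon> / 2 / (K + 1) * ?G * \<alpha> n)"
        using * K by (intro mult_mono) auto
      also have "\<dots> = \<epsilon> / 2 * \<alpha> n * ?G" by (rule cancel) (use K in linarith)
      finally have "K \<le> \<epsilon> / 2 * \<alpha> n * ?G" by simp
      then show ?thesis unfolding eq using G by (simp only: pos_divide_le_eq)
    qed
    show ?case
    proof (intro allI impI)
      fix M :: "'b measure" and e
      assume "standardized_errors M {1..n} e q K"
      then interpret standardized_errors M "{1..n}" e q K .
      have hy: "h n * (n / ln n) = q * sqrt (ln n)" using n0 ln1 by (simp add: h_def)
      have hr: "h n * (1 / sqrt (ln n)) = q * ln n / n" using ln1 by (simp add: h_def)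
      have h0: "0 \<le> h n" unfolding h_def using q0 ln1 by simp
      have y0: "0 < n / ln n" by (rule divide_pos_pos) (use n0 ln1 in linarith)+
      have "\<P>(w in M. real (card {1..n}) * (1 + 1 / sqrt (ln n)) < (\<Sum>i=1..n. (e i w)\<^sup>2))
          \<le> real (card {1..n}) * K * (n / ln n) powr (- q / 2)
            + exp (real (card {1..n}) * (3 * exp (h n * (n / ln n)) * (1 + K) * h n powr sq_exponent - h n * (1 / sqrt (ln n))))"
        by (rule squares_upper_tail[OF h0 y0])
      also have "\<dots> = real n * K * (n / ln n) powr (- q / 2)
          + exp (real n * (3 * exp (q * sqrt (ln n)) * k * h n powr g - q * ln n / n))"
        unfolding hy hr by (simp add: k_def g_def sq_exponent_def)
      finally show "\<P>(w in M. real n * (1 + 1 / sqrt (ln n)) < (\<Sum>i=1..n. (e i w)\<^sup>2)) \<le> \<epsilon> * \<alpha> n"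
        using b1 b2 by simp
    qed
  qed
qed

text \<open>A nonpositive statistic forces every score to vanish, so a single column suffices. The
  anticoncentration bound then tends to 2 d, and d is chosen with 2 d \<le> \<epsilon>/2.\<close>

lemma prob_Lambda_stat_nonpos:
  assumes \<epsilon>: "0 < \<epsilon>"
  shows "eventually (\<lambda>n. \<forall>(M :: 'b measure) e. standardized_errors M {1..n} e q K \<longrightarrow>
      \<P>(w in M. Lambda_stat n (p n) (x n) (\<lambda>i. e i w) \<le> 0) \<le> \<epsilon>) sequentially"
proof -
  \<comment> \<open>A fixed \<epsilon> is the target rather than a multiple of \<alpha>/p, so the
    whole exponent q - 2 is available for the truncation.\<close>
  define B where "B = q - 2"
  define a where "a = B / (4 * q)"
  define d where "d = min 1 (\<epsilon> / 4)"
  define y where "y = (\<lambda>n::nat. real n powr (- a))"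
  define \<theta> where "\<theta> = (\<lambda>n::nat. K * (C * real n powr (1 - q / 2)) * y n powr (- q))"
  have B: "0 < B" using q by (simp add: B_def)
  have a: "0 < a" and aq: "a * q = B / 4" using B q by (auto simp: a_def)
  have d: "0 < d" "d \<le> 1" "2 * d \<le> \<epsilon> / 2" using \<epsilon> by (auto simp: d_def)
  have yq: "y n powr q = real n powr (- B / 4)" "y n powr (- q) = real n powr (B / 4)" for n
    unfolding y_def powr_powr using aq by (auto simp: algebra_simps)
  have nq: "real n powr (1 - q / 2) * real n powr (B / 4) = real n powr (- B / 4)" for n
    unfolding powr_add[symmetric] B_def by (rule arg_cong[where f = "\<lambda>e. real n powr e"]) (simp add: field_simps)
  have \<theta>_eq: "\<theta> n = K * C * real n powr (- B / 4)" for n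
    unfolding \<theta>_def yq using nq[of n] by simp
  have l1: "(\<lambda>n::nat. real n powr (- B / 4)) \<longlonglongrightarrow> 0" using B by real_asymp
  have l2: "y \<longlonglongrightarrow> 0" unfolding y_def using a by real_asymp
  have lC: "(\<lambda>n. C * real n powr (- B / 4)) \<longlonglongrightarrow> 0" by (rule tendsto_mult_right_zero[OF l1])
  have "\<theta> \<longlonglongrightarrow> 0" unfolding \<theta>_eq[abs_def] by (rule tendsto_mult_right_zero[OF l1])
  then have "(\<lambda>n. \<theta> n + 3360 / d ^ 3 * (2 * \<theta> n + (3 + gauss_cube) * y n)) \<longlonglongrightarrow> 0 + 3360 / d ^ 3 * (2 * 0 + (3 + gauss_cube) * 0)"
    by (intro tendsto_intros l2)
  then have lim: "(\<lambda>n. \<theta> n + 3360 / d ^ 3 * (2 * \<theta> n + (3 + gauss_cube) * y n)) \<longlonglongrightarrow> 0" by simp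
  have e2: "0 < \<epsilon> / 2" using \<epsilon> by simp
  show ?thesis
    using eventually_ge_at_top[of 1] p1 eventually_le_of_tendsto_0[OF lC zero_less_one] eventually_le_of_tendsto_0[OF lim e2]
  proof eventually_elim
    case (elim n)
    have n: "1 \<le> n" by fact
    have y0: "0 < y n" "y n \<le> 1" using n a powr_mono[of "- a" 0 "real n"] by (auto simp: y_def)
    have yC: "C * real n powr (1 - q / 2) \<le> y n powr q"
    proof -
      have "C * real n powr (1 - q / 2) * (real n powr (B / 4) * real n powr (- B / 4))
          = C * (real n powr (1 - q / 2) * real n powr (B / 4)) * real n powr (- B / 4)"
        by (simp only: mult.assoc)
      also have "\<dots> = C * real n powr (- B / 4) * real n powr (- B / 4)" by (simp only: nq)
      also have "\<dots> \<le> 1 * real n powr (- B / 4)" using elim by (intro mult_right_mono) auto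
      finally show ?thesis using n unfolding yq by (simp flip: powr_add)
    qed
    show ?case
    proof (intro allI impI)
      fix M :: "'b measure" and e
      assume "standardized_errors M {1..n} e q K"
      then interpret standardized_errors M "{1..n}" e q K .
      have j: "1 \<in> {1..p n}" using elim by simp
      let ?b = "\<lambda>i. x n i 1 / sqrt n"
      have q0: "0 < q" using q by simp
      note L = sum_norm_powr_le[OF n q0 mom[OF n j]]
      have "\<P>(w in M. Lambda_stat n (p n) (x n) (\<lambda>i. e i w) \<le> 0)
          \<le> \<P>(w in M. (\<Sum>i=1..n. ?b i * e i w) = 0)"
      proof (rule finite_measure_mono)
        show "{w \<in> space M. Lambda_stat n (p n) (x n) (\<lambda>i. e i w) \<le> 0}
            \<subseteq> {w \<in> space M. (\<Sum>i=1..n. ?b i * e i w) = 0}"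
        proof (rule subsetI)
          fix w assume w: "w \<in> {w \<in> space M. Lambda_stat n (p n) (x n) (\<lambda>i. e i w) \<le> 0}"
          have "\<bar>\<Sum>i=1..n. x n i 1 * e i w\<bar>
              \<le> Lambda_stat n (p n) (x n) (\<lambda>i. e i w) * sqrt (emp_mean n (\<lambda>i. (e i w)\<^sup>2))"
            by (rule score_le_Lambda_stat[OF n j])
          also have "\<dots> \<le> 0" using w
            by (auto intro!: mult_nonpos_nonneg simp: emp_mean_def intro!: sum_nonneg divide_nonneg_nonneg)
          finally have "(\<Sum>i=1..n. x n i 1 * e i w) = 0" by simp
          then have "(\<Sum>i=1..n. ?b i * e i w) = 0"
            by (simp flip: sum_divide_distrib)
          then show "w \<in> {w \<in> space M. (\<Sum>i=1..n. ?b i * e i w) = 0}" using w by simp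
        qed
      qed measurable
      also have "\<dots> \<le> \<theta> n + 2 * d + 3360 / d ^ 3 * (2 * \<theta> n + (3 + gauss_cube) * y n)"
        by (rule prob_sum_eq_0[OF sum_norm_square[OF n design[OF n j]] L K y0
              abs_norm_le[OF L yC q0 y0(1)] _ d(1,2)]) (simp_all add: \<theta>_def)
      also have "\<dots> \<le> \<epsilon>" using elim(4) d(3) by linarith
      finally show "\<P>(w in M. Lambda_stat n (p n) (x n) (\<lambda>i. e i w) \<le> 0) \<le> \<epsilon>" .
    qed
  qed
qed

end

subsection \<open>Quantiles\<close>

text \<open>Nonnegativity of Z and u > 0 bound the defining set below by 0, so that its
  \<open>Inf\<close> is meaningful.\<close>

lemma (in prob_space) quantile_le:
  assumes Z: "\<And>w. w \<in> space M \<Longrightarrow> 0 \<le> Z w" and u: "0 < u"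
    and t: "u \<le> \<P>(w in M. Z w \<le> t)"
  shows "quantile M Z u \<le> t"
  unfolding quantile_def
proof (rule cInf_lower)
  show "bdd_below {t. u \<le> \<P>(w in M. Z w \<le> t)}"
  proof (rule bdd_belowI)
    fix s assume "s \<in> {t. u \<le> \<P>(w in M. Z w \<le> t)}"
    then have "\<P>(w in M. Z w \<le> s) \<noteq> 0" using u by auto
    then have "{w \<in> space M. Z w \<le> s} \<noteq> {}" by (metis measure_empty)
    then show "0 \<le> s" using Z by (auto intro: order_trans)
  qed
qed (use t in simp)

text \<open>Right continuity of the distribution function: every point to the right of the quantile
  has level at least u, and the limit keeps it. The given t witnesses that the defining set is
  nonempty.\<close>

lemma (in prob_space) prob_le_quantile:
  assumes [measurable]: "Z \<in> borel_measurable M" and Z: "\<And>w. w \<in> space M \<Longrightarrow> 0 \<le> Z w" and u: "0 < u"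
    and t: "u \<le> \<P>(w in M. Z w \<le> t)"
  shows "u \<le> \<P>(w in M. Z w \<le> quantile M Z u)"
proof -
  let ?m = "quantile M Z u"
  interpret D: real_distribution "distr M borel Z" by (rule real_distribution_distr) simp
  have cdf: "cdf (distr M borel Z) s = \<P>(w in M. Z w \<le> s)" for s
    by (simp add: cdf_def measure_distr vimage_def Int_def conj_commute)
  have "((cdf (distr M borel Z)) \<longlongrightarrow> cdf (distr M borel Z) ?m) (at_right ?m)"
    using D.cdf_is_right_cont[of ?m] by (simp add: continuous_within)
  moreover have "eventually (\<lambda>s. u \<le> cdf (distr M borel Z) s) (at_right ?m)"
    unfolding eventually_at_right_field
  proof (intro exI[of _ "?m + 1"] conjI allI impI)
    fix s assume "?m < s"
    moreover have "{t. u \<le> \<P>(w in M. Z w \<le> t)} \<noteq> {}" using t by auto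
    ultimately obtain r where r: "u \<le> \<P>(w in M. Z w \<le> r)" "r < s"
      unfolding quantile_def by (metis (mono_tags, lifting) cInf_lessD mem_Collect_eq)
    note r(1)
    also have "\<P>(w in M. Z w \<le> r) \<le> \<P>(w in M. Z w \<le> s)"
      using r(2) by (intro finite_measure_mono) auto
    finally show "u \<le> cdf (distr M borel Z) s" by (simp add: cdf)
  qed simp
  ultimately have "u \<le> cdf (distr M borel Z) ?m"
    by (rule tendsto_lowerbound) simp
  then show ?thesis by (simp add: cdf)
qed

lemma normal_tail_strict_antimono:
  assumes "a < b" shows "normal_tail b < normal_tail a"
proof -
  define m where "m = max \<bar>a\<bar> \<bar>b\<bar>"
  have "(b - a) * std_normal_density m \<le> measure gauss {a<..b}"
  proof (rule gauss_interval_ge)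
    fix z assume "a \<le> z" "z \<le> b"
    then have "\<bar>z\<bar> \<le> \<bar>m\<bar>" by (auto simp: m_def)
    then have "z\<^sup>2 \<le> m\<^sup>2" by (simp only: abs_le_square_iff)
    then show "std_normal_density m \<le> std_normal_density z"
      by (auto simp: std_normal_density_def divide_right_mono)
  qed (use assms in auto)
  moreover have "0 < (b - a) * std_normal_density m" using assms by (simp add: normal_density_pos)
  ultimately show ?thesis using normal_tail_diff[of a b] assms by linarith
qed

lemma cdf_gauss: "cdf gauss z = 1 - normal_tail z"
proof -
  have "measure gauss (space gauss - {z<..}) = 1 - measure gauss {z<..}"
    by (rule gauss.prob_compl) simp
  moreover have "space gauss - {z<..} = {..z}" by auto
  ultimately show ?thesis by (simp add: cdf_def normal_tail_def)
qed

text \<open>Existence comes from the intermediate value theorem and uniqueness from strict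
  monotonicity of the tail, so the definite description in \<open>std_normal_quantile\<close>
  denotes.\<close>

lemma normal_tail_quantile:
  assumes w: "0 < w" "w < 1"
  shows "normal_tail (std_normal_quantile (1 - w)) = w"
proof -
  have cont: "isCont (cdf gauss) z" for z
  proof -
    have "emeasure gauss {z} = 0" by (subst emeasure_density) auto
    then show ?thesis by (simp add: gauss.isCont_cdf gauss.emeasure_eq_measure)
  qed
  have "eventually (\<lambda>z. cdf gauss z < 1 - w) at_bot"
    by (rule order_tendstoD[OF gauss.cdf_lim_at_bot]) (use w in simp)
  then obtain a where a: "cdf gauss a < 1 - w" by (auto simp: eventually_at_bot_linorder)
  have "eventually (\<lambda>z. 1 - w < cdf gauss z) at_top"
    by (rule order_tendstoD[OF gauss.cdf_lim_at_top_prob]) (use w in simp)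
  then obtain b where b: "1 - w < cdf gauss b" by (auto simp: eventually_at_top_linorder)
  have "a \<le> b"
    using gauss.cdf_nondecreasing[of b a] a b by (intro leI notI) auto
  then have "\<exists>z\<ge>a. z \<le> b \<and> cdf gauss z = 1 - w"
    using a b cont by (intro IVT) auto
  then obtain z where z: "cdf gauss z = 1 - w" by blast
  have uniq: "z' = z" if "cdf gauss z' = 1 - w" for z'
    using that z normal_tail_strict_antimono[of z z'] normal_tail_strict_antimono[of z' z]
    by (cases z z' rule: linorder_cases) (auto simp: cdf_gauss)
  have "std_normal_quantile (1 - w) = z"
    unfolding std_normal_quantile_def by (rule the_equality, rule z, erule uniq)
  then show ?thesis using z by (simp add: cdf_gauss)
qed

text \<open>Exponential Markov inequality with tilt t. It holds down to t = 0, where the Mills bound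
  blows up, and \<open>level\<close> is its exact inverse.\<close>

lemma normal_tail_le_exp:
  assumes "0 \<le> t" shows "normal_tail t \<le> exp (- t\<^sup>2 / 2)"
proof -
  have "gauss.prob {z \<in> space gauss. t < z} \<le> (\<integral>z. exp (- t\<^sup>2) * exp (t * z) \<partial>gauss)"
  proof (rule gauss.prob_le_expectation)
    show "integrable gauss (\<lambda>z. exp (- t\<^sup>2) * exp (t * z))" by (intro integrable_mult_right gauss_mgf)
    show "1 \<le> exp (- t\<^sup>2) * exp (t * z)" if "t < z" for z
      using assms that mult_left_mono[of t z t] by (auto simp: power2_eq_square simp flip: exp_add)
  qed auto
  also have "\<dots> = exp (- t\<^sup>2) * exp (t\<^sup>2 / 2)" by (simp add: gauss_mgf)
  also have "\<dots> = exp (- t\<^sup>2 / 2)" by (simp flip: exp_add)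
  finally show ?thesis by (simp add: normal_tail_def greaterThan_def)
qed

subsection \<open>The deterministic oracle inequality\<close>

lemma emp_mean_cong: "(\<And>i. i \<in> {1..n} \<Longrightarrow> f i = g i) \<Longrightarrow> emp_mean n f = emp_mean n g"
  by (simp add: emp_mean_def)

lemma emp_mean_nonneg: "(\<And>i. i \<in> {1..n} \<Longrightarrow> 0 \<le> f i) \<Longrightarrow> 0 \<le> emp_mean n f"
  unfolding emp_mean_def by (intro divide_nonneg_nonneg sum_nonneg) auto

lemma emp_mean_Cauchy_Schwarz:
  "\<bar>emp_mean n (\<lambda>i. f i * g i)\<bar> \<le> sqrt (emp_mean n (\<lambda>i. (f i)\<^sup>2)) * sqrt (emp_mean n (\<lambda>i. (g i)\<^sup>2))"
proof -
  have "(emp_mean n (\<lambda>i. f i * g i))\<^sup>2 \<le> emp_mean n (\<lambda>i. (f i)\<^sup>2) * emp_mean n (\<lambda>i. (g i)\<^sup>2)"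
    using Cauchy_Schwarz_ineq_sum[of f g "{1..n}"]
    by (simp add: emp_mean_def power_divide divide_right_mono power2_eq_square[of "real n"])
  then have "sqrt ((emp_mean n (\<lambda>i. f i * g i))\<^sup>2) \<le> sqrt (emp_mean n (\<lambda>i. (f i)\<^sup>2) * emp_mean n (\<lambda>i. (g i)\<^sup>2))"
    by (rule real_sqrt_le_mono)
  then show ?thesis by (simp add: real_sqrt_mult)
qed

lemma l1_norm_nonneg: "0 \<le> l1_norm p v"
  unfolding l1_norm_def by (intro sum_nonneg) auto

lemma l1_norm_split: "l1_norm p v = l1_norm p (restr T v) + l1_norm p (restr (- T) v)"
  unfolding l1_norm_def sum.distrib[symmetric] by (intro sum.cong) (auto simp: restr_def)

lemma Rvec_eq_0: "v \<in> Rvec p \<Longrightarrow> l1_norm p v = 0 \<Longrightarrow> v = (\<lambda>_. 0)"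
  unfolding l1_norm_def Rvec_def by (subst (asm) sum_nonneg_eq_0_iff) (auto simp: fun_eq_iff)

text \<open>Hoelder duality between the sup norm of the scores and the l1 norm.\<close>

lemma emp_mean_score_le:
  assumes "\<And>j. j \<in> {1..p} \<Longrightarrow> \<bar>emp_mean n (\<lambda>i. x i j * e i)\<bar> \<le> m"
  shows "\<bar>emp_mean n (\<lambda>i. e i * lin_pred p x v i)\<bar> \<le> m * l1_norm p v"
proof -
  have "emp_mean n (\<lambda>i. e i * lin_pred p x v i) = (\<Sum>i=1..n. \<Sum>j=1..p. x i j * e i * v j) / real n"
    by (simp add: emp_mean_def lin_pred_def sum_distrib_left ac_simps)
  also have "\<dots> = (\<Sum>j=1..p. emp_mean n (\<lambda>i. x i j * e i) * v j)"
    by (subst sum.swap) (simp add: emp_mean_def sum_divide_distrib sum_distrib_right)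
  finally have "\<bar>emp_mean n (\<lambda>i. e i * lin_pred p x v i)\<bar> \<le> (\<Sum>j=1..p. \<bar>emp_mean n (\<lambda>i. x i j * e i) * v j\<bar>)"
    by (simp add: sum_abs)
  also have "\<dots> \<le> (\<Sum>j=1..p. m * \<bar>v j\<bar>)"
    unfolding abs_mult by (intro sum_mono mult_right_mono assms) auto
  finally show ?thesis by (simp add: l1_norm_def sum_distrib_left)
qed

text \<open>On the score event the gradient of the root loss at \<beta>0 has sup norm at most lam /
  (c n), so the loss can fall by at most that multiple of the l1 norm of \<delta>; optimality lets
  it rise by at most lam / n times the l1 norm on the support minus that off it. Through the
  restricted eigenvalue, L converts (lam / n) times the l1 norm on the support into a multiple of
  the prediction norm, and R L < 1 lets the squared loss difference be absorbed into the left
  side.\<close>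

lemma sqrt_lasso_bound:
  fixes \<beta>0 b :: "nat \<Rightarrow> real"
  assumes n: "1 \<le> n" and \<beta>0: "\<beta>0 \<in> Rvec p" and \<sigma>: "0 < \<sigma>"
    and y: "\<And>i. i \<in> {1..n} \<Longrightarrow> y i = lin_pred p x \<beta>0 i + \<sigma> * e i"
    and lasso: "is_sqrt_lasso n p x y lam b"
    and c: "1 < c" "cbar = (c + 1) / (c - 1)" and \<kappa>: "0 < \<kappa>"
    and re: "ereal \<kappa> \<le> re_kappa n p x (supp \<beta>0) cbar"
    and ret: "ereal \<kappa> \<le> re_kappa_tilde n p x (supp \<beta>0) cbar"
    and lam: "0 < lam" and score: "c * Lambda_stat n p x e \<le> lam"
  defines "L \<equiv> lam * sqrt (card (supp \<beta>0)) / (real n * \<kappa>)"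
    and "R \<equiv> max 1 ((1 + cbar) / c)" and "\<delta> \<equiv> (\<lambda>j. b j - \<beta>0 j)"
  assumes L: "(R * L)\<^sup>2 < 1"
  shows "\<kappa> * l2_norm p \<delta> \<le> pred_norm n p x \<delta>"
    and "pred_norm n p x \<delta> \<le> 2 * (1 + 1 / c) * L * (\<sigma> * sqrt (emp_mean n (\<lambda>i. (e i)\<^sup>2))) / (1 - (R * L)\<^sup>2)"
proof -
  define T where "T = supp \<beta>0"
  define v where "v = lin_pred p x \<delta>"
  define ve where "ve = emp_mean n (\<lambda>i. (e i)\<^sup>2)"
  define q0 where "q0 = \<sigma> * sqrt ve"
  define qh where "qh = sqrt (emp_mean n (\<lambda>i. (\<sigma> * e i - v i)\<^sup>2))"
  define D where "D = pred_norm n p x \<delta>"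
  \<comment> \<open>On the score event m bounds every score mean relative to the root mean square of
    the errors.\<close>
  define m where "m = lam / (c * n)"
  define tT where "tT = l1_norm p (restr T \<delta>)"
  define tC where "tC = l1_norm p (restr (- T) \<delta>)"
  have m: "0 < m" using lam n c by (simp add: m_def)
  have cm: "lam / n = c * m" using c by (simp add: m_def)
  have t0: "0 \<le> tT" "0 \<le> tC" by (auto simp: tT_def tC_def l1_norm_nonneg)
  have ve0: "0 \<le> ve" unfolding ve_def by (rule emp_mean_nonneg) simp
  have q0: "0 \<le> q0" "q0\<^sup>2 = emp_mean n (\<lambda>i. (\<sigma> * e i)\<^sup>2)" "q0 = sqrt (emp_mean n (\<lambda>i. (\<sigma> * e i)\<^sup>2))"
  proof -
    have eq: "emp_mean n (\<lambda>i. (\<sigma> * e i)\<^sup>2) = \<sigma>\<^sup>2 * ve"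
      by (simp add: ve_def emp_mean_def power_mult_distrib sum_distrib_left)
    show "0 \<le> q0" using \<sigma> ve0 by (simp add: q0_def)
    show "q0\<^sup>2 = emp_mean n (\<lambda>i. (\<sigma> * e i)\<^sup>2)" unfolding eq q0_def using ve0 by (simp add: power_mult_distrib)
    show "q0 = sqrt (emp_mean n (\<lambda>i. (\<sigma> * e i)\<^sup>2))" using \<sigma> by (simp add: q0_def eq real_sqrt_mult)
  qed
  have qh0: "0 \<le> qh" "qh\<^sup>2 = emp_mean n (\<lambda>i. (\<sigma> * e i - v i)\<^sup>2)"
    using emp_mean_nonneg[of n "\<lambda>i. (\<sigma> * e i - v i)\<^sup>2"] by (auto simp: qh_def)
  have D0: "0 \<le> D" "D\<^sup>2 = emp_mean n (\<lambda>i. (v i)\<^sup>2)"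
    using emp_mean_nonneg[of n "\<lambda>i. (v i)\<^sup>2"] by (auto simp: D_def pred_norm_def v_def)
  have R: "1 \<le> R" "(1 + cbar) / c \<le> R" by (auto simp: R_def)
  have cbar: "0 < cbar" using c by simp
  have L0: "0 \<le> L" unfolding L_def using lam \<kappa> by simp
  define w where "w = emp_mean n (\<lambda>i. \<sigma> * e i * v i)"
  have w_le: "\<bar>w\<bar> \<le> m * q0 * (tT + tC)"
  proof -
    have "\<bar>emp_mean n (\<lambda>i. e i * lin_pred p x \<delta> i)\<bar> \<le> (m * sqrt ve) * l1_norm p \<delta>"
    proof (rule emp_mean_score_le)
      fix j assume j: "j \<in> {1..p}"
      have "\<bar>\<Sum>i=1..n. x i j * e i\<bar> \<le> Lambda_stat n p x e * sqrt ve"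
        unfolding ve_def by (rule score_le_Lambda_stat[OF n j])
      also have "\<dots> \<le> lam / c * sqrt ve"
        using score c ve0 by (intro mult_right_mono) (auto simp: pos_le_divide_eq mult.commute)
      finally have "\<bar>\<Sum>i=1..n. x i j * e i\<bar> / n \<le> lam / c * sqrt ve / n"
        by (rule divide_right_mono) simp
      then show "\<bar>emp_mean n (\<lambda>i. x i j * e i)\<bar> \<le> m * sqrt ve"
        by (simp add: emp_mean_def m_def abs_divide)
    qed
    then have "\<sigma> * \<bar>emp_mean n (\<lambda>i. e i * lin_pred p x \<delta> i)\<bar> \<le> \<sigma> * ((m * sqrt ve) * l1_norm p \<delta>)"
      using \<sigma> by (intro mult_left_mono) auto
    moreover have "w = \<sigma> * emp_mean n (\<lambda>i. e i * lin_pred p x \<delta> i)"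
      by (simp add: w_def v_def emp_mean_def sum_distrib_left mult.assoc)
    ultimately show ?thesis
      using \<sigma> l1_norm_split[of p \<delta> T] by (simp add: abs_mult q0_def tT_def tC_def ac_simps)
  qed
  have expand: "qh\<^sup>2 = q0\<^sup>2 - 2 * w + D\<^sup>2"
  proof -
    have "qh\<^sup>2 = emp_mean n (\<lambda>i. (\<sigma> * e i)\<^sup>2 - 2 * (\<sigma> * e i * v i) + (v i)\<^sup>2)"
      unfolding qh0(2) by (rule emp_mean_cong) (simp add: power2_diff)
    also have "\<dots> = q0\<^sup>2 - 2 * w + D\<^sup>2"
      unfolding q0(2) w_def D0(2)
      by (simp add: emp_mean_def sum.distrib sum_subtractf add_divide_distrib diff_divide_distrib flip: sum_distrib_left)
    finally show ?thesis .
  qed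
  have bR: "b \<in> Rvec p" and opt: "sqrt_lasso_obj n p x y lam b \<le> sqrt_lasso_obj n p x y lam \<beta>0"
    using lasso \<beta>0 by (auto simp: is_sqrt_lasso_def is_arg_min_def not_less)
  have \<delta>R: "\<delta> \<in> Rvec p" using bR \<beta>0 by (auto simp: Rvec_def \<delta>_def)
  have lin: "lin_pred p x b i = lin_pred p x \<beta>0 i + v i" for i
    by (simp add: v_def \<delta>_def lin_pred_def algebra_simps flip: sum.distrib)
  have "emp_mean n (\<lambda>i. (y i - lin_pred p x b i)\<^sup>2) = emp_mean n (\<lambda>i. (\<sigma> * e i - v i)\<^sup>2)"
    by (rule emp_mean_cong) (simp add: y lin)
  moreover have "emp_mean n (\<lambda>i. (y i - lin_pred p x \<beta>0 i)\<^sup>2) = emp_mean n (\<lambda>i. (\<sigma> * e i)\<^sup>2)"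
    by (rule emp_mean_cong) (simp add: y)
  ultimately have opt': "qh + c * m * l1_norm p b \<le> q0 + c * m * l1_norm p \<beta>0"
    using opt unfolding sqrt_lasso_obj_def cm by (simp add: qh_def q0(3))
  have "l1_norm p \<beta>0 - l1_norm p b \<le> tT - tC"
  proof -
    have "l1_norm p \<beta>0 \<le> l1_norm p b + tT - tC"
      unfolding l1_norm_def tT_def tC_def sum.distrib[symmetric] sum_subtractf[symmetric]
      by (intro sum_mono) (auto simp: restr_def \<delta>_def T_def supp_def)
    then show ?thesis by simp
  qed
  then have "c * m * (l1_norm p \<beta>0 - l1_norm p b) \<le> c * m * (tT - tC)"
    using c m by (intro mult_left_mono) auto
  then have up: "qh - q0 \<le> c * m * (tT - tC)" using opt' by (simp add: right_diff_distrib)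
  \<comment> \<open>Convexity of the root loss, made explicit by Cauchy-Schwarz. When q0 = 0 the
    root has no gradient at \<beta>0, but then the left side is nonpositive anyway.\<close>
  have low: "q0 - qh \<le> m * (tT + tC)"
  proof (cases "q0 = 0")
    case True
    moreover have "0 \<le> m * (tT + tC)" using m t0 by simp
    ultimately show ?thesis using qh0(1) by linarith
  next
    case False
    then have qpos: "0 < q0" using q0(1) by simp
    have "q0\<^sup>2 - w = emp_mean n (\<lambda>i. \<sigma> * e i * (\<sigma> * e i - v i))"
      unfolding q0(2) w_def
      by (simp add: emp_mean_def power2_eq_square right_diff_distrib sum_subtractf diff_divide_distrib)
    also have "\<dots> \<le> q0 * qh"
      using emp_mean_Cauchy_Schwarz[of n "\<lambda>i. \<sigma> * e i" "\<lambda>i. \<sigma> * e i - v i"] unfolding q0(3) qh_def by simp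
    finally have "q0 * (q0 - qh) \<le> q0 * (m * (tT + tC))"
      using w_le by (simp add: power2_eq_square algebra_simps)
    then show ?thesis using qpos by simp
  qed
  have cone: "tC \<le> cbar * tT"
  proof -
    have "0 \<le> m * (c * (tT - tC) + (tT + tC))" using up low by (simp add: algebra_simps)
    then have "0 \<le> c * (tT - tC) + (tT + tC)" using m by (simp add: zero_le_mult_iff)
    then have "tC * (c - 1) \<le> (c + 1) * tT" by (simp add: algebra_simps)
    then show ?thesis using c by (simp add: pos_le_divide_eq)
  qed
  \<comment> \<open>The cone excludes the zero vector, which is treated separately. This also covers
    an empty support, where tT = 0 forces \<delta> = 0.\<close>
  have "\<kappa> * l2_norm p \<delta> \<le> D \<and> c * m * tT \<le> L * D"
  proof (cases "\<delta> = (\<lambda>_. 0)")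
    case True
    then have "l2_norm p \<delta> = 0" "tT = 0" by (auto simp: l2_norm_def L2_set_def tT_def l1_norm_def restr_def)
    then show ?thesis using D0(1) L0 by simp
  next
    case False
    then have mem: "\<delta> \<in> restricted_cone p T cbar"
      using \<delta>R cone by (simp add: restricted_cone_def tT_def tC_def)
    have "tT \<noteq> 0"
    proof
      assume "tT = 0"
      then have "l1_norm p \<delta> = 0" using cone t0 l1_norm_split[of p \<delta> T] by (simp add: tT_def tC_def)
      then show False using Rvec_eq_0[OF \<delta>R] False by simp
    qed
    then have tT: "0 < tT" using t0 by simp
    have "ereal \<kappa> \<le> ereal (sqrt (real (card T)) * D / tT)"
      using re INF_lower[OF mem, of "\<lambda>\<delta>. ereal (sqrt (real (card T)) * pred_norm n p x \<delta> / l1_norm p (restr T \<delta>))"]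
      unfolding re_kappa_def D_def tT_def T_def by (rule order_trans)
    then have \<kappa>T: "\<kappa> * tT \<le> sqrt (real (card T)) * D" using tT by (simp add: pos_le_divide_eq)
    have "c * m * tT * \<kappa> = c * m * (\<kappa> * tT)" by simp
    also have "\<dots> \<le> c * m * (sqrt (real (card T)) * D)" using c m by (intro mult_left_mono[OF \<kappa>T]) auto
    also have "\<dots> = L * D * \<kappa>"
      unfolding cm[symmetric] L_def T_def using \<kappa> by simp
    finally have 1: "c * m * tT \<le> L * D" using \<kappa> by simp
    have "0 \<le> l2_norm p \<delta>" by (simp add: l2_norm_def)
    moreover have "ereal \<kappa> \<le> ereal (D / l2_norm p \<delta>)"
      using ret INF_lower[OF mem, of "\<lambda>\<delta>. ereal (pred_norm n p x \<delta> / l2_norm p \<delta>)"]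
      unfolding re_kappa_tilde_def D_def T_def by (rule order_trans)
    ultimately have "\<kappa> * l2_norm p \<delta> \<le> D"
      using D0(1) by (cases "l2_norm p \<delta> = 0") (auto simp: pos_le_divide_eq)
    then show ?thesis using 1 by blast
  qed
  then have k2: "\<kappa> * l2_norm p \<delta> \<le> D" and tL: "c * m * tT \<le> L * D" by auto
  show "\<kappa> * l2_norm p \<delta> \<le> pred_norm n p x \<delta>" using k2 by (simp add: D_def)
  have ct0: "0 \<le> c * m * tT" using c m t0 by simp
  \<comment> \<open>The loss rises by at most c m tT and, on the cone, falls by at most m (1 + cbar)
    tT; R is the larger factor relative to c m tT.\<close>
  have "\<bar>qh - q0\<bar> \<le> R * (c * m * tT)"
  proof -
    have "c * m * (tT - tC) \<le> 1 * (c * m * tT)" using c m t0 by simp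
    also have "\<dots> \<le> R * (c * m * tT)" using R ct0 by (intro mult_right_mono) auto
    finally have 1: "qh - q0 \<le> R * (c * m * tT)" using up by linarith
    have "m * (tT + tC) \<le> m * (tT + cbar * tT)" using m cone by simp
    also have "\<dots> = (1 + cbar) / c * (c * m * tT)" using c by (simp add: field_simps)
    also have "\<dots> \<le> R * (c * m * tT)" using R ct0 by (intro mult_right_mono) auto
    finally show ?thesis using 1 low by linarith
  qed
  also have "\<dots> \<le> R * (L * D)" using R tL by (intro mult_left_mono) auto
  finally have "\<bar>qh - q0\<bar>\<^sup>2 \<le> (R * (L * D))\<^sup>2" by (intro power_mono) auto
  then have sq: "(qh - q0)\<^sup>2 \<le> (R * L)\<^sup>2 * D\<^sup>2" by (simp add: power_mult_distrib mult.assoc)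
  \<comment> \<open>The squared losses are compared through qh - q0: its square yields D^2 with a
    small coefficient, the rest is linear in D.\<close>
  have d1: "D\<^sup>2 = (qh - q0)\<^sup>2 + 2 * q0 * (qh - q0) + 2 * w"
    using expand by (simp add: power2_eq_square algebra_simps)
  have d2: "2 * q0 * (qh - q0) + 2 * w \<le> 2 * q0 * ((1 + 1 / c) * (c * m * tT))"
  proof -
    have "q0 * (qh - q0) \<le> q0 * (c * m * (tT - tC))" using up q0(1) by (rule mult_left_mono)
    then have "q0 * (qh - q0) + w \<le> q0 * (c * m * (tT - tC) + m * (tT + tC))"
      using w_le by (simp add: distrib_left ac_simps)
    \<comment> \<open>The score term raises the factor of m tT from c to c + 1 and leaves -(c - 1) m
      tC, which is dropped; this is the origin of 1 + 1/c and hence of 1 + c in the final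
      constant.\<close>
    also have "c * m * (tT - tC) + m * (tT + tC) = (1 + 1 / c) * (c * m * tT) - (c - 1) * (m * tC)"
      using c by (simp add: field_simps)
    also have "q0 * ((1 + 1 / c) * (c * m * tT) - (c - 1) * (m * tC)) \<le> q0 * ((1 + 1 / c) * (c * m * tT))"
      using q0(1) c m t0 by (intro mult_left_mono) auto
    finally show ?thesis by simp
  qed
  have d3: "2 * q0 * ((1 + 1 / c) * (c * m * tT)) \<le> 2 * q0 * ((1 + 1 / c) * (L * D))"
    using q0(1) c tL by (intro mult_left_mono) auto
  have "D\<^sup>2 \<le> (R * L)\<^sup>2 * D\<^sup>2 + 2 * q0 * ((1 + 1 / c) * (L * D))"
    using sq d1 d2 d3 by linarith
  then have "D * (D * (1 - (R * L)\<^sup>2)) \<le> D * (2 * (1 + 1 / c) * L * q0)"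
    by (simp add: power2_eq_square algebra_simps)
  then have "D * (1 - (R * L)\<^sup>2) \<le> 2 * (1 + 1 / c) * L * q0"
    using D0(1) L0 q0(1) c by (cases "D = 0") auto
  then show "pred_norm n p x \<delta> \<le> 2 * (1 + 1 / c) * L * (\<sigma> * sqrt (emp_mean n (\<lambda>i. (e i)\<^sup>2))) / (1 - (R * L)\<^sup>2)"
    using L by (simp add: pos_le_divide_eq D_def[symmetric] q0_def ve_def)
qed

subsection \<open>Asymptotics of the penalty level\<close>

lemma normal_tail_pos: "0 < normal_tail t"
  using normal_tail_strict_antimono[of t "t + 1"] normal_tail_nonneg[of "t + 1"] by linarith

context asymptotic_design
begin

text \<open>The solution t of exp(-t^2/2) = \<alpha>/(2p). Times c sqrt n it eventually majorises
  all three penalties, and it is the source of the logarithm in the rate.\<close>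

definition level :: "nat \<Rightarrow> real" where
  "level n = sqrt (2 * ln (2 * real (p n) / \<alpha> n))"

lemma real_p_lim: "filterlim (\<lambda>n. real (p n)) at_top sequentially"
  by (rule filterlim_compose[OF filterlim_real_sequentially p_lim])

lemma p_over_\<alpha>_lim: "filterlim (\<lambda>n. real (p n) / \<alpha> n) at_top sequentially"
proof (rule filterlim_at_top_mono[OF real_p_lim])
  show "eventually (\<lambda>n. real (p n) \<le> real (p n) / \<alpha> n) sequentially"
    using eventually_ge_at_top[of 1]
  proof eventually_elim
    case (elim n)
    have "real (p n) * \<alpha> n \<le> real (p n) * 1" using \<alpha>[OF elim] by (intro mult_left_mono) auto
    then show ?case using \<alpha>[OF elim] by (simp add: pos_le_divide_eq)
  qed
qed

lemma level_lim: "filterlim level at_top sequentially"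
proof -
  have "filterlim (\<lambda>u::real. sqrt (2 * ln (2 * u))) at_top at_top" by real_asymp
  from filterlim_compose[OF this p_over_\<alpha>_lim] show ?thesis
    by (simp add: level_def[abs_def])
qed

text \<open>The rate condition on p places this level in the range of the moderate deviation
  bound.\<close>

lemma level_le: "eventually (\<lambda>n. level n \<le> sqrt (\<eta> * (q - 2) * ln n)) sequentially"
  using eventually_ge_at_top[of 1] p1 rate
proof eventually_elim
  case (elim n)
  note a = \<alpha>[OF elim(1)]
  have "2 * real (p n) / \<alpha> n \<le> real n powr (\<eta> * (q - 2) / 2)"
    using elim a by (simp add: pos_divide_le_eq mult.commute)
  then have "ln (2 * real (p n) / \<alpha> n) \<le> ln (real n powr (\<eta> * (q - 2) / 2))"
    using elim a by (subst ln_le_cancel_iff) auto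
  then have "2 * ln (2 * real (p n) / \<alpha> n) \<le> \<eta> * (q - 2) * ln n"
    using elim by (simp add: ln_powr)
  then show ?case unfolding level_def by (rule real_sqrt_le_mono)
qed

lemma exp_level:
  assumes "1 \<le> n" "1 \<le> p n"
  shows "exp (- (level n)\<^sup>2 / 2) = \<alpha> n / (2 * real (p n))"
proof -
  note a = \<alpha>[OF assms(1)]
  have "\<alpha> n < 2 * real (p n)" using a assms(2) by linarith
  then have "1 < 2 * real (p n) / \<alpha> n" using a by (simp add: less_divide_eq)
  then have "(level n)\<^sup>2 = 2 * ln (2 * real (p n) / \<alpha> n)" "0 < 2 * real (p n) / \<alpha> n"
    by (auto simp: level_def)
  then show ?thesis by (simp add: exp_minus)
qed

text \<open>At \<open>level n\<close> the Mills bound gains a factor level n * sqrt(2 pi) \<ge> 4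
  over \<alpha>/(2p). This pays for the error terms with \<epsilon> = 1/4, since (1/4)(5/4) + 1/4 <
  1, so the probability is below \<alpha> itself and not merely \<alpha> + o(\<alpha>).\<close>

lemma Lambda_stat_tail_level:
  "eventually (\<lambda>n. \<forall>(M :: 'b measure) e. standardized_errors M {1..n} e q K \<longrightarrow>
      \<P>(w in M. sqrt n * level n < Lambda_stat n (p n) (x n) (\<lambda>i. e i w)) \<le> \<alpha> n) sequentially"
proof -
  have "eventually (\<lambda>n. 4 \<le> level n) sequentially"
    using level_lim by (simp add: filterlim_at_top)
  moreover have "eventually (\<lambda>n. \<forall>(M :: 'b measure) e. standardized_errors M {1..n} e q K \<longrightarrow>
      \<P>(w in M. sqrt n * level n < Lambda_stat n (p n) (x n) (\<lambda>i. e i w))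
        \<le> 2 * real (p n) * normal_tail (level n) * (1 + 1 / 4) + 1 / 4 * \<alpha> n) sequentially"
    by (rule Lambda_stat_moderate_deviation[OF _ level_lim level_le]) auto
  ultimately show ?thesis
    using eventually_ge_at_top[of 1] p1
  proof eventually_elim
    case (elim n)
    note a = \<alpha>[OF elim(3)]
    have l: "4 \<le> level n" by fact
    have "1 \<le> sqrt (2 * pi)" using pi_ge_two by simp
    then have "4 * 1 \<le> level n * sqrt (2 * pi)" using l by (intro mult_mono) auto
    then have "exp (- (level n)\<^sup>2 / 2) / (level n * sqrt (2 * pi)) \<le> exp (- (level n)\<^sup>2 / 2) / 4"
      by (intro divide_left_mono) auto
    moreover have "normal_tail (level n) \<le> exp (- (level n)\<^sup>2 / 2) / (level n * sqrt (2 * pi))"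
      using l by (intro normal_tail_le_density) simp
    ultimately have "normal_tail (level n) \<le> \<alpha> n / (2 * real (p n)) / 4"
      unfolding exp_level[OF elim(3,4)] by linarith
    then have "2 * real (p n) * normal_tail (level n) \<le> 2 * real (p n) * (\<alpha> n / (2 * real (p n)) / 4)"
      by (intro mult_left_mono) auto
    also have "\<dots> = \<alpha> n / 4" using elim(4) by simp
    finally have "2 * real (p n) * normal_tail (level n) * (1 + 1 / 4) + 1 / 4 * \<alpha> n \<le> \<alpha> n"
      using a by (simp add: field_simps)
    then show ?case using elim(2) by (meson order_trans)
  qed
qed

definition asymptotic_level :: "nat \<Rightarrow> real" where
  "asymptotic_level n = std_normal_quantile (1 - \<alpha> n / (2 * real (p n)))"

lemma normal_tail_asymptotic_level:
  assumes "1 \<le> n" "1 \<le> p n"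
  shows "normal_tail (asymptotic_level n) = \<alpha> n / (2 * real (p n))"
  unfolding asymptotic_level_def
  by (rule normal_tail_quantile) (use \<alpha>[OF assms(1)] assms(2) in \<open>auto simp: divide_less_eq\<close>)

text \<open>The exponential tail bound at \<open>level n\<close> is exactly \<alpha>/(2p), the tail
  at the normal quantile.\<close>

lemma asymptotic_level_le_level:
  assumes "1 \<le> n" "1 \<le> p n"
  shows "asymptotic_level n \<le> level n"
proof (rule ccontr)
  assume *: "\<not> asymptotic_level n \<le> level n"
  have l0: "0 \<le> level n"
  proof -
    have "1 \<le> 2 * real (p n) / \<alpha> n" using \<alpha>[OF assms(1)] assms(2) by (simp add: pos_le_divide_eq)
    then show ?thesis by (simp add: level_def)
  qed
  have "normal_tail (asymptotic_level n) < normal_tail (level n)"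
    using * by (intro normal_tail_strict_antimono) simp
  also have "\<dots> \<le> exp (- (level n)\<^sup>2 / 2)" by (rule normal_tail_le_exp[OF l0])
  finally show False using exp_level[OF assms] normal_tail_asymptotic_level[OF assms] by simp
qed

lemma asymptotic_level_lim: "filterlim asymptotic_level at_top sequentially"
  unfolding filterlim_at_top
proof
  fix Z :: real
  have "(\<lambda>n. \<alpha> n / (2 * real (p n))) \<longlonglongrightarrow> 0"
  proof -
    have "(\<lambda>n. inverse (real (p n) / \<alpha> n)) \<longlonglongrightarrow> 0"
      by (rule filterlim_compose[OF tendsto_inverse_0_at_top[OF filterlim_ident] p_over_\<alpha>_lim])
    then have "(\<lambda>n. inverse (real (p n) / \<alpha> n) * (1 / 2)) \<longlonglongrightarrow> 0"
      by (rule tendsto_mult_left_zero)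
    then show ?thesis by (simp add: field_simps)
  qed
  then have "eventually (\<lambda>n. \<alpha> n / (2 * real (p n)) < normal_tail Z) sequentially"
    by (rule order_tendstoD) (rule normal_tail_pos)
  then show "eventually (\<lambda>n. Z \<le> asymptotic_level n) sequentially"
    using eventually_ge_at_top[of 1] p1
  proof eventually_elim
    case (elim n)
    then have "normal_tail (asymptotic_level n) < normal_tail Z"
      by (simp add: normal_tail_asymptotic_level)
    then show ?case using normal_tail_antimono[of "asymptotic_level n" Z] by linarith
  qed
qed

text \<open>The tail bound without o(\<alpha>) loss puts sqrt n * level n into the set whose infimum
  is the quantile, uniformly over the laws; the same membership secures the nominal coverage of the
  quantile.\<close>

lemma Lambda_quantile_bounds:
  "eventually (\<lambda>n. \<forall>F. real_distribution F \<longrightarrow> standardized_law F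
      \<longrightarrow> (\<integral>\<^sup>+ e. ennreal (\<bar>e\<bar> powr q) \<partial>F) \<le> ennreal K \<longrightarrow>
      Lambda_quantile n (p n) (x n) F (1 - \<alpha> n) \<le> sqrt n * level n \<and>
      1 - \<alpha> n \<le> \<P>(w in (PiM {1..n} (\<lambda>_. F)).
        Lambda_stat n (p n) (x n) w \<le> Lambda_quantile n (p n) (x n) F (1 - \<alpha> n))) sequentially"
  using Lambda_stat_tail_level[where ?'b = "nat \<Rightarrow> real"] p1 eventually_ge_at_top[of 1]
proof eventually_elim
  case (elim n)
  show ?case
  proof (intro allI impI)
    fix F assume F: "real_distribution F" "standardized_law F" "(\<integral>\<^sup>+ e. ennreal (\<bar>e\<bar> powr q) \<partial>F) \<le> ennreal K"
    let ?P = "PiM {1..n} (\<lambda>_. F)"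
    have se: "standardized_errors ?P {1..n} (\<lambda>i w. w i) q K"
      by (rule standardized_errors_PiM[OF F(1,2) q elim(3) F(3) K])
    interpret standardized_errors ?P "{1..n}" "\<lambda>i w. w i" q K by (rule se)
    have Z [measurable]: "Lambda_stat n (p n) (x n) \<in> borel_measurable ?P"
      using Lambda_stat_measurable[of n "\<lambda>i w. w i" ?P "p n" "x n"] e_measurable by simp
    have "\<P>(w in ?P. sqrt n * level n < Lambda_stat n (p n) (x n) w) \<le> \<alpha> n"
      using elim(1)[rule_format, OF se] by simp
    moreover have "\<P>(w in ?P. \<not> (sqrt n * level n < Lambda_stat n (p n) (x n) w))
        = 1 - \<P>(w in ?P. sqrt n * level n < Lambda_stat n (p n) (x n) w)"
      by (rule prob_neg) measurable
    ultimately have t: "1 - \<alpha> n \<le> \<P>(w in ?P. Lambda_stat n (p n) (x n) w \<le> sqrt n * level n)"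
      by (simp add: not_less)
    have u: "0 < 1 - \<alpha> n" using \<alpha>[OF elim(3)] by simp
    note nn = Lambda_stat_nonneg[OF elim(2)]
    show "Lambda_quantile n (p n) (x n) F (1 - \<alpha> n) \<le> sqrt n * level n \<and>
      1 - \<alpha> n \<le> \<P>(w in ?P. Lambda_stat n (p n) (x n) w \<le> Lambda_quantile n (p n) (x n) F (1 - \<alpha> n))"
      unfolding Lambda_quantile_def
      using quantile_le[OF nn u t] prob_le_quantile[OF Z nn u t] by simp
  qed
qed

text \<open>A nonpositive quantile would give a nonpositive statistic probability at least 1 - a,
  while anticoncentration allows only (1 - a)/2; here \<alpha> has to stay away from 1.\<close>

lemma Lambda_quantile_pos:
  assumes bdd: "\<exists>a<1. \<forall>n\<ge>1. \<alpha> n \<le> a"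
  shows "eventually (\<lambda>n. \<forall>F. real_distribution F \<longrightarrow> standardized_law F
      \<longrightarrow> (\<integral>\<^sup>+ e. ennreal (\<bar>e\<bar> powr q) \<partial>F) \<le> ennreal K
      \<longrightarrow> 0 < Lambda_quantile n (p n) (x n) F (1 - \<alpha> n)) sequentially"
proof -
  obtain a where a: "a < 1" "\<And>n. 1 \<le> n \<Longrightarrow> \<alpha> n \<le> a" using bdd by blast
  have a2: "0 < (1 - a) / 2" using a by simp
  have "eventually (\<lambda>n. \<forall>(M :: (nat \<Rightarrow> real) measure) e. standardized_errors M {1..n} e q K \<longrightarrow>
      \<P>(w in M. Lambda_stat n (p n) (x n) (\<lambda>i. e i w) \<le> 0) \<le> (1 - a) / 2) sequentially"
    by (rule prob_Lambda_stat_nonpos[OF a2])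
  then show ?thesis
    using Lambda_quantile_bounds eventually_ge_at_top[of 1]
  proof eventually_elim
    case (elim n)
    show ?case
    proof (intro allI impI, rule ccontr)
      fix F assume F: "real_distribution F" "standardized_law F" "(\<integral>\<^sup>+ e. ennreal (\<bar>e\<bar> powr q) \<partial>F) \<le> ennreal K"
      assume np: "\<not> 0 < Lambda_quantile n (p n) (x n) F (1 - \<alpha> n)"
      let ?P = "PiM {1..n} (\<lambda>_. F)"
      have se: "standardized_errors ?P {1..n} (\<lambda>i w. w i) q K"
        by (rule standardized_errors_PiM[OF F(1,2) q elim(3) F(3) K])
      interpret standardized_errors ?P "{1..n}" "\<lambda>i w. w i" q K by (rule se)
      have [measurable]: "(\<lambda>w. Lambda_stat n (p n) (x n) w) \<in> borel_measurable ?P"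
        using Lambda_stat_measurable[of n "\<lambda>i w. w i" ?P "p n" "x n"] e_measurable by simp
      have "1 - a \<le> 1 - \<alpha> n" using a(2)[OF elim(3)] by simp
      also have "\<dots> \<le> \<P>(w in ?P. Lambda_stat n (p n) (x n) w \<le> Lambda_quantile n (p n) (x n) F (1 - \<alpha> n))"
        using elim(2) F by blast
      also have "\<dots> \<le> \<P>(w in ?P. Lambda_stat n (p n) (x n) w \<le> 0)"
      proof (rule finite_measure_mono)
        show "{w \<in> space ?P. Lambda_stat n (p n) (x n) w \<le> Lambda_quantile n (p n) (x n) F (1 - \<alpha> n)}
            \<subseteq> {w \<in> space ?P. Lambda_stat n (p n) (x n) w \<le> 0}"
          using np by auto
      qed measurable
      also have "\<dots> \<le> (1 - a) / 2"
        using elim(1)[rule_format, OF se] by simp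
      finally show False using a by simp
    qed
  qed
qed

end

section \<open>Assembly: score coverage, noise level and the oracle inequality\<close>

theorem corollary3:
  fixes M :: "nat \<Rightarrow> 'a measure"
    and p s :: "nat \<Rightarrow> nat"
    and x :: "nat \<Rightarrow> nat \<Rightarrow> nat \<Rightarrow> real"
    and y \<epsilon> :: "nat \<Rightarrow> nat \<Rightarrow> 'a \<Rightarrow> real"
    and \<beta>0 :: "nat \<Rightarrow> nat \<Rightarrow> real"
    and \<sigma> \<alpha> lam :: "nat \<Rightarrow> real"
    and F0 :: "nat \<Rightarrow> real measure"
    and \<F> :: "nat \<Rightarrow> real measure set"
    and \<beta>hat :: "nat \<Rightarrow> 'a \<Rightarrow> nat \<Rightarrow> real"
    and c cbar \<kappa> q \<eta> :: real
    and n0 :: nat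
    and choice :: penalty_choice
  assumes prob: "\<And>n. n \<ge> 1 \<Longrightarrow> prob_space (M n)"
    and p_lim: "filterlim p at_top sequentially"
    and alpha: "\<And>n. n \<ge> 1 \<Longrightarrow> 0 < \<alpha> n \<and> \<alpha> n < 1"
    and alpha_bdd: "\<exists>a<1. \<forall>n\<ge>1. \<alpha> n \<le> a"
    and beta0: "\<And>n. n \<ge> 1 \<Longrightarrow> \<beta>0 n \<in> Rvec (p n)"
    and sigma: "\<And>n. n \<ge> 1 \<Longrightarrow> \<sigma> n > 0"
    and model: "\<And>n i \<omega>. n \<ge> 1 \<Longrightarrow> i \<in> {1..n} \<Longrightarrow> \<omega> \<in> space (M n) \<Longrightarrow>
        y n i \<omega> = lin_pred (p n) (x n) (\<beta>0 n) i + \<sigma> n * \<epsilon> n i \<omega>"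
    and design: "\<And>n j. n \<ge> 1 \<Longrightarrow> j \<in> {1..p n} \<Longrightarrow> emp_mean n (\<lambda>i. (x n i j)\<^sup>2) = 1"
    and sparsity: "\<And>n. n \<ge> 1 \<Longrightarrow> s n = card (supp (\<beta>0 n)) \<and> s n < n"
    and indep: "\<And>n. n \<ge> 1 \<Longrightarrow> prob_space.indep_vars (M n) (\<lambda>_. borel) (\<epsilon> n) {1..n}"
    and law: "\<And>n i. n \<ge> 1 \<Longrightarrow> i \<in> {1..n} \<Longrightarrow> distr (M n) borel (\<epsilon> n i) = F0 n"
    and std: "\<And>n. n \<ge> 1 \<Longrightarrow> standardized_law (F0 n)"
    and c: "c > 1" "cbar = (c + 1) / (c - 1)"
    and family: "\<And>n F. n \<ge> 1 \<Longrightarrow> F \<in> \<F> n \<Longrightarrow> real_distribution F"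
    and RE: "n0 > 0" "\<kappa> > 0"
      "\<And>n. n > n0 \<Longrightarrow> re_kappa n (p n) (x n) (supp (\<beta>0 n)) cbar \<ge> ereal \<kappa>"
      "\<And>n. n > n0 \<Longrightarrow> re_kappa_tilde n (p n) (x n) (supp (\<beta>0 n)) cbar \<ge> ereal \<kappa>"
    and Mom: "q > 2"
      "\<And>n. n \<ge> 1 \<Longrightarrow> F0 n \<in> \<F> n"
      "(SUP n\<in>{1..}. SUP F\<in>\<F> n. \<integral>\<^sup>+ e. ennreal (\<bar>e\<bar> powr q) \<partial>F) < \<infinity>"
      "(SUP n\<in>{1..}. SUP j\<in>{1..p n}. ennreal (emp_mean n (\<lambda>i. \<bar>x n i j\<bar> powr q))) < \<infinity>"
    and Rate: "0 < \<eta>" "\<eta> < 1"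
      "eventually (\<lambda>n. real (p n) \<le> \<alpha> n * real n powr (\<eta> * (q - 2) / 2) / 2) sequentially"
      "(\<lambda>n. 1 / \<alpha> n) \<in> o(\<lambda>n. real n powr (max (min (q / 2 - 1) (q / 4)) (q / 2 - 2))
                              / ln (real n) powr (q / 2))"
    and growth: "(\<lambda>n. real (s n) / real n * ln (real (p n) / \<alpha> n)) \<longlonglongrightarrow> 0"
    and semi_exact: "\<And>n. choice = Semi_Exact \<Longrightarrow> n \<ge> 1 \<Longrightarrow>
        (\<forall>F\<in>\<F> n. standardized_law F) \<and> Lambda_max_exists n (p n) (x n) (\<F> n) (1 - \<alpha> n)"
    and penalty: "\<And>n. n \<ge> 1 \<Longrightarrow>
        lam n = penalty_level choice c n (p n) (x n) (F0 n) (\<F> n) (\<alpha> n)"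
    and estimator: "\<And>n \<omega>. n \<ge> 1 \<Longrightarrow> \<omega> \<in> space (M n) \<Longrightarrow>
        is_sqrt_lasso n (p n) (x n) (\<lambda>i. y n i \<omega>) (lam n) (\<beta>hat n \<omega>)"
  shows "\<exists>r \<rho> :: nat \<Rightarrow> real. r \<longlonglongrightarrow> 0 \<and> \<rho> \<in> o(\<alpha>) \<and>
    (\<forall>n\<ge>1. \<exists>A \<in> sets (M n). measure (M n) A \<ge> 1 - \<alpha> n - \<rho> n \<and>
      (\<forall>\<omega>\<in>A.
        let \<delta> = (\<lambda>j. \<beta>hat n \<omega> j - \<beta>0 n j); C = 2 * (1 + c) / (\<kappa> * (1 - r n)) in
        \<kappa> * l2_norm (p n) \<delta> \<le> pred_norm n (p n) (x n) \<delta> \<and>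
        pred_norm n (p n) (x n) \<delta>
          \<le> C * \<sigma> n * sqrt (2 * real (s n) * ln (2 * real (p n) / \<alpha> n) / real n)))"
proof -
  have Ksup: "(SUP n\<in>{1..}. SUP F\<in>\<F> n. \<integral>\<^sup>+ e. ennreal (\<bar>e\<bar> powr q) \<partial>F) < top"
    and Csup: "(SUP n\<in>{1..}. SUP j\<in>{1..p n}. ennreal (emp_mean n (\<lambda>i. \<bar>x n i j\<bar> powr q))) < top"
    using Mom(3,4) by (simp_all only: infinity_ennreal_def)
  \<comment> \<open>Finite suprema of extended nonnegative reals become real moment bounds that are
    uniform in n.\<close>
  define K where "K = enn2real (SUP n\<in>{1..}. SUP F\<in>\<F> n. \<integral>\<^sup>+ e. ennreal (\<bar>e\<bar> powr q) \<partial>F)"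
  define C where "C = enn2real (SUP n\<in>{1..}. SUP j\<in>{1..p n}. ennreal (emp_mean n (\<lambda>i. \<bar>x n i j\<bar> powr q)))"
  have K0: "0 \<le> K" and C0: "0 \<le> C" by (simp_all add: K_def C_def)
  have K: "(\<integral>\<^sup>+ e. ennreal (\<bar>e\<bar> powr q) \<partial>F) \<le> ennreal K" if "1 \<le> n" "F \<in> \<F> n" for n F
    unfolding K_def ennreal_enn2real[OF Ksup]
    by (rule SUP_upper2[of n], use that in simp, rule SUP_upper, rule that)
  have C: "emp_mean n (\<lambda>i. \<bar>x n i j\<bar> powr q) \<le> C" if "1 \<le> n" "j \<in> {1..p n}" for n j
  proof -
    have "ennreal (emp_mean n (\<lambda>i. \<bar>x n i j\<bar> powr q)) \<le> ennreal C"
      unfolding C_def ennreal_enn2real[OF Csup]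
      by (rule SUP_upper2[of n], use that in simp, rule SUP_upper, rule that)
    then show ?thesis using C0 by simp
  qed
  interpret D: asymptotic_design p \<alpha> x q \<eta> K C
    by unfold_locales (use Mom(1) Rate(1-3) K0 C0 p_lim alpha design C in blast)+
  have F0: "real_distribution (F0 n)" "standardized_law (F0 n)"
      "(\<integral>\<^sup>+ e. ennreal (\<bar>e\<bar> powr q) \<partial>F0 n) \<le> ennreal K" if "1 \<le> n" for n
    using family[OF that Mom(2)[OF that]] std[OF that] K[OF that Mom(2)[OF that]] by auto
  have se: "standardized_errors (M n) {1..n} (\<epsilon> n) q K" if n: "1 \<le> n" for n
    by (rule standardized_errorsI[OF prob[OF n] _ indep[OF n] law[OF n] F0(1,2)[OF n] Mom(1) F0(3)[OF n] K0]) auto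
  let ?\<Lambda> = "\<lambda>n w. Lambda_stat n (p n) (x n) (\<lambda>i. \<epsilon> n i w)"
  let ?Q = "\<lambda>n. Lambda_quantile n (p n) (x n) (F0 n) (1 - \<alpha> n)"
  let ?Qmax = "\<lambda>n. SUP F\<in>\<F> n. Lambda_quantile n (p n) (x n) F (1 - \<alpha> n)"
  have meas: "?\<Lambda> n \<in> borel_measurable (M n)" if "1 \<le> n" for n
    by (rule Lambda_stat_measurable) (use standardized_errors.e_measurable[OF se[OF that]] in auto)
  have F0_bounds: "eventually (\<lambda>n. ?Q n \<le> sqrt n * D.level n \<and>
      0 < ?Q n \<and>
      1 - \<alpha> n \<le> \<P>(w in (M n). ?\<Lambda> n w \<le> ?Q n)) sequentially"
    using D.Lambda_quantile_bounds D.Lambda_quantile_pos[OF alpha_bdd] eventually_ge_at_top[of 1]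
  proof eventually_elim
    case (elim n)
    then show ?case
      using F0[OF elim(3)] measure_Lambda_stat_le_PiM[OF prob[OF elim(3)] elim(3) indep[OF elim(3)] law[OF elim(3)]]
      by simp
  qed
  \<comment> \<open>The bound valid for every law of the family also bounds the set of quantiles
    above, as the real supremum requires.\<close>
  have semi: "eventually (\<lambda>n. ?Q n
        \<le> ?Qmax n \<and>
      ?Qmax n \<le> sqrt n * D.level n) sequentially"
    if ch: "choice = Semi_Exact"
    using D.Lambda_quantile_bounds eventually_ge_at_top[of 1]
  proof eventually_elim
    case (elim n)
    have le: "Lambda_quantile n (p n) (x n) F (1 - \<alpha> n) \<le> sqrt n * D.level n" if F: "F \<in> \<F> n" for F
      using elim(1) family[OF elim(2) F] semi_exact[OF ch elim(2)] F K[OF elim(2) F] by blast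
    show ?case
    proof
      show "?Q n \<le> ?Qmax n"
        by (rule cSUP_upper[OF Mom(2)[OF elim(2)]]) (use le in \<open>auto intro!: bdd_aboveI2\<close>)
      show "?Qmax n \<le> sqrt n * D.level n"
        by (rule cSUP_least) (use le Mom(2)[OF elim(2)] in auto)
    qed
  qed
  \<comment> \<open>Positivity comes from divergence of the normal quantile for the asymptotic
    option and from anticoncentration for the other two; the maximum inherits it from F0, a member
    of the family.\<close>
  have lam_bounds: "eventually (\<lambda>n. 0 < lam n \<and> lam n \<le> c * (sqrt n * D.level n)) sequentially"
  proof (cases choice)
    case Asymptotic
    have "eventually (\<lambda>n. 1 \<le> D.asymptotic_level n) sequentially"
      using D.asymptotic_level_lim by (simp add: filterlim_at_top)
    then show ?thesis
      using eventually_ge_at_top[of 1] D.p1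
    proof eventually_elim
      case (elim n)
      have "lam n = c * (sqrt n * D.asymptotic_level n)"
        using penalty[OF elim(2)] Asymptotic by (simp add: D.asymptotic_level_def)
      moreover have "sqrt n * D.asymptotic_level n \<le> sqrt n * D.level n"
        using D.asymptotic_level_le_level[OF elim(2,3)] by (intro mult_left_mono) auto
      ultimately show ?case using c(1) elim by simp
    qed
  next
    case Exact
    show ?thesis using F0_bounds eventually_ge_at_top[of 1]
    proof eventually_elim
      case (elim n)
      then show ?case using penalty[OF elim(2)] Exact c(1) by simp
    qed
  next
    case Semi_Exact
    show ?thesis using F0_bounds semi[OF Semi_Exact] eventually_ge_at_top[of 1]
    proof eventually_elim
      case (elim n)
      have "0 < ?Qmax n" using elim by linarith
      then show ?case using penalty[OF elim(3)] Semi_Exact c(1) elim(2) by simp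
    qed
  qed
  \<comment> \<open>The quantile options cover with probability at least 1 - \<alpha>. The
    asymptotic option loses \<gamma> \<alpha>, half of it from the relative and half from the
    additive error of the moderate deviation bound.\<close>
  have coverage: "eventually (\<lambda>n. 1 - \<alpha> n - \<gamma> * \<alpha> n \<le> \<P>(w in (M n). c * ?\<Lambda> n w \<le> lam n)) sequentially"
    if \<gamma>: "0 < \<gamma>" for \<gamma>
  proof (cases "choice = Asymptotic")
    case True
    have \<gamma>2: "0 < \<gamma> / 2" using \<gamma> by simp
    have al: "eventually (\<lambda>n. D.asymptotic_level n \<le> sqrt (\<eta> * (q - 2) * ln n)) sequentially"
      using D.level_le eventually_ge_at_top[of 1] D.p1
      by eventually_elim (use D.asymptotic_level_le_level in \<open>blast intro: order_trans\<close>)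
    have "eventually (\<lambda>n. \<forall>(M :: 'a measure) e. standardized_errors M {1..n} e q K \<longrightarrow>
        \<P>(w in M. sqrt n * D.asymptotic_level n < Lambda_stat n (p n) (x n) (\<lambda>i. e i w))
          \<le> 2 * real (p n) * normal_tail (D.asymptotic_level n) * (1 + \<gamma> / 2) + \<gamma> / 2 * \<alpha> n) sequentially"
      by (rule D.Lambda_stat_moderate_deviation[OF \<gamma>2 D.asymptotic_level_lim al])
    then show ?thesis using eventually_ge_at_top[of 1] D.p1
    proof eventually_elim
      case (elim n)
      interpret prob_space "M n" by (rule prob[OF elim(2)])
      note [measurable] = meas[OF elim(2)]
      have lam: "lam n = c * (sqrt n * D.asymptotic_level n)"
        using penalty[OF elim(2)] True by (simp add: D.asymptotic_level_def)
      have "\<P>(w in (M n). sqrt n * D.asymptotic_level n < ?\<Lambda> n w)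
          \<le> 2 * real (p n) * normal_tail (D.asymptotic_level n) * (1 + \<gamma> / 2) + \<gamma> / 2 * \<alpha> n"
        using elim(1) se[OF elim(2)] by blast
      also have "\<dots> = \<alpha> n + \<gamma> * \<alpha> n"
        using elim(3) unfolding D.normal_tail_asymptotic_level[OF elim(2,3)] by (simp add: field_simps)
      finally have "\<P>(w in (M n). sqrt n * D.asymptotic_level n < ?\<Lambda> n w) \<le> \<alpha> n + \<gamma> * \<alpha> n" .
      moreover have "\<P>(w in (M n). \<not> (sqrt n * D.asymptotic_level n < ?\<Lambda> n w))
          = 1 - \<P>(w in (M n). sqrt n * D.asymptotic_level n < ?\<Lambda> n w)"
        by (rule prob_neg) measurable
      moreover have "{w \<in> space (M n). \<not> (sqrt n * D.asymptotic_level n < ?\<Lambda> n w)}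
          = {w \<in> space (M n). c * ?\<Lambda> n w \<le> lam n}"
        using c(1) by (auto simp: lam not_less)
      ultimately show ?case by simp
    qed
  next
    case False
    have "eventually (\<lambda>n. c * ?Q n \<le> lam n) sequentially"
    proof (cases choice)
      case Exact
      show ?thesis using eventually_ge_at_top[of 1] by eventually_elim (use penalty Exact in simp)
    next
      case Semi_Exact
      show ?thesis using semi[OF Semi_Exact] eventually_ge_at_top[of 1]
        by eventually_elim (use penalty Semi_Exact c(1) in simp)
    qed (use False in simp)
    then show ?thesis using F0_bounds eventually_ge_at_top[of 1]
    proof eventually_elim
      case (elim n)
      interpret prob_space "M n" by (rule prob[OF elim(3)])
      note [measurable] = meas[OF elim(3)]
      have "1 - \<alpha> n \<le> \<P>(w in (M n). ?\<Lambda> n w \<le> ?Q n)"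
        using elim(2) by blast
      also have "\<dots> \<le> \<P>(w in (M n). c * ?\<Lambda> n w \<le> lam n)"
      proof (rule finite_measure_mono)
        show "{w \<in> space (M n). ?\<Lambda> n w \<le> ?Q n}
            \<subseteq> {w \<in> space (M n). c * ?\<Lambda> n w \<le> lam n}"
        proof (intro subsetI CollectI conjI)
          fix w assume w: "w \<in> {w \<in> space (M n). ?\<Lambda> n w \<le> ?Q n}"
          then show "w \<in> space (M n)" by simp
          have "c * ?\<Lambda> n w \<le> c * ?Q n"
            using w c(1) by (intro mult_left_mono) auto
          then show "c * ?\<Lambda> n w \<le> lam n" using elim(1) by linarith
        qed
      qed measurable
      finally show ?case using \<gamma> alpha[OF elim(3)] mult_pos_pos[of \<gamma> "\<alpha> n"] by linarith
    qed
  qed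
  define R where "R = max 1 ((1 + cbar) / c)"
  define Lb where "Lb = (\<lambda>n. c * D.level n * sqrt (real (s n) / real n) / \<kappa>)"
  define G where "G = (\<lambda>n. (R * Lb n)\<^sup>2)"
  define W where "W = (\<lambda>n::nat. sqrt (1 + 1 / sqrt (ln n)))"
  \<comment> \<open>Chosen so that 1 - r n = (1 - G n) / W n exactly, where G bounds the quadratic
    term of the oracle inequality and W the root mean square of the errors.\<close>
  define r where "r = (\<lambda>n. 1 - (1 - G n) / W n)"
  \<comment> \<open>The conclusion is claimed for every n \<ge> 1. Where one of these eventual
    conditions fails, A n is empty and \<rho> n takes up the whole deficit in probability.\<close>
  define good where "good = (\<lambda>n. 3 \<le> n \<and> n0 < n \<and> 1 \<le> D.level n \<and> 0 < lam n \<and> lam n \<le> c * (sqrt n * D.level n) \<and> G n < 1)"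
  define A where "A = (\<lambda>n. if good n then {w \<in> space (M n). c * ?\<Lambda> n w \<le> lam n \<and>
      (\<Sum>i=1..n. (\<epsilon> n i w)\<^sup>2) \<le> real n * (1 + 1 / sqrt (ln n))} else {})"
  define \<rho> where "\<rho> = (\<lambda>n. max 0 (1 - \<alpha> n - measure (M n) (A n)))"
  have G_lim: "G \<longlonglongrightarrow> 0"
  proof -
    have "(\<lambda>n. 4 * (R * c / \<kappa>)\<^sup>2 * (real (s n) / real n * ln (real (p n) / \<alpha> n))) \<longlonglongrightarrow> 0"
      by (rule tendsto_mult_right_zero[OF growth])
    \<comment> \<open>For u = p/\<alpha> \<ge> 2 one has ln(2u) \<le> 2 ln u, which reconciles the
      2p of the level with the p of the growth condition.\<close>
    moreover have "eventually (\<lambda>n. 2 \<le> real (p n) / \<alpha> n) sequentially"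
      using D.p_over_\<alpha>_lim by (simp add: filterlim_at_top)
    then have "eventually (\<lambda>n. norm (G n) \<le> 4 * (R * c / \<kappa>)\<^sup>2 * (real (s n) / real n * ln (real (p n) / \<alpha> n))) sequentially"
    proof eventually_elim
      case (elim n)
      let ?u = "real (p n) / \<alpha> n"
      have u: "0 < ?u" using elim by linarith
      have "ln 2 \<le> ln ?u" using elim u by (subst ln_le_cancel_iff) auto
      moreover have "ln (2 * ?u) = ln 2 + ln ?u" using u by (intro ln_mult_pos) auto
      moreover have "0 \<le> ln (2 :: real)" by simp
      ultimately have l: "2 * ln (2 * ?u) \<le> 4 * ln ?u" "0 \<le> 2 * ln (2 * ?u)" by linarith+
      have lev: "(D.level n)\<^sup>2 \<le> 4 * ln ?u"
        using l by (simp add: D.level_def)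
      have "G n = (R * c / \<kappa>)\<^sup>2 * (real (s n) / real n * (D.level n)\<^sup>2)"
        by (simp add: G_def Lb_def power_mult_distrib power_divide ac_simps)
      also have "\<dots> \<le> (R * c / \<kappa>)\<^sup>2 * (real (s n) / real n * (4 * ln ?u))"
        using lev by (intro mult_left_mono) auto
      finally have "G n \<le> 4 * (R * c / \<kappa>)\<^sup>2 * (real (s n) / real n * ln ?u)" by (simp add: ac_simps)
      moreover have "0 \<le> G n" by (simp add: G_def)
      ultimately show ?case by simp
    qed
    ultimately show ?thesis by (rule Lim_null_comparison[rotated])
  qed
  have "W \<longlonglongrightarrow> 1" unfolding W_def by real_asymp
  then have "r \<longlonglongrightarrow> 1 - (1 - 0) / 1"
    unfolding r_def by (intro tendsto_intros G_lim) auto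
  then have r_lim: "r \<longlonglongrightarrow> 0" by simp
  have good_ev: "eventually good sequentially"
  proof -
    have "eventually (\<lambda>n. G n < 1) sequentially" by (rule order_tendstoD[OF G_lim]) simp
    moreover have "eventually (\<lambda>n. 1 \<le> D.level n) sequentially"
      using D.level_lim by (simp add: filterlim_at_top)
    ultimately show ?thesis
      using lam_bounds eventually_ge_at_top[of 3] eventually_gt_at_top[of n0]
      by eventually_elim (simp add: good_def)
  qed
  have A_sets: "A n \<in> sets (M n)" if "1 \<le> n" for n
  proof -
    have [measurable]: "?\<Lambda> n \<in> borel_measurable (M n)" by (rule meas[OF that])
    have [measurable]: "\<epsilon> n i \<in> borel_measurable (M n)" if "i \<in> {1..n}" for i
      by (rule standardized_errors.e_measurable[OF se[OF \<open>1 \<le> n\<close>] that])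
    have [measurable]: "(\<lambda>w. \<Sum>i=1..n. (\<epsilon> n i w)\<^sup>2) \<in> borel_measurable (M n)" by measurable
    have "{w \<in> space (M n). c * ?\<Lambda> n w \<le> lam n \<and>
        (\<Sum>i=1..n. (\<epsilon> n i w)\<^sup>2) \<le> real n * (1 + 1 / sqrt (ln n))} \<in> sets (M n)"
      by measurable
    then show ?thesis unfolding A_def by (cases "good n") (simp_all only: if_True if_False sets.empty_sets)
  qed
  have "\<rho> \<in> o(\<alpha>)"
  proof (rule landau_o.smallI)
    fix \<gamma> :: real assume \<gamma>: "0 < \<gamma>"
    have \<gamma>2: "0 < \<gamma> / 2" using \<gamma> by simp
    have "eventually (\<lambda>n. \<forall>(M :: 'a measure) e. standardized_errors M {1..n} e q K \<longrightarrow>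
        \<P>(w in M. real n * (1 + 1 / sqrt (ln n)) < (\<Sum>i=1..n. (e i w)\<^sup>2)) \<le> \<gamma> / 2 * \<alpha> n) sequentially"
      by (rule D.squares_upper_tail_rate[OF \<gamma>2 Rate(4)])
    then show "eventually (\<lambda>n. norm (\<rho> n) \<le> \<gamma> * norm (\<alpha> n)) sequentially"
      using coverage[OF \<gamma>2] good_ev eventually_ge_at_top[of 1]
    proof eventually_elim
      case (elim n)
      interpret prob_space "M n" by (rule prob[OF elim(4)])
      let ?B = "{w \<in> space (M n). real n * (1 + 1 / sqrt (ln n)) < (\<Sum>i=1..n. (\<epsilon> n i w)\<^sup>2)}"
      have [measurable]: "\<epsilon> n i \<in> borel_measurable (M n)" if "i \<in> {1..n}" for i
        by (rule standardized_errors.e_measurable[OF se[OF elim(4)] that])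
      have B: "?B \<in> events"
      proof -
        have [measurable]: "(\<lambda>w. \<Sum>i=1..n. (\<epsilon> n i w)\<^sup>2) \<in> borel_measurable (M n)" by measurable
        show ?thesis by measurable
      qed
      have "1 - \<alpha> n - \<gamma> / 2 * \<alpha> n \<le> \<P>(w in (M n). c * ?\<Lambda> n w \<le> lam n)" by fact
      also have "\<dots> \<le> prob (A n \<union> ?B)"
        using elim(3) by (intro finite_measure_mono sets.Un A_sets elim(4) B) (auto simp: A_def not_less)
      also have "\<dots> \<le> prob (A n) + prob ?B"
        by (intro measure_Un_le A_sets elim(4) B)
      also have "prob ?B \<le> \<gamma> / 2 * \<alpha> n" using elim(1) se[OF elim(4)] by blast
      finally have "1 - \<alpha> n - prob (A n) \<le> \<gamma> * \<alpha> n" by simp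
      moreover have "0 \<le> \<gamma> * \<alpha> n" using \<gamma> alpha[OF elim(4)] by simp
      ultimately show ?case using alpha[OF elim(4)] by (simp add: \<rho>_def)
    qed
  qed
  moreover have "\<exists>A \<in> sets (M n). measure (M n) A \<ge> 1 - \<alpha> n - \<rho> n \<and>
      (\<forall>w\<in>A.
        let \<delta> = (\<lambda>j. \<beta>hat n w j - \<beta>0 n j); C = 2 * (1 + c) / (\<kappa> * (1 - r n)) in
        \<kappa> * l2_norm (p n) \<delta> \<le> pred_norm n (p n) (x n) \<delta> \<and>
        pred_norm n (p n) (x n) \<delta>
          \<le> C * \<sigma> n * sqrt (2 * real (s n) * ln (2 * real (p n) / \<alpha> n) / real n))"
    (is "\<exists>A\<in>_. _ \<and> (\<forall>w\<in>A. ?concl w)") if n: "1 \<le> n" for n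
  proof (rule bexI[OF conjI A_sets[OF n]])
    show "1 - \<alpha> n - \<rho> n \<le> measure (M n) (A n)" by (simp add: \<rho>_def)
    show "\<forall>w\<in>A n. ?concl w"
    proof
      fix w assume w: "w \<in> A n"
      then have g: "good n" by (auto simp: A_def split: if_splits)
      then have sp: "w \<in> space (M n)" and sc: "c * ?\<Lambda> n w \<le> lam n"
        and sq: "(\<Sum>i=1..n. (\<epsilon> n i w)\<^sup>2) \<le> real n * (1 + 1 / sqrt (ln n))"
        using w by (auto simp: A_def)
      have lev: "1 \<le> D.level n" and lam: "0 < lam n" "lam n \<le> c * (sqrt n * D.level n)"
        and G1: "G n < 1" and nn: "n0 < n" using g by (auto simp: good_def)
      let ?L = "lam n * sqrt (card (supp (\<beta>0 n))) / (real n * \<kappa>)"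
      let ?\<delta> = "\<lambda>j. \<beta>hat n w j - \<beta>0 n j"
      have L0: "0 \<le> ?L" using lam RE(2) by simp
      have LLb: "?L \<le> Lb n"
      proof -
        have sn: "real (card (supp (\<beta>0 n))) = real (s n)" using sparsity[OF n] by simp
        have "?L \<le> c * (sqrt n * D.level n) * sqrt (s n) / (real n * \<kappa>)"
          unfolding sn using lam RE(2) by (intro divide_right_mono mult_right_mono) auto
        also have "\<dots> = c * D.level n * (sqrt n * sqrt (s n) / real n) / \<kappa>" by simp
        also have "sqrt n * sqrt (s n) / real n = sqrt (real (s n) / real n)"
        proof -
          have "real n = sqrt n * sqrt n" by simp
          then have "sqrt n * sqrt (s n) / real n = sqrt n * sqrt (s n) / (sqrt n * sqrt n)" by simp
          also have "\<dots> = sqrt (s n) / sqrt n"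
            by (rule nonzero_mult_divide_mult_cancel_left) (use n in simp)
          also have "\<dots> = sqrt (real (s n) / real n)" by (simp only: real_sqrt_divide)
          finally show ?thesis .
        qed
        finally show ?thesis by (simp add: Lb_def)
      qed
      have R0: "0 \<le> R" by (simp add: R_def)
      have GL: "(R * ?L)\<^sup>2 \<le> G n"
        unfolding G_def by (intro power_mono mult_left_mono LLb R0 mult_nonneg_nonneg L0)
      then have RL: "(max 1 ((1 + cbar) / c) * ?L)\<^sup>2 < 1" using G1 by (simp add: R_def)
      have yw: "y n i w = lin_pred (p n) (x n) (\<beta>0 n) i + \<sigma> n * \<epsilon> n i w" if "i \<in> {1..n}" for i
        by (rule model[OF n that sp])
      note bound = sqrt_lasso_bound[OF n beta0[OF n] sigma[OF n] yw estimator[OF n sp] c RE(2)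
          RE(3)[OF nn] RE(4)[OF nn] lam(1) sc RL]
      have ve: "sqrt (emp_mean n (\<lambda>i. (\<epsilon> n i w)\<^sup>2)) \<le> W n"
        unfolding W_def by (rule real_sqrt_le_mono) (use sq n in \<open>simp add: emp_mean_def pos_divide_le_eq mult.commute\<close>)
      have W0: "0 < W n"
      proof -
        have "1 \<le> ln n"
        proof -
          have "3 \<le> n" using g by (simp add: good_def)
          then have "exp 1 \<le> real n" "0 < real n" using exp_le by linarith+
          then show ?thesis by (simp add: ln_ge_iff)
        qed
        then have "0 \<le> 1 / sqrt (ln n)" by simp
        then show ?thesis unfolding W_def by (intro real_sqrt_gt_zero) linarith
      qed
      have "pred_norm n (p n) (x n) ?\<delta>
          \<le> 2 * (1 + 1 / c) * ?L * (\<sigma> n * sqrt (emp_mean n (\<lambda>i. (\<epsilon> n i w)\<^sup>2))) / (1 - (R * ?L)\<^sup>2)"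
        using bound(2) unfolding R_def .
      \<comment> \<open>The bound increases with L and with the empirical noise level, so both may
        be replaced by their majorants Lb n and W n.\<close>
      also have "\<dots> \<le> 2 * (1 + 1 / c) * Lb n * (\<sigma> n * W n) / (1 - G n)"
        using L0 LLb GL G1 ve sigma[OF n] c(1) W0
        by (intro frac_le mult_mono mult_left_mono mult_nonneg_nonneg) (auto simp: emp_mean_nonneg)
      also have "\<dots> = 2 * (1 + c) / (\<kappa> * (1 - r n)) * \<sigma> n * (D.level n * sqrt (real (s n) / real n))"
      proof -
        have "2 * (1 + 1 / c) * c = 2 * (1 + c)" using c(1) by (simp add: field_simps)
        then have "2 * (1 + 1 / c) * Lb n = 2 * (1 + c) * (D.level n * sqrt (real (s n) / real n)) / \<kappa>"
          unfolding Lb_def by (metis (no_types, lifting) mult.assoc times_divide_eq_right)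
        moreover have "1 - r n = (1 - G n) / W n" by (simp add: r_def)
        ultimately show ?thesis using W0 by simp
      qed
      also have "D.level n * sqrt (real (s n) / real n) = sqrt (2 * real (s n) * ln (2 * real (p n) / \<alpha> n) / real n)"
        by (simp add: D.level_def flip: real_sqrt_mult)
      finally show "?concl w"
        using bound(1) by (simp only: Let_def)
    qed
  qed
  ultimately show ?thesis using r_lim by blast
qed

end
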